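(* Let $\mathcal{F}$ be a class of graphs and let $\delta$ be a pseudometric on graphons such that (1) $\delta$ is compatible with $\delta_\square$, and (2) for all graphons $U,W$, $\delta(U,W)=0$ implies $t(F,U)=t(F,W)$ for every $F\in\mathcal{F}$. Then for every graph $F\in\mathcal{F}$ and every $\epsilon>0$ there is an $\eta>0$ such that, for all graphons $U,W$, if $\delta(U,W)\le\eta$ then $\lvert t(F,U)-t(F,W)\rvert\le\epsilon$.
   Context: A graphon is a symmetric measurable function $W\colon[0,1]^2\to[0,1]$. For a finite simple graph $F$ and a graphon $W$, $t(F,W)=\int_{[0,1]^{V(F)}}\prod_{ij\in E(F)}W(x_i,x_j)\prod_{i\in V(F)}dx_i$. The cut norm of a bounded symmetric measurable $W\colon[0,1]^2\to\mathbb{R}$ is $\|W\|_\square=\sup_{S,T\subseteq[0,1]}\lvert\int_{S\times T}W(x,y)\,dx\,dy\rvert$ (over measurable sets). For an invertible measure-preserving map $\varphi\colon[0,1]\to[0,1]$ let $W^\varphi(x,y)=W(\varphi(x),\varphi(y))$; the cut distance is $\delta_\square(U,W)=\inf_{\varphi}\|U-W^\varphi\|_\square$, the infimum over all invertible measure-preserving maps. A pseudometric $\delta$ on graphons is compatible with $\delta_\square$ if for every sequence of graphons $(U_n)_n$ and every graphon $\widetilde U$, $\delta_\square(U_n,\widetilde U)\to0$ implies $\delta(U_n,\widetilde U)\to0$. *)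

theory Defs
  imports "HOL-Analysis.Analysis"
begin

text \<open>Measurability is Lebesgue measurability throughout.  Graphons are taken to be extensional
  functions, so that the set below is exactly a set of functions on the unit square and two
  graphons are never distinguished by junk values outside it.\<close>

definition graphons :: "(real \<times> real \<Rightarrow> real) set" where
  "graphons = {W \<in> {0..1} \<times> {0..1} \<rightarrow>\<^sub>E {0..1}.
     W \<in> borel_measurable (lebesgue_on ({0..1} \<times> {0..1})) \<and>
     (\<forall>x\<in>{0..1}. \<forall>y\<in>{0..1}. W (x, y) = W (y, x))}"

record 'a graph =
  verts :: "'a set"
  edges :: "'a set set"

definition finite_simple_graph :: "'a graph \<Rightarrow> bool" where
  "finite_simple_graph F \<longleftrightarrow>
     finite (verts F) \<and> (\<forall>e\<in>edges F. e \<subseteq> verts F \<and> card e = 2)"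

text \<open>An edge is an unordered pair \<open>{i, j}\<close>; by symmetry of \<open>W\<close> the factor \<open>W (x i, x j)\<close> does
  not depend on the order in which its ends are listed, see \<open>edge_factor_eq\<close>.\<close>

definition edge_factor :: "(real \<times> real \<Rightarrow> real) \<Rightarrow> ('a \<Rightarrow> real) \<Rightarrow> 'a set \<Rightarrow> real" where
  "edge_factor W x e = (THE r. \<exists>i j. e = {i, j} \<and> r = W (x i, x j))"

lemma edge_factor_eq:
  assumes "W \<in> graphons" "x i \<in> {0..1}" "x j \<in> {0..1}"
  shows "edge_factor W x {i, j} = W (x i, x j)"
  unfolding edge_factor_def
proof (rule the_equality)
  show "\<exists>i' j'. {i, j} = {i', j'} \<and> W (x i, x j) = W (x i', x j')"
    by blast
next
  fix r
  assume "\<exists>i' j'. {i, j} = {i', j'} \<and> r = W (x i', x j')"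
  moreover have "W (x i, x j) = W (x j, x i)"
    using assms by (auto simp: graphons_def)
  ultimately show "r = W (x i, x j)"
    by (auto simp: doubleton_eq_iff)
qed

text \<open>The product measure is completed because, for a Lebesgue measurable \<open>W\<close>, the integrand is
  in general measurable only with respect to Lebesgue measure on the cube.\<close>

definition hom_density :: "'a graph \<Rightarrow> (real \<times> real \<Rightarrow> real) \<Rightarrow> real" where
  "hom_density F W =
     (\<integral>x. (\<Prod>e\<in>edges F. edge_factor W x e)
        \<partial>completion (\<Pi>\<^sub>M i\<in>verts F. lebesgue_on {0..1}))"

definition cut_norm :: "(real \<times> real \<Rightarrow> real) \<Rightarrow> real" where
  "cut_norm W =
     (SUP (S, T) \<in> sets (lebesgue_on {0..1}) \<times> sets (lebesgue_on {0..1}).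
        \<bar>set_lebesgue_integral lebesgue (S \<times> T) W\<bar>)"

definition invertible_measure_preserving :: "(real \<Rightarrow> real) \<Rightarrow> bool" where
  "invertible_measure_preserving \<phi> \<longleftrightarrow>
     bij_betw \<phi> {0..1} {0..1} \<and>
     \<phi> \<in> lebesgue_on {0..1} \<rightarrow>\<^sub>M lebesgue_on {0..1} \<and>
     inv_into {0..1} \<phi> \<in> lebesgue_on {0..1} \<rightarrow>\<^sub>M lebesgue_on {0..1} \<and>
     distr (lebesgue_on {0..1}) (lebesgue_on {0..1}) \<phi> = lebesgue_on {0..1}"

definition cut_distance :: "(real \<times> real \<Rightarrow> real) \<Rightarrow> (real \<times> real \<Rightarrow> real) \<Rightarrow> real" where
  "cut_distance U W =
     (INF \<phi> \<in> {\<phi>. invertible_measure_preserving \<phi>}.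
        cut_norm (\<lambda>(x, y). U (x, y) - W (\<phi> x, \<phi> y)))"

definition pseudometric_on :: "'b set \<Rightarrow> ('b \<Rightarrow> 'b \<Rightarrow> real) \<Rightarrow> bool" where
  "pseudometric_on A d \<longleftrightarrow>
     (\<forall>x\<in>A. \<forall>y\<in>A. 0 \<le> d x y) \<and>
     (\<forall>x\<in>A. d x x = 0) \<and>
     (\<forall>x\<in>A. \<forall>y\<in>A. d x y = d y x) \<and>
     (\<forall>x\<in>A. \<forall>y\<in>A. \<forall>z\<in>A. d x z \<le> d x y + d y z)"

definition compatible_with_cut_distance ::
    "((real \<times> real \<Rightarrow> real) \<Rightarrow> (real \<times> real \<Rightarrow> real) \<Rightarrow> real) \<Rightarrow> bool" where
  "compatible_with_cut_distance \<delta> \<longleftrightarrow>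
     (\<forall>U V. (\<forall>n::nat. U n \<in> graphons) \<longrightarrow> V \<in> graphons \<longrightarrow>
        (\<lambda>n. cut_distance (U n) V) \<longlonglongrightarrow> 0 \<longrightarrow> (\<lambda>n. \<delta> (U n) V) \<longlonglongrightarrow> 0)"

end

theory Submission
  imports Defs "HOL-Probability.Infinite_Product_Measure" "HOL-Library.Diagonal_Subsequence"
begin

text \<open>The theorem follows by contradiction from sequential compactness of the space of graphons
  under the cut distance, along which every homomorphism density converges by the counting lemma.

  Compactness is proved without martingales and without the isomorphism theorem for Lebesgue
  spaces.  A greedy weak regularity lemma writes a graphon, up to \<open>e\<close> in cut norm, as a signed sum of
  boundedly many rectangles whose sides are unions of dyadic intervals.  Two graphons with the same signs
  and nearly the same sizes of the atoms generated by these sides are close after a permutation of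
  dyadic intervals, so by the pigeonhole principle and a diagonal argument some subsequence is,
  after rearrangement, Cauchy in cut norm.  Its limit is the Radon--Nikodym density of the limit
  of the measures \<open>A \<mapsto> \<integral>\<^sub>A V\<^sub>n\<close>.\<close>

section \<open>Weak limits of functions with values in the unit interval\<close>

text \<open>The hypotheses are not quantitative: compatibility controls \<open>\<delta>\<close> only
  near one fixed limit, and the condition on densities speaks only of pairs at distance exactly 0. A
  violating sequence of pairs therefore has to be replaced by a pair of limits, which is what
  compactness is for. The infimum in \<open>cut_distance\<close> runs over genuine bijections of the
  interval with measurable inverse, so partitions of equal sizes must be carried onto one another by
  explicit maps. Dyadic sides turn this into a finite matching of intervals of equal length, and the
  dyadic level, which is not bounded along the sequence, drops out of the estimates. Products of
  Lebesgue measures are not complete, so the analysis is done with Borel functions bounded at every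
  point; graphons enter and leave through almost everywhere equality. Symmetry is not tracked
  through the greedy decomposition and the weak limit; it is put back by averaging the limit with
  its transpose.\<close>

lemma (in prob_space) integrable_bounded:
  fixes g :: "'a \<Rightarrow> real"
  assumes "g \<in> borel_measurable M" "\<And>x. \<bar>g x\<bar> \<le> B"
  shows "integrable M g"
  by (rule integrable_const_bound[of _ B]) (use assms in auto)

lemma (in prob_space) set_integrable_bounded:
  fixes g :: "'a \<Rightarrow> real"
  assumes "g \<in> borel_measurable M" "\<And>x. \<bar>g x\<bar> \<le> B" "A \<in> sets M"
  shows "set_integrable M A g"
  unfolding set_integrable_def
  by (rule integrable_mult_indicator[OF assms(3) integrable_bounded[OF assms(1,2)]])

lemma (in prob_space) abs_integral_le:
  fixes g :: "'a \<Rightarrow> real"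
  assumes "\<And>x. x \<in> space M \<Longrightarrow> \<bar>g x\<bar> \<le> B" "0 \<le> B"
  shows "\<bar>\<integral>x. g x \<partial>M\<bar> \<le> B"
proof (cases "integrable M g")
  case True
  have "\<bar>\<integral>x. g x \<partial>M\<bar> \<le> (\<integral>x. \<bar>g x\<bar> \<partial>M)" by (rule integral_abs_bound)
  also have "\<dots> \<le> (\<integral>x. B \<partial>M)"
    using True assms by (intro integral_mono) auto
  finally show ?thesis by (simp add: prob_space)
\<comment> \<open>A nonintegrable \<open>g\<close> has integral 0 by convention, which lies within
  the bound because \<open>0 \<le> B\<close>.\<close>
qed (use assms in \<open>simp add: not_integrable_integral_eq\<close>)

lemma (in prob_space) set_integrable_unit:
  fixes g :: "'a \<Rightarrow> real"
  assumes "g \<in> borel_measurable M" "\<And>x. 0 \<le> g x \<and> g x \<le> 1" "A \<in> sets M"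
  shows "set_integrable M A g"
proof (rule set_integrable_bounded[where B=1])
  show "\<bar>g x\<bar> \<le> 1" for x using assms(2)[of x] by simp
qed (use assms in auto)

lemma (in prob_space) set_integral_nonneg_le_prob:
  fixes g :: "'a \<Rightarrow> real"
  assumes g: "g \<in> borel_measurable M" "\<And>x. 0 \<le> g x \<and> g x \<le> 1" and A: "A \<in> sets M"
  shows "0 \<le> (LINT x:A|M. g x)" "(LINT x:A|M. g x) \<le> prob A"
proof -
  show "0 \<le> (LINT x:A|M. g x)"
    unfolding set_lebesgue_integral_def using g by (intro Bochner_Integration.integral_nonneg) auto
  have "(LINT x:A|M. g x) \<le> (LINT x:A|M. 1)"
    using g A by (intro set_integral_mono set_integrable_unit) auto
  also have "\<dots> = prob A" using A by (simp add: set_lebesgue_integral_def)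
  finally show "(LINT x:A|M. g x) \<le> prob A" .
qed

lemma (in prob_space) measure_density_eq_set_integral:
  fixes g :: "'a \<Rightarrow> real"
  assumes g: "g \<in> borel_measurable M" "\<And>x. 0 \<le> g x \<and> g x \<le> 1" and A: "A \<in> sets M"
  shows "emeasure (density M (\<lambda>x. ennreal (g x))) A = ennreal (LINT x:A|M. g x)"
proof -
  have [measurable]: "g \<in> borel_measurable M" "A \<in> sets M" by fact+
  have "emeasure (density M (\<lambda>x. ennreal (g x))) A = (\<integral>\<^sup>+x. ennreal (g x) * indicator A x \<partial>M)"
    by (simp add: emeasure_density A)
  also have "\<dots> = (\<integral>\<^sup>+x. ennreal (indicator A x *\<^sub>R g x) \<partial>M)"
    by (intro nn_integral_cong) (auto split: split_indicator)
  also have "\<dots> = ennreal (\<integral>x. indicator A x *\<^sub>R g x \<partial>M)"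
    using g set_integrable_unit[OF g A]
    by (intro nn_integral_eq_integral) (auto simp: set_integrable_def)
  finally show ?thesis by (simp add: set_lebesgue_integral_def)
qed

text \<open>Reading the set integral as the measure with density \<open>g\<close> turns the claim
  into countable additivity of a finite measure.\<close>

lemma (in prob_space) set_integral_sums:
  fixes g :: "'a \<Rightarrow> real"
  assumes g: "g \<in> borel_measurable M" "\<And>x. 0 \<le> g x \<and> g x \<le> 1"
    and A: "range A \<subseteq> sets M" "disjoint_family A"
  shows "(\<lambda>k. LINT x:A k|M. g x) sums (LINT x:(\<Union>k. A k)|M. g x)"
proof -
  let ?D = "density M (\<lambda>x. ennreal (g x))"
  have m: "measure ?D B = (LINT x:B|M. g x)" if "B \<in> sets M" for B
    using measure_density_eq_set_integral[OF g that] set_integral_nonneg_le_prob(1)[OF g that]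
    by (simp add: measure_def)
  interpret D: finite_measure ?D
    by (rule finite_measureI) (simp add: measure_density_eq_set_integral[OF g])
  have "(\<lambda>k. measure ?D (A k)) sums measure ?D (\<Union>k. A k)"
    using A by (intro D.finite_measure_UNION) auto
  moreover have "A k \<in> sets M" "(\<Union>k. A k) \<in> sets M" for k using A by auto
  ultimately show ?thesis by (simp add: m)
qed

text \<open>Uniform domination by \<open>M\<close> lets Tannery's theorem pass the limit through a disjoint union.\<close>

lemma (in prob_space) set_integral_tendsto_UN:
  fixes V :: "nat \<Rightarrow> 'a \<Rightarrow> real" and l :: "nat \<Rightarrow> real"
  assumes V: "\<And>n. V n \<in> borel_measurable M" "\<And>n x. 0 \<le> V n x \<and> V n x \<le> 1"
    and A: "range A \<subseteq> sets M" "disjoint_family A"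
    and l: "\<And>k. (\<lambda>n. LINT x:A k|M. V n x) \<longlonglongrightarrow> l k"
  shows "summable l" "(\<lambda>n. LINT x:(\<Union>k. A k)|M. V n x) \<longlonglongrightarrow> suminf l"
proof -
  have b: "norm (LINT x:A k|M. V n x) \<le> prob (A k)" for k n
    using set_integral_nonneg_le_prob[OF V, of "A k" n] A by auto
  have s: "(\<lambda>k. prob (A k)) sums prob (\<Union>k. A k)"
    using A by (intro finite_measure_UNION) auto
  have *: "summable (\<lambda>k. norm (l k))"
      "(\<lambda>n. \<Sum>k. (LINT x:A k|M. V n x)) \<longlonglongrightarrow> suminf l"
    using tannerys_theorem[of "\<lambda>k n. LINT x:A k|M. V n x" l sequentially "\<lambda>k. prob (A k)"]
      l s eventuallyI[of "\<lambda>(k,n). norm (LINT x:A k|M. V n x) \<le> prob (A k)" "sequentially \<times>\<^sub>F sequentially"] b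
    unfolding sums_iff by (simp_all add: split_beta)
  show "summable l" using *(1) by (rule summable_norm_cancel)
  have "(\<Sum>k. (LINT x:A k|M. V n x)) = (LINT x:(\<Union>k. A k)|M. V n x)" for n
    using set_integral_sums[OF V A] by (simp add: sums_iff)
  with *(2) show "(\<lambda>n. LINT x:(\<Union>k. A k)|M. V n x) \<longlonglongrightarrow> suminf l" by simp
qed

text \<open>The sets on which the integrals converge form a Dynkin system: complements follow by
  subtraction from the whole space, which is why \<open>space M\<close> belongs to \<open>G\<close>,
  and disjoint unions by the domination argument above.\<close>

lemma (in prob_space) convergent_set_integral_generator:
  fixes V :: "nat \<Rightarrow> 'a \<Rightarrow> real"
  assumes V: "\<And>n. V n \<in> borel_measurable M" "\<And>n x. 0 \<le> V n x \<and> V n x \<le> 1"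
    and G: "Int_stable G" "G \<subseteq> Pow (space M)" "space M \<in> G" "sets M = sigma_sets (space M) G"
    and conv: "\<And>A. A \<in> G \<Longrightarrow> convergent (\<lambda>n. LINT x:A|M. V n x)"
    and A: "A \<in> sets M"
  shows "convergent (\<lambda>n. LINT x:A|M. V n x)"
proof -
  from A have "A \<in> sigma_sets (space M) G" using G by simp
  from G(1,2) this show ?thesis
  proof (induction rule: sigma_sets_induct_disjoint)
    case (basic A)
    then show ?case by (rule conv)
  next
    case empty
    then show ?case by (simp add: set_lebesgue_integral_def convergent_const)
  next
    case (compl A)
    then have A: "A \<in> sets M" using G by simp
    have "(LINT x:space M - A|M. V n x) = (LINT x:space M|M. V n x) - (LINT x:A|M. V n x)" for n
    proof -
      have i: "set_integrable M B (V n)" if "B \<in> sets M" for B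
        by (intro set_integrable_unit V that)
      have "(LINT x:(space M - A) \<union> A|M. V n x) = (LINT x:space M - A|M. V n x) + (LINT x:A|M. V n x)"
        using A i by (intro set_integral_Un) auto
      moreover have "(space M - A) \<union> A = space M" using A sets.sets_into_space by blast
      ultimately show ?thesis by simp
    qed
    then show ?case using compl(2) conv[OF G(3)] by (simp add: convergent_diff)
  next
    case (union A)
    then have "\<forall>k. \<exists>l. (\<lambda>n. LINT x:A k|M. V n x) \<longlonglongrightarrow> l"
      by (simp add: convergent_def)
    then obtain l where "\<And>k. (\<lambda>n. LINT x:A k|M. V n x) \<longlonglongrightarrow> l k" by metis
    then have "(\<lambda>n. LINT x:(\<Union>k. A k)|M. V n x) \<longlonglongrightarrow> suminf l"
      using union G by (intro set_integral_tendsto_UN V) auto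
    then show ?case by (auto simp: convergent_def)
  qed
qed

text \<open>Domination by \<open>M\<close> survives the setwise limit. It makes the limit countably
  additive and absolutely continuous, and it also forces the Radon--Nikodym density to be at most 1
  almost everywhere.\<close>

lemma (in prob_space) weak_limit_exists:
  fixes V :: "nat \<Rightarrow> 'a \<Rightarrow> real"
  assumes V: "\<And>n. V n \<in> borel_measurable M" "\<And>n x. 0 \<le> V n x \<and> V n x \<le> 1"
    and conv: "\<And>A. A \<in> sets M \<Longrightarrow> convergent (\<lambda>n. LINT x:A|M. V n x)"
  obtains v where "v \<in> borel_measurable M" "\<And>x. 0 \<le> v x \<and> v x \<le> 1"
    "\<And>A. A \<in> sets M \<Longrightarrow> (\<lambda>n. LINT x:A|M. V n x) \<longlonglongrightarrow> (LINT x:A|M. v x)"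
proof -
  define \<nu> where "\<nu> A = lim (\<lambda>n. LINT x:A|M. V n x)" for A
  have lim: "(\<lambda>n. LINT x:A|M. V n x) \<longlonglongrightarrow> \<nu> A" if "A \<in> sets M" for A
    using conv[OF that] unfolding \<nu>_def by (rule convergent_LIMSEQ_iff[THEN iffD1])
  have nonneg: "0 \<le> \<nu> A" if "A \<in> sets M" for A
    using lim[OF that] by (rule LIMSEQ_le_const) (use set_integral_nonneg_le_prob[OF V that] in auto)
  have le: "\<nu> A \<le> prob A" if "A \<in> sets M" for A
    using lim[OF that] by (rule LIMSEQ_le_const2) (use set_integral_nonneg_le_prob[OF V that] in auto)
  define N where "N = measure_of (space M) (sets M) (\<lambda>A. ennreal (\<nu> A))"
  have sN [simp]: "sets N = sets M" "space N = space M" by (auto simp: N_def)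
  have ca: "countably_additive (sets M) (\<lambda>A. ennreal (\<nu> A))"
  proof (rule countably_additiveI)
    fix A :: "nat \<Rightarrow> 'a set"
    assume A: "range A \<subseteq> sets M" "disjoint_family A" "(\<Union>k. A k) \<in> sets M"
    have "summable (\<lambda>k. \<nu> (A k))" "(\<lambda>n. LINT x:(\<Union>k. A k)|M. V n x) \<longlonglongrightarrow> (\<Sum>k. \<nu> (A k))"
      using set_integral_tendsto_UN[of V A "\<lambda>k. \<nu> (A k)", OF V A(1,2)] lim A(1)
      by (auto simp: image_subset_iff)
    moreover from this(2) have "\<nu> (\<Union>k. A k) = (\<Sum>k. \<nu> (A k))"
      using lim[OF A(3)] LIMSEQ_unique by blast
    ultimately show "(\<Sum>k. ennreal (\<nu> (A k))) = ennreal (\<nu> (\<Union>k. A k))"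
      using nonneg A by (subst suminf_ennreal2) (auto simp: image_subset_iff)
  qed
  have "\<nu> {} = 0" using nonneg[of "{}"] le[of "{}"] by simp
  then have pos: "positive (sets M) (\<lambda>A. ennreal (\<nu> A))" by (simp add: positive_def)
  have eN: "emeasure N A = ennreal (\<nu> A)" if "A \<in> sets M" for A
    unfolding N_def by (rule emeasure_measure_of_sigma[OF sets.sigma_algebra_axioms pos ca that])
  have "absolutely_continuous M N"
    unfolding absolutely_continuous_def
  proof
    fix A assume A: "A \<in> null_sets M"
    then have "A \<in> sets M" "prob A = 0" by (auto simp: measure_def null_sets_def)
    then have "\<nu> A = 0" using nonneg[of A] le[of A] by simp
    then show "A \<in> null_sets N" using A eN by (auto simp: null_sets_def)
  qed
  then obtain f where f [measurable]: "f \<in> borel_measurable M" and fN: "density M f = N"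
    using Radon_Nikodym[OF _ sN(1)] by auto
  have fA: "(\<integral>\<^sup>+x. f x * indicator A x \<partial>M) = ennreal (\<nu> A)" if "A \<in> sets M" for A
    using eN[OF that] that unfolding fN[symmetric] by (simp add: emeasure_density)
  have "AE x in M. f x \<le> 1"
  proof -
    \<comment> \<open>The limit measure of \<open>?B\<close> equals its probability plus the
      integral of the excess \<open>f - 1\<close>, yet is at most its probability; so the excess
      vanishes almost everywhere.\<close>
    let ?B = "{x \<in> space M. 1 < f x}"
    have "(\<integral>\<^sup>+x. indicator ?B x \<partial>M) + (\<integral>\<^sup>+x. (f x - 1) * indicator ?B x \<partial>M)
        = (\<integral>\<^sup>+x. f x * indicator ?B x \<partial>M)"
      by (subst nn_integral_add[symmetric])
        (auto intro!: nn_integral_cong split: split_indicator)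
    also have "\<dots> \<le> ennreal (prob ?B)" by (subst fA) (auto intro!: ennreal_leI le)
    finally have *: "ennreal (prob ?B) + (\<integral>\<^sup>+x. (f x - 1) * indicator ?B x \<partial>M) \<le> ennreal (prob ?B) + 0"
      by (simp add: emeasure_eq_measure)
    then have "(\<integral>\<^sup>+x. (f x - 1) * indicator ?B x \<partial>M) \<le> 0"
      by (subst (asm) ennreal_add_left_cancel_le) auto
    then have "AE x in M. (f x - 1) * indicator ?B x = 0"
      by (simp add: nn_integral_0_iff_AE)
    with AE_space show ?thesis
      by eventually_elim (auto simp: diff_eq_0_iff_ennreal split: split_indicator_asm)
  qed
  \<comment> \<open>The density is controlled only almost everywhere; truncation makes the bounds
    hold at every point.\<close>
  define v where "v x = min 1 (enn2real (f x))" for x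
  have [measurable]: "v \<in> borel_measurable M" unfolding v_def by measurable
  have v01: "0 \<le> v x \<and> v x \<le> 1" for x by (auto simp: v_def)
  have fv: "AE x in M. f x = ennreal (v x)"
    using \<open>AE x in M. f x \<le> 1\<close>
  proof eventually_elim
    case (elim x)
    then have "f x < top" using ennreal_one_less_top order_le_less_trans by blast
    moreover from elim have "enn2real (f x) \<le> 1" by (metis enn2real_leI ennreal_1 zero_le_one)
    ultimately show ?case by (simp add: v_def)
  qed
  have "(LINT x:A|M. v x) = \<nu> A" if A [measurable]: "A \<in> sets M" for A
  proof -
    have "ennreal (LINT x:A|M. v x) = emeasure (density M (\<lambda>x. ennreal (v x))) A"
      using v01 A by (subst measure_density_eq_set_integral) auto
    also have "\<dots> = (\<integral>\<^sup>+x. ennreal (v x) * indicator A x \<partial>M)" by (simp add: emeasure_density)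
    also have "\<dots> = (\<integral>\<^sup>+x. f x * indicator A x \<partial>M)"
      using fv by (intro nn_integral_cong_AE) auto
    also have "\<dots> = ennreal (\<nu> A)" by (rule fA[OF A])
    finally show ?thesis
      using nonneg[OF A] set_integral_nonneg_le_prob(1)[of v A] v01 A
      by (simp add: ennreal_inj)
  qed
  then show ?thesis using that[of v] v01 lim by simp
qed

section \<open>Cut norm and weak regularity\<close>

text \<open>Only upper bounds on the cut norm are ever used. A predicate avoids carrying the
  boundedness condition of a real supremum through every estimate, and it also makes sense for
  nonsymmetric kernels.\<close>

definition cut_bound :: "'a measure \<Rightarrow> ('a \<times> 'a \<Rightarrow> real) \<Rightarrow> real \<Rightarrow> bool" where
  "cut_bound M g c \<longleftrightarrow> (\<forall>S\<in>sets M. \<forall>T\<in>sets M. \<bar>LINT p:S \<times> T|M \<Otimes>\<^sub>M M. g p\<bar> \<le> c)"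

lemma cut_boundI:
  "(\<And>S T. S \<in> sets M \<Longrightarrow> T \<in> sets M \<Longrightarrow> \<bar>LINT p:S \<times> T|M \<Otimes>\<^sub>M M. g p\<bar> \<le> c) \<Longrightarrow> cut_bound M g c"
  by (simp add: cut_bound_def)

lemma cut_boundD:
  "cut_bound M g c \<Longrightarrow> S \<in> sets M \<Longrightarrow> T \<in> sets M \<Longrightarrow> \<bar>LINT p:S \<times> T|M \<Otimes>\<^sub>M M. g p\<bar> \<le> c"
  by (simp add: cut_bound_def)

lemma cut_bound_mono: "cut_bound M g c \<Longrightarrow> c \<le> d \<Longrightarrow> cut_bound M g d"
  unfolding cut_bound_def by (meson order_trans)

lemma cut_bound_uminus: "cut_bound M (\<lambda>p. - g p) c \<longleftrightarrow> cut_bound M g c"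
  by (simp add: cut_bound_def set_lebesgue_integral_def)

lemma cut_bound_add:
  assumes "cut_bound M f a" "cut_bound M g b"
    and "integrable (M \<Otimes>\<^sub>M M) f" "integrable (M \<Otimes>\<^sub>M M) g"
  shows "cut_bound M (\<lambda>p. f p + g p) (a + b)"
proof (rule cut_boundI)
  fix S T assume ST: "S \<in> sets M" "T \<in> sets M"
  have "set_integrable (M \<Otimes>\<^sub>M M) (S \<times> T) f" "set_integrable (M \<Otimes>\<^sub>M M) (S \<times> T) g"
    using ST assms unfolding set_integrable_def by (intro integrable_mult_indicator; simp)+
  then have "(LINT p:S \<times> T|M \<Otimes>\<^sub>M M. f p + g p) = (LINT p:S \<times> T|M \<Otimes>\<^sub>M M. f p) + (LINT p:S \<times> T|M \<Otimes>\<^sub>M M. g p)"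
    by simp
  then show "\<bar>LINT p:S \<times> T|M \<Otimes>\<^sub>M M. f p + g p\<bar> \<le> a + b"
    using cut_boundD[OF assms(1) ST] cut_boundD[OF assms(2) ST] by linarith
qed

lemma cut_bound_integral_abs:
  assumes g: "integrable (M \<Otimes>\<^sub>M M) g" and c: "(\<integral>p. \<bar>g p\<bar> \<partial>(M \<Otimes>\<^sub>M M)) \<le> c"
  shows "cut_bound M g c"
proof (rule cut_boundI)
  fix S T assume ST: "S \<in> sets M" "T \<in> sets M"
  have i: "integrable (M \<Otimes>\<^sub>M M) (\<lambda>p. indicator (S \<times> T) p *\<^sub>R g p)"
    using ST g by (intro integrable_mult_indicator) auto
  have "\<bar>LINT p:S \<times> T|M \<Otimes>\<^sub>M M. g p\<bar> \<le> (\<integral>p. \<bar>indicator (S \<times> T) p *\<^sub>R g p\<bar> \<partial>(M \<Otimes>\<^sub>M M))"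
    unfolding set_lebesgue_integral_def by (rule integral_abs_bound)
  also have "\<dots> \<le> (\<integral>p. \<bar>g p\<bar> \<partial>(M \<Otimes>\<^sub>M M))"
    using i g by (intro integral_mono integrable_abs) (auto split: split_indicator)
  finally show "\<bar>LINT p:S \<times> T|M \<Otimes>\<^sub>M M. g p\<bar> \<le> c" using c by simp
qed

lemma (in prob_space) pair_prob_space_self: "pair_prob_space M M"
  by unfold_locales

lemma (in prob_space) prob_space_pair_self: "prob_space (M \<Otimes>\<^sub>M M)"
proof -
  interpret pair_prob_space M M by (rule pair_prob_space_self)
  show ?thesis by unfold_locales
qed

lemma cut_bound_swap:
  assumes "prob_space M" "integrable (M \<Otimes>\<^sub>M M) g" "cut_bound M g c"
  shows "cut_bound M (\<lambda>(x, y). g (y, x)) c"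
proof (rule cut_boundI)
  interpret prob_space M by fact
  interpret pair_prob_space M M by (rule pair_prob_space_self)
  fix S T assume ST: "S \<in> sets M" "T \<in> sets M"
  have "integrable (M \<Otimes>\<^sub>M M) (\<lambda>p. indicator (T \<times> S) p *\<^sub>R g p)"
    using ST assms by (intro integrable_mult_indicator) auto
  then have "(\<integral>(x, y). indicator (T \<times> S) (y, x) *\<^sub>R g (y, x) \<partial>(M \<Otimes>\<^sub>M M)) = (LINT p:T \<times> S|M \<Otimes>\<^sub>M M. g p)"
    unfolding set_lebesgue_integral_def by (intro integral_product_swap borel_measurable_integrable)
  moreover have "(LINT p:S \<times> T|M \<Otimes>\<^sub>M M. case p of (x, y) \<Rightarrow> g (y, x))
      = (\<integral>(x, y). indicator (T \<times> S) (y, x) *\<^sub>R g (y, x) \<partial>(M \<Otimes>\<^sub>M M))"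
    unfolding set_lebesgue_integral_def
    by (intro Bochner_Integration.integral_cong refl) (auto simp: indicator_def)
  ultimately show "\<bar>LINT p:S \<times> T|M \<Otimes>\<^sub>M M. case p of (x, y) \<Rightarrow> g (y, x)\<bar> \<le> c"
    using cut_boundD[OF assms(3) ST(2,1)] by simp
qed

lemma distr_pair_measure_preserving:
  assumes "prob_space M" "f \<in> M \<rightarrow>\<^sub>M M" "distr M M f = M"
  shows "distr (M \<Otimes>\<^sub>M M) (M \<Otimes>\<^sub>M M) (\<lambda>(x, y). (f x, f y)) = M \<Otimes>\<^sub>M M"
proof -
  interpret prob_space M by fact
  have "sigma_finite_measure (distr M M f)" using assms(3) sigma_finite_measure_axioms by simp
  from pair_measure_distr[OF assms(2,2) this] show ?thesis by (simp add: assms(3))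
qed

text \<open>The left inverse \<open>h\<close> converts the test sides into \<open>h -\<close>
  S\<open>and\<close>h -\<open>T\<close>, which pull back along \<open>f\<close> to \<open>S\<close>
  and \<open>T\<close>. Preimages are measurable, whereas images under \<open>f\<close> might not
  be.\<close>

lemma cut_bound_rearrange:
  assumes M: "prob_space M" and f: "f \<in> M \<rightarrow>\<^sub>M M" "distr M M f = M"
    and h: "h \<in> M \<rightarrow>\<^sub>M M" "\<And>x. h (f x) = x"
    and g: "g \<in> borel_measurable (M \<Otimes>\<^sub>M M)" and c: "cut_bound M g c"
  shows "cut_bound M (\<lambda>(x, y). g (f x, f y)) c"
proof (rule cut_boundI)
  fix S T assume ST: "S \<in> sets M" "T \<in> sets M"
  let ?S = "h -` S \<inter> space M" and ?T = "h -` T \<inter> space M"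
  have m [measurable]: "?S \<in> sets M" "?T \<in> sets M" "f \<in> M \<rightarrow>\<^sub>M M" "g \<in> borel_measurable (M \<Otimes>\<^sub>M M)"
    using ST h f g by (auto intro: measurable_sets)
  have "(LINT p:S \<times> T|M \<Otimes>\<^sub>M M. case p of (x, y) \<Rightarrow> g (f x, f y))
      = (\<integral>p. (indicator (?S \<times> ?T) ((\<lambda>(x, y). (f x, f y)) p) *\<^sub>R g ((\<lambda>(x, y). (f x, f y)) p)) \<partial>(M \<Otimes>\<^sub>M M))"
    unfolding set_lebesgue_integral_def
    using h(2) measurable_space[OF f(1)] sets.sets_into_space[OF ST(1)] sets.sets_into_space[OF ST(2)]
    by (intro Bochner_Integration.integral_cong refl)
       (auto simp: space_pair_measure split: split_indicator)
  also have "\<dots> = (\<integral>p. (indicator (?S \<times> ?T) p *\<^sub>R g p) \<partial>distr (M \<Otimes>\<^sub>M M) (M \<Otimes>\<^sub>M M) (\<lambda>(x, y). (f x, f y)))"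
    by (rule integral_distr[symmetric]) (measurable)
  also have "\<dots> = (LINT p:?S \<times> ?T|M \<Otimes>\<^sub>M M. g p)"
    by (simp only: distr_pair_measure_preserving[OF M f] set_lebesgue_integral_def)
  finally show "\<bar>LINT p:S \<times> T|M \<Otimes>\<^sub>M M. case p of (x, y) \<Rightarrow> g (f x, f y)\<bar> \<le> c"
    using cut_boundD[OF c m(1,2)] by simp
qed

text \<open>The integral is linear in the weight \<open>a\<close>, hence at most its value for the
  indicator of \<open>h > 0\<close> and at least that for \<open>h < 0\<close>; both sets are
  admissible tests.\<close>

lemma abs_integral_mult_unit_le:
  fixes h :: "'a \<Rightarrow> real"
  assumes h: "integrable M h" and c: "\<And>S. S \<in> sets M \<Longrightarrow> \<bar>LINT x:S|M. h x\<bar> \<le> c"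
    and a: "a \<in> borel_measurable M" "\<And>x. 0 \<le> a x \<and> a x \<le> 1"
  shows "\<bar>\<integral>x. a x * h x \<partial>M\<bar> \<le> c"
proof -
  have [measurable]: "h \<in> borel_measurable M" "a \<in> borel_measurable M" using h a by auto
  let ?P = "{x \<in> space M. 0 < h x}" and ?N = "{x \<in> space M. h x < 0}"
  have P: "integrable M (\<lambda>x. indicator ?P x *\<^sub>R h x)" and N: "integrable M (\<lambda>x. indicator ?N x *\<^sub>R h x)"
    using h by (intro integrable_mult_indicator; simp)+
  have ah: "integrable M (\<lambda>x. a x * h x)"
    by (rule Bochner_Integration.integrable_bound[OF h])
      (use a in \<open>auto simp: abs_mult intro!: mult_left_le_one_le\<close>)
  have "(\<integral>x. a x * h x \<partial>M) \<le> (LINT x:?P|M. h x)"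
    unfolding set_lebesgue_integral_def
  proof (intro integral_mono ah P)
    fix x assume "x \<in> space M"
    then show "a x * h x \<le> indicator ?P x *\<^sub>R h x"
      using a(2)[of x] by (cases "0 < h x") (auto simp: mult_le_0_iff not_less)
  qed
  moreover have "(LINT x:?N|M. h x) \<le> (\<integral>x. a x * h x \<partial>M)"
    unfolding set_lebesgue_integral_def
  proof (intro integral_mono ah N)
    fix x assume "x \<in> space M"
    then show "indicator ?N x *\<^sub>R h x \<le> a x * h x"
      using a(2)[of x] by (cases "h x < 0") (auto simp: mult_le_cancel_right1 not_less)
  qed
  moreover have "\<bar>LINT x:?P|M. h x\<bar> \<le> c" "\<bar>LINT x:?N|M. h x\<bar> \<le> c" by (auto intro!: c)
  ultimately show ?thesis by linarith
qed

text \<open>Indicators are replaced by weights one variable at a time: \<open>a\<close> while the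
  second side is still a set \<open>T\<close>, then \<open>b\<close> with \<open>a\<close> already
  in place. Fubini changes the order of integration in between.\<close>

lemma cut_bound_functions:
  assumes M: "prob_space M" and g: "integrable (M \<Otimes>\<^sub>M M) g" and c: "cut_bound M g c"
    and a: "a \<in> borel_measurable M" "\<And>x. 0 \<le> a x \<and> a x \<le> 1"
    and b: "b \<in> borel_measurable M" "\<And>x. 0 \<le> b x \<and> b x \<le> 1"
  shows "\<bar>\<integral>x. \<integral>y. a x * b y * g (x, y) \<partial>M \<partial>M\<bar> \<le> c"
proof -
  interpret prob_space M by fact
  interpret pair_prob_space M M by (rule pair_prob_space_self)
  have [measurable]: "a \<in> borel_measurable M" "b \<in> borel_measurable M" "g \<in> borel_measurable (M \<Otimes>\<^sub>M M)"
    using a b g by auto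
  have int: "integrable (M \<Otimes>\<^sub>M M) (\<lambda>p. u (fst p) * v (snd p) * g p)"
    if [measurable]: "u \<in> borel_measurable M" "v \<in> borel_measurable M"
      and u: "\<And>x. 0 \<le> u x \<and> u x \<le> 1" and v: "\<And>x. 0 \<le> v x \<and> v x \<le> 1" for u v :: "'a \<Rightarrow> real"
  proof (rule Bochner_Integration.integrable_bound[OF g])
    show "AE p in M \<Otimes>\<^sub>M M. norm (u (fst p) * v (snd p) * g p) \<le> norm (g p)"
    proof (rule AE_I2)
      fix p
      have "0 \<le> u (fst p) * v (snd p)" "u (fst p) * v (snd p) \<le> 1"
        using u v by (auto intro: mult_le_one)
      then show "norm (u (fst p) * v (snd p) * g p) \<le> norm (g p)"
        by (simp add: abs_mult[of "_ * _"] mult_left_le_one_le)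
    qed
  qed simp
  have 1: "\<bar>\<integral>x. a x * (\<integral>y. indicator T y * g (x, y) \<partial>M) \<partial>M\<bar> \<le> c" if T [measurable]: "T \<in> sets M" for T
  proof (rule abs_integral_mult_unit_le[OF _ _ a])
    have "integrable (M \<Otimes>\<^sub>M M) (\<lambda>p. 1 * indicator T (snd p) * g p)"
      by (rule int) auto
    then show "integrable M (\<lambda>x. \<integral>y. indicator T y * g (x, y) \<partial>M)"
      using integrable_fst'[of "\<lambda>p. indicator T (snd p) * g p"] by simp
    fix S assume S [measurable]: "S \<in> sets M"
    have "(LINT x:S|M. (\<integral>y. indicator T y * g (x, y) \<partial>M))
       = (\<integral>x. \<integral>y. indicator S x * indicator T y * g (x, y) \<partial>M \<partial>M)"
      by (simp add: set_lebesgue_integral_def mult.assoc)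
    also have "\<dots> = (\<integral>p. indicator S (fst p) * indicator T (snd p) * g p \<partial>(M \<Otimes>\<^sub>M M))"
      using integral_fst'[OF int[of "indicator S" "indicator T"]] by simp
    also have "\<dots> = (LINT p:S \<times> T|M \<Otimes>\<^sub>M M. g p)"
      unfolding set_lebesgue_integral_def
      by (intro Bochner_Integration.integral_cong refl) (auto split: split_indicator)
    finally show "\<bar>LINT x:S|M. (\<integral>y. indicator T y * g (x, y) \<partial>M)\<bar> \<le> c"
      using cut_boundD[OF c S T] by simp
  qed
  have "\<bar>\<integral>y. b y * (\<integral>x. a x * g (x, y) \<partial>M) \<partial>M\<bar> \<le> c"
  proof (rule abs_integral_mult_unit_le[OF _ _ b])
    have "integrable (M \<Otimes>\<^sub>M M) (\<lambda>p. a (fst p) * 1 * g p)"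
      by (rule int) (use a in auto)
    then show "integrable M (\<lambda>y. \<integral>x. a x * g (x, y) \<partial>M)"
      using integrable_snd[of "\<lambda>x y. a x * g (x, y)"] by (simp add: split_beta')
    fix T assume T [measurable]: "T \<in> sets M"
    have i: "integrable (M \<Otimes>\<^sub>M M) (\<lambda>p. a (fst p) * indicator T (snd p) * g p)"
      by (rule int) (use a in auto)
    have "(LINT y:T|M. (\<integral>x. a x * g (x, y) \<partial>M)) = (\<integral>y. \<integral>x. a x * indicator T y * g (x, y) \<partial>M \<partial>M)"
      unfolding set_lebesgue_integral_def
      by (subst integral_scaleR_right[symmetric]) (simp add: mult_ac)
    also have "\<dots> = (\<integral>x. \<integral>y. a x * indicator T y * g (x, y) \<partial>M \<partial>M)"
      by (rule Fubini_integral) (use i in \<open>simp add: split_beta'\<close>)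
    also have "\<dots> = (\<integral>x. a x * (\<integral>y. indicator T y * g (x, y) \<partial>M) \<partial>M)"
      by (simp add: mult.assoc)
    finally show "\<bar>LINT y:T|M. (\<integral>x. a x * g (x, y) \<partial>M)\<bar> \<le> c" using 1[OF T] by simp
  qed
  also have "(\<integral>y. b y * (\<integral>x. a x * g (x, y) \<partial>M) \<partial>M) = (\<integral>y. \<integral>x. a x * b y * g (x, y) \<partial>M \<partial>M)"
    by (subst integral_mult_right_zero[symmetric]) (simp add: mult_ac)
  also have "\<dots> = (\<integral>x. \<integral>y. a x * b y * g (x, y) \<partial>M \<partial>M)"
    by (rule Fubini_integral) (use int[of a b] a b in \<open>simp add: split_beta'\<close>)
  finally show ?thesis .
qed

text \<open>Greedy form of the Frieze--Kannan weak regularity lemma: each violated test rectangle is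
  subtracted with the fixed weight \<open>\<plusminus>e\<close>, which lowers the \<open>L\<^sup>2\<close> energy by at least \<open>e\<^sup>2\<close>.\<close>

lemma (in prob_space) weak_regularity:
  fixes g :: "'a \<times> 'a \<Rightarrow> real"
  assumes g: "g \<in> borel_measurable (M \<Otimes>\<^sub>M M)" "\<And>p. \<bar>g p\<bar> \<le> 1"
    and D: "D \<subseteq> sets M" "D \<noteq> {}" and e: "0 < e" and k: "1 < real k * e\<^sup>2"
  obtains s S T where "\<And>i. i < k \<Longrightarrow> s i \<in> {- e, 0, e}" "\<And>i. i < k \<Longrightarrow> S i \<in> D" "\<And>i. i < k \<Longrightarrow> T i \<in> D"
    "\<And>A B. A \<in> D \<Longrightarrow> B \<in> D \<Longrightarrow>
      \<bar>LINT p:A \<times> B|M \<Otimes>\<^sub>M M. g p - (\<Sum>i<k. s i * indicator (S i \<times> T i) p)\<bar> \<le> e"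
proof -
  interpret P: prob_space "M \<Otimes>\<^sub>M M" by (rule prob_space_pair_self)
  define R where "R s S T n p = g p - (\<Sum>i<n. s i * indicator (S i \<times> T i) p)"
    for s :: "nat \<Rightarrow> real" and S T :: "nat \<Rightarrow> 'a set" and n :: nat and p
  define good where "good s S T n \<longleftrightarrow>
     (\<forall>i<n. s i \<in> {- e, 0, e} \<and> S i \<in> D \<and> T i \<in> D)" for s :: "nat \<Rightarrow> real" and S T n
  define fin where "fin s S T n \<longleftrightarrow>
     (\<forall>A\<in>D. \<forall>B\<in>D. \<bar>LINT p:A \<times> B|M \<Otimes>\<^sub>M M. R s S T n p\<bar> \<le> e)" for s S T n
  have R_meas: "R s S T n \<in> borel_measurable (M \<Otimes>\<^sub>M M)" if "good s S T n" for s S T n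
  proof -
    have "S i \<times> T i \<in> sets (M \<Otimes>\<^sub>M M)" if "i < n" for i
      using \<open>good s S T n\<close> that D(1) by (intro pair_measureI) (auto simp: good_def)
    then show ?thesis unfolding R_def[abs_def] using g by (intro borel_measurable_diff borel_measurable_sum) auto
  qed
  have R_bdd: "\<bar>R s S T n p\<bar> \<le> 1 + real n * e" if "good s S T n" for s S T n p
  proof -
    have "\<bar>\<Sum>i<n. s i * indicator (S i \<times> T i) p\<bar> \<le> (\<Sum>i<n. e)"
      using that e by (intro order_trans[OF sum_abs] sum_mono)
        (auto simp: good_def split: split_indicator)
    then show ?thesis using g(2)[of p] unfolding R_def by simp
  qed
  have "\<exists>s S T. good s S T n \<and> (fin s S T n \<or> (\<integral>p. (R s S T n p)\<^sup>2 \<partial>(M \<Otimes>\<^sub>M M)) \<le> 1 - real n * e\<^sup>2)" for n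
  proof (induction n)
    case 0
    have "\<bar>\<integral>p. (g p)\<^sup>2 \<partial>(M \<Otimes>\<^sub>M M)\<bar> \<le> 1"
      using g(2) by (intro P.abs_integral_le) (auto simp: abs_square_le_1)
    then have "(\<integral>p. (R s S T 0 p)\<^sup>2 \<partial>(M \<Otimes>\<^sub>M M)) \<le> 1" for s S T by (simp add: R_def)
    then show ?case by (auto simp: good_def)
  next
    case (Suc n)
    then obtain s S T where good: "good s S T n"
      and *: "fin s S T n \<or> (\<integral>p. (R s S T n p)\<^sup>2 \<partial>(M \<Otimes>\<^sub>M M)) \<le> 1 - real n * e\<^sup>2" by blast
    have RSuc: "R (s(n := c)) (S(n := A)) (T(n := B)) (Suc n) p = R s S T n p - c * indicator (A \<times> B) p"
      for c A B p by (simp add: R_def)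
    have goodSuc: "good (s(n := c)) (S(n := A)) (T(n := B)) (Suc n)"
      if "c \<in> {- e, 0, e}" "A \<in> D" "B \<in> D" for c A B
      using good that by (auto simp: good_def less_Suc_eq)
    show ?case
    proof (cases "fin s S T n")
      case True
      \<comment> \<open>Once no test rectangle is violated, zero weights pad the sum to the
        prescribed length; this is why 0 is an allowed weight.\<close>
      obtain A where A: "A \<in> D" using D by auto
      have "R (s(n := 0)) (S(n := A)) (T(n := A)) (Suc n) = R s S T n"
        by (rule ext) (simp add: RSuc)
      then have "fin (s(n := 0)) (S(n := A)) (T(n := A)) (Suc n)"
        using True unfolding fin_def by simp
      then show ?thesis using goodSuc[of 0 A A] A by blast
    next
      case False
      then obtain A B where A: "A \<in> D" and B: "B \<in> D"
        and gt: "\<bar>LINT p:A \<times> B|M \<Otimes>\<^sub>M M. R s S T n p\<bar> > e" by (auto simp: fin_def not_le)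
      \<comment> \<open>The sign makes the cross term lower the energy by at least
        \<open>2 * e\<^sup>2\<close>, while the square of the subtracted term costs at most
        \<open>e\<^sup>2\<close>.\<close>
      define c where "c = e * sgn (LINT p:A \<times> B|M \<Otimes>\<^sub>M M. R s S T n p)"
      have c: "c \<in> {- e, 0, e}" "c\<^sup>2 = e\<^sup>2"
        using gt e by (auto simp: c_def sgn_if)
      have AB [measurable]: "A \<times> B \<in> sets (M \<Otimes>\<^sub>M M)" using A B D by auto
      let ?R = "R s S T n"
      have [measurable]: "?R \<in> borel_measurable (M \<Otimes>\<^sub>M M)" by (rule R_meas[OF good])
      have i1: "integrable (M \<Otimes>\<^sub>M M) (\<lambda>p. (?R p)\<^sup>2)"
        by (rule P.integrable_bounded[of _ "(1 + real n * e)\<^sup>2"])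
          (use R_bdd[OF good] in \<open>auto simp: abs_le_square_iff[symmetric] intro: order_trans[OF _ abs_ge_self]\<close>)
      have i2: "integrable (M \<Otimes>\<^sub>M M) (\<lambda>p. indicator (A \<times> B) p * ?R p)"
        using P.set_integrable_bounded[OF R_meas[OF good] R_bdd[OF good] AB]
        by (simp add: set_integrable_def)
      have i3: "integrable (M \<Otimes>\<^sub>M M) (\<lambda>p. indicator (A \<times> B) p :: real)"
        by (rule P.integrable_bounded[where B=1]) (auto split: split_indicator)
      have "(\<integral>p. (?R p - c * indicator (A \<times> B) p)\<^sup>2 \<partial>(M \<Otimes>\<^sub>M M))
         = (\<integral>p. (?R p)\<^sup>2 - 2 * c * (indicator (A \<times> B) p * ?R p) + c\<^sup>2 * indicator (A \<times> B) p \<partial>(M \<Otimes>\<^sub>M M))"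
        by (intro Bochner_Integration.integral_cong refl)
          (auto simp: power2_eq_square algebra_simps split: split_indicator)
      also have "\<dots> = (\<integral>p. (?R p)\<^sup>2 \<partial>(M \<Otimes>\<^sub>M M)) - 2 * c * (LINT p:A \<times> B|M \<Otimes>\<^sub>M M. ?R p) + c\<^sup>2 * P.prob (A \<times> B)"
        using i1 i2 i3 by (simp add: set_lebesgue_integral_def)
      also have "\<dots> \<le> (1 - real n * e\<^sup>2) - 2 * e\<^sup>2 + e\<^sup>2"
      proof -
        have "c * (LINT p:A \<times> B|M \<Otimes>\<^sub>M M. ?R p) = e * \<bar>LINT p:A \<times> B|M \<Otimes>\<^sub>M M. ?R p\<bar>"
          by (simp add: c_def abs_sgn ac_simps)
        then have "e * e \<le> c * (LINT p:A \<times> B|M \<Otimes>\<^sub>M M. ?R p)"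
          using gt e by simp
        moreover have "c\<^sup>2 * P.prob (A \<times> B) \<le> e\<^sup>2"
          unfolding c(2) by (rule mult_left_le) auto
        ultimately show ?thesis using * False by (simp add: power2_eq_square)
      qed
      finally have "(\<integral>p. (R (s(n := c)) (S(n := A)) (T(n := B)) (Suc n) p)\<^sup>2 \<partial>(M \<Otimes>\<^sub>M M)) \<le> 1 - real (Suc n) * e\<^sup>2"
        by (simp add: RSuc algebra_simps)
      then show ?thesis using goodSuc[OF c(1) A B] by blast
    qed
  qed
  then obtain s S T where good: "good s S T k"
    and *: "fin s S T k \<or> (\<integral>p. (R s S T k p)\<^sup>2 \<partial>(M \<Otimes>\<^sub>M M)) \<le> 1 - real k * e\<^sup>2" by blast
  have "0 \<le> (\<integral>p. (R s S T k p)\<^sup>2 \<partial>(M \<Otimes>\<^sub>M M))" by (intro Bochner_Integration.integral_nonneg) auto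
  \<comment> \<open>Without stopping, the nonnegative energy would be at most
    \<open>1 - real k * e\<^sup>2\<close>, which is negative.\<close>
  with * k have "fin s S T k" by linarith
  with good show ?thesis using that[of s S T] unfolding good_def fin_def R_def by blast
qed

section \<open>Dyadic approximation\<close>

text \<open>A Borel measure on the whole line, concentrated on the unit interval. Its space is
  \<open>UNIV\<close>, so functions carry no domain conditions, and its square is again Borel, which
  keeps Fubini and pushforwards free of completions.\<close>

definition I01 :: "real measure" where
  "I01 = density lborel (indicator {0..1})"

lemma sets_I01 [simp, measurable_cong]: "sets I01 = sets borel"
  by (simp add: I01_def)

lemma space_I01 [simp]: "space I01 = UNIV"
  by (simp add: I01_def)

lemma emeasure_I01: "A \<in> sets borel \<Longrightarrow> emeasure I01 A = emeasure lborel (A \<inter> {0..1})"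
  by (simp add: I01_def emeasure_density indicator_inter_arith[symmetric] mult.commute inf_commute)

lemma prob_space_I01: "prob_space I01"
  by (rule prob_spaceI) (simp add: emeasure_I01[of UNIV])

interpretation I01: prob_space I01
  by (rule prob_space_I01)

interpretation I01_pair: prob_space "I01 \<Otimes>\<^sub>M I01"
  by (rule I01.prob_space_pair_self)

lemma sets_I01_pair [simp]: "sets (I01 \<Otimes>\<^sub>M I01) = sets borel"
  by (metis borel_prod sets_I01 sets_pair_measure_cong)

lemma space_I01_pair [simp]: "space (I01 \<Otimes>\<^sub>M I01) = UNIV"
  by (simp add: space_pair_measure)

lemma measure_I01: "A \<in> sets borel \<Longrightarrow> A \<subseteq> {0..1} \<Longrightarrow> measure I01 A = measure lborel A"
  by (simp add: measure_def emeasure_I01 Int_absorb2)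

lemma I01_AE_less_1: "AE x in I01. 0 \<le> x \<and> x < 1"
proof -
  have "AE x in lborel. x \<in> {0..1} \<longrightarrow> 0 \<le> x \<and> x < (1::real)"
    using AE_lborel_singleton[of "1::real"] by eventually_elim auto
  then show ?thesis unfolding I01_def by (subst AE_density) (auto simp: indicator_def)
qed

section \<open>Dyadic intervals and functions constant on them\<close>

definition dyadic_floor :: "nat \<Rightarrow> real \<Rightarrow> real" where
  "dyadic_floor L x = of_int \<lfloor>2 ^ L * x\<rfloor> / 2 ^ L"

text \<open>Constancy on half-open intervals of length \<open>1 / 2 ^ L\<close>, expressed by
  evaluation at left endpoints. Such a function, of whatever type, factors through one integer, and
  predicates describe unions of dyadic intervals.\<close>

definition dyadic :: "nat \<Rightarrow> (real \<Rightarrow> 'b) \<Rightarrow> bool" where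
  "dyadic L f \<longleftrightarrow> (\<forall>x. f (dyadic_floor L x) = f x)"

lemma dyadic_floor_le: "dyadic_floor L x \<le> x" "x < dyadic_floor L x + 1 / 2 ^ L"
proof -
  have "of_int \<lfloor>2 ^ L * x\<rfloor> \<le> 2 ^ L * x" "2 ^ L * x < of_int \<lfloor>2 ^ L * x\<rfloor> + 1" by linarith+
  then show "dyadic_floor L x \<le> x" "x < dyadic_floor L x + 1 / 2 ^ L"
    by (simp_all add: dyadic_floor_def field_simps)
qed

text \<open>The partitions are nested because the coarse index is the fine index divided by a power
  of two.\<close>

lemma dyadic_floor_dyadic_floor:
  assumes "L \<le> K"
  shows "dyadic_floor L (dyadic_floor K x) = dyadic_floor L x"
proof -
  obtain d where K: "K = L + d" using assms le_Suc_ex by blast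
  have e: "\<lfloor>2 ^ L * x\<rfloor> = \<lfloor>2 ^ K * x\<rfloor> div 2 ^ d" for x :: real
  proof -
    have "2 ^ L * x = (2 ^ K * x) / real_of_int (2 ^ d)" by (simp add: K power_add)
    then show ?thesis by (simp only: floor_divide_real_eq_div zero_le_power zero_le_numeral)
  qed
  have "2 ^ K * dyadic_floor K x = of_int \<lfloor>2 ^ K * x\<rfloor>" by (simp add: dyadic_floor_def)
  then show ?thesis unfolding dyadic_floor_def[of L] e by simp
qed

lemma dyadic_mono: "dyadic L f \<Longrightarrow> L \<le> K \<Longrightarrow> dyadic K f"
  unfolding dyadic_def by (metis dyadic_floor_dyadic_floor)

text \<open>Every preimage under \<open>f\<close> is the preimage of a set of integers under a floor
  function, so \<open>A\<close> can be any set of any type.\<close>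

lemma dyadic_vimage_borel:
  assumes "dyadic L f" shows "f -` A \<in> sets borel"
proof -
  have "(\<lambda>x::real. \<lfloor>2 ^ L * x\<rfloor>) \<in> borel \<rightarrow>\<^sub>M count_space UNIV" by measurable
  then have "(\<lambda>x::real. \<lfloor>2 ^ L * x\<rfloor>) -` {j. f (of_int j / 2 ^ L) \<in> A} \<inter> space borel \<in> sets borel"
    by (rule measurable_sets) simp
  also have "(\<lambda>x::real. \<lfloor>2 ^ L * x\<rfloor>) -` {j. f (of_int j / 2 ^ L) \<in> A} \<inter> space borel = f -` A"
    using assms by (auto simp: dyadic_def dyadic_floor_def)
  finally show ?thesis .
qed

definition dyadic_sets :: "real set set" where
  "dyadic_sets = {A. \<exists>L. dyadic L (\<lambda>x. x \<in> A)}"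

lemma dyadic_sets_borel: "dyadic_sets \<subseteq> sets borel"
  using dyadic_vimage_borel[where A = "{True}"] by (fastforce simp: dyadic_sets_def vimage_def)

lemma dyadic_sets_Un: "A \<in> dyadic_sets \<Longrightarrow> B \<in> dyadic_sets \<Longrightarrow> A \<union> B \<in> dyadic_sets"
proof -
  assume "A \<in> dyadic_sets" "B \<in> dyadic_sets"
  then obtain L K where "dyadic L (\<lambda>x. x \<in> A)" "dyadic K (\<lambda>x. x \<in> B)"
    by (auto simp: dyadic_sets_def)
  then have "dyadic (max L K) (\<lambda>x. x \<in> A)" "dyadic (max L K) (\<lambda>x. x \<in> B)"
    by (auto intro: dyadic_mono)
  then have "dyadic (max L K) (\<lambda>x. x \<in> A \<union> B)" by (auto simp: dyadic_def)
  then show ?thesis by (auto simp: dyadic_sets_def)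
qed

lemma dyadic_sets_compl: "A \<in> dyadic_sets \<Longrightarrow> UNIV - A \<in> dyadic_sets"
  by (auto simp: dyadic_sets_def dyadic_def)

lemma measure_I01_sym_diff_triangle:
  assumes "X \<in> sets borel" "Y \<in> sets borel" "Z \<in> sets borel"
  shows "measure I01 (sym_diff X Z) \<le> measure I01 (sym_diff X Y) + measure I01 (sym_diff Y Z)"
proof -
  have "measure I01 (sym_diff X Z) \<le> measure I01 (sym_diff X Y \<union> sym_diff Y Z)"
    using assms by (intro I01.finite_measure_mono) auto
  also have "\<dots> \<le> measure I01 (sym_diff X Y) + measure I01 (sym_diff Y Z)"
    using assms by (intro measure_Un_le) auto
  finally show ?thesis .
qed

text \<open>The sets approximable in measure form a \<sigma>-algebra containing the open rays. A
  countable union is first cut down to a finite one by continuity from below, at the cost of half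
  the error.\<close>

lemma dyadic_approximation:
  assumes "A \<in> sets borel" "0 < e"
  obtains B where "B \<in> dyadic_sets" "measure I01 (sym_diff A B) < e"
proof -
  define appr where
    "appr A \<longleftrightarrow> A \<in> sets borel \<and> (\<forall>e>0. \<exists>B\<in>dyadic_sets. measure I01 (sym_diff A B) < e)" for A :: "real set"
  have b: "B \<in> sets borel" if "B \<in> dyadic_sets" for B using that dyadic_sets_borel by auto
  have Un: "appr (A \<union> B)" if "appr A" "appr B" for A B
    unfolding appr_def
  proof (intro conjI allI impI)
    fix e :: real assume "0 < e"
    then obtain A' B' where A': "A' \<in> dyadic_sets" "measure I01 (sym_diff A A') < e / 2"
      and B': "B' \<in> dyadic_sets" "measure I01 (sym_diff B B') < e / 2"
      using \<open>appr A\<close> \<open>appr B\<close> unfolding appr_def by (meson half_gt_zero)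
    have s: "A \<in> sets borel" "B \<in> sets borel" "A' \<in> sets borel" "B' \<in> sets borel"
      using that A' B' b by (auto simp: appr_def)
    have "measure I01 (sym_diff (A \<union> B) (A' \<union> B')) \<le> measure I01 (sym_diff A A' \<union> sym_diff B B')"
      using s by (intro I01.finite_measure_mono) auto
    also have "\<dots> \<le> measure I01 (sym_diff A A') + measure I01 (sym_diff B B')"
      using s by (intro measure_Un_le) auto
    also have "\<dots> < e" using A' B' by simp
    finally show "\<exists>C\<in>dyadic_sets. measure I01 (sym_diff (A \<union> B) C) < e"
      using dyadic_sets_Un[OF A'(1) B'(1)] by blast
  qed (use that in \<open>auto simp: appr_def\<close>)
  have empty: "appr {}"
    unfolding appr_def by (auto intro!: bexI[of _ "{}"] simp: dyadic_sets_def dyadic_def)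
  have "A \<in> sigma_sets UNIV (range (\<lambda>a::real. {a<..}))"
    using assms(1) by (simp add: borel_Ioi)
  then have "appr A"
  proof (induction rule: sigma_sets.induct)
    case (Basic A)
    then obtain a where A: "A = {a<..}" by auto
    show ?case unfolding appr_def
    proof (intro conjI allI impI)
      fix e :: real assume "0 < e"
      then obtain L where L: "(1 / 2) ^ L < e" using real_arch_pow_inv[of e "1/2"] by auto
      \<comment> \<open>Rounding down can remove only points of the ray within
        \<open>1 / 2 ^ L\<close> of \<open>a\<close>, and adds none.\<close>
      let ?B = "{x. a < dyadic_floor L x}"
      have B: "?B \<in> dyadic_sets"
        by (auto simp: dyadic_sets_def dyadic_def dyadic_floor_dyadic_floor intro!: exI[of _ L])
      have sub: "sym_diff A ?B \<subseteq> {a..a + 1 / 2 ^ L}"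
      proof
        fix x assume "x \<in> sym_diff A ?B"
        then show "x \<in> {a..a + 1 / 2 ^ L}"
          using dyadic_floor_le[where L=L and x=x] by (auto simp: A)
      qed
      have "measure I01 (sym_diff A ?B) \<le> measure I01 {a..a + 1 / 2 ^ L}"
        using sub by (rule I01.finite_measure_mono) auto
      also have "\<dots> \<le> measure lborel {a..a + 1 / 2 ^ L}"
      proof -
        have "emeasure I01 {a..a + 1 / 2 ^ L} \<le> emeasure lborel {a..a + 1 / 2 ^ L}"
          unfolding emeasure_I01[OF borel_closed[OF closed_atLeastAtMost]] by (rule emeasure_mono) auto
        then show ?thesis unfolding measure_def by (rule enn2real_mono) simp
      qed
      also have "\<dots> < e" using L by (simp add: power_one_over)
      finally show "\<exists>B\<in>dyadic_sets. measure I01 (sym_diff A B) < e" using B by blast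
    qed (simp add: A)
  next
    case Empty
    then show ?case by (rule empty)
  next
    case (Compl A)
    then have A: "A \<in> sets borel" by (simp add: appr_def)
    show ?case unfolding appr_def
    proof (intro conjI allI impI)
      fix e :: real assume "0 < e"
      then obtain B where B: "B \<in> dyadic_sets" "measure I01 (sym_diff A B) < e"
        using Compl.IH by (auto simp: appr_def)
      moreover have "sym_diff (UNIV - A) (UNIV - B) = sym_diff A B" by auto
      ultimately show "\<exists>B\<in>dyadic_sets. measure I01 (sym_diff (UNIV - A) B) < e"
        using dyadic_sets_compl[OF B(1)] by metis
    qed (use A in auto)
  next
    case (Union A)
    let ?X = "\<lambda>n. \<Union>i<n. A i"
    have X: "appr (?X n)" for n
      by (induction n) (auto simp: lessThan_Suc empty intro!: Un Union.IH)
    have m [measurable]: "A i \<in> sets borel" for i using Union.IH by (auto simp: appr_def)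
    have "(\<lambda>n. measure I01 (?X n)) \<longlonglongrightarrow> measure I01 (\<Union>n. ?X n)"
      by (intro I01.finite_Lim_measure_incseq incseq_SucI) (auto simp: lessThan_Suc)
    moreover have "(\<Union>n. ?X n) = (\<Union>i. A i)" by auto
    ultimately have lim: "(\<lambda>n. measure I01 (?X n)) \<longlonglongrightarrow> measure I01 (\<Union>i. A i)" by simp
    show ?case unfolding appr_def
    proof (intro conjI allI impI)
      fix e :: real assume e: "0 < e"
      then have "\<forall>\<^sub>F n in sequentially. dist (measure I01 (?X n)) (measure I01 (\<Union>i. A i)) < e / 2"
        by (intro tendstoD[OF lim]) simp
      then obtain n where n: "dist (measure I01 (?X n)) (measure I01 (\<Union>i. A i)) < e / 2"
        by (auto simp: eventually_sequentially)
      obtain B where B: "B \<in> dyadic_sets" "measure I01 (sym_diff (?X n) B) < e / 2"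
        using X[of n] e unfolding appr_def by (meson half_gt_zero)
      have "measure I01 ((\<Union>i. A i) - ?X n) = measure I01 (\<Union>i. A i) - measure I01 (?X n)"
        by (intro I01.finite_measure_Diff) auto
      also have "\<dots> < e / 2" using n unfolding dist_real_def by linarith
      also have "(\<Union>i. A i) - ?X n = sym_diff (\<Union>i. A i) (?X n)" by auto
      finally have "measure I01 (sym_diff (\<Union>i. A i) B) < e"
        using measure_I01_sym_diff_triangle[of "\<Union>i. A i" "?X n" B] B b by simp
      then show "\<exists>B\<in>dyadic_sets. measure I01 (sym_diff (\<Union>i. A i) B) < e" using B by blast
    qed simp
  qed
  then show ?thesis using that assms(2) by (auto simp: appr_def)
qed

text \<open>The rectangles differ only inside two strips, one over \<open>sym_diff S A\<close> and
  one over \<open>sym_diff T B\<close>, and the integrand is at most \<open>b\<close> there.\<close>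

lemma (in prob_space) set_integral_rectangle_diff:
  fixes g :: "'a \<times> 'a \<Rightarrow> real"
  assumes g: "g \<in> borel_measurable (M \<Otimes>\<^sub>M M)" "\<And>p. \<bar>g p\<bar> \<le> b"
    and s: "S \<in> sets M" "T \<in> sets M" "A \<in> sets M" "B \<in> sets M"
  shows "\<bar>(LINT p:S \<times> T|M \<Otimes>\<^sub>M M. g p) - (LINT p:A \<times> B|M \<Otimes>\<^sub>M M. g p)\<bar>
    \<le> b * (prob (sym_diff S A) + prob (sym_diff T B))"
proof -
  have times: "emeasure (M \<Otimes>\<^sub>M M) (X \<times> Y) = emeasure M X * emeasure M Y"
    if "X \<in> sets M" "Y \<in> sets M" for X Y
    using that by (rule emeasure_pair_measure_Times)
  have one: "emeasure M (space M) = 1" by (rule emeasure_space_1)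
  interpret pair_prob_space M M by (rule pair_prob_space_self)
  have b: "0 \<le> b" using order_trans[OF abs_ge_zero g(2)] .
  note [measurable] = s g(1)
  let ?X = "sym_diff S A \<times> space M" and ?Y = "space M \<times> sym_diff T B"
  have XY: "?X \<in> sets (M \<Otimes>\<^sub>M M)" "?Y \<in> sets (M \<Otimes>\<^sub>M M)" using s by auto
  have i: "set_integrable (M \<Otimes>\<^sub>M M) C g" if "C \<in> sets (M \<Otimes>\<^sub>M M)" for C
    using g that by (rule P.set_integrable_bounded)
  have ind: "integrable (M \<Otimes>\<^sub>M M) (\<lambda>p. indicator C p :: real)" if "C \<in> sets (M \<Otimes>\<^sub>M M)" for C
    using that by (intro P.integrable_bounded[where B=1]) (auto split: split_indicator)
  have "(LINT p:S \<times> T|M \<Otimes>\<^sub>M M. g p) - (LINT p:A \<times> B|M \<Otimes>\<^sub>M M. g p)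
      = (\<integral>p. indicator (S \<times> T) p *\<^sub>R g p - indicator (A \<times> B) p *\<^sub>R g p \<partial>(M \<Otimes>\<^sub>M M))"
    unfolding set_lebesgue_integral_def
    using i s by (intro Bochner_Integration.integral_diff[symmetric]) (auto simp: set_integrable_def)
  also have "\<bar>\<dots>\<bar> \<le> (\<integral>p. \<bar>indicator (S \<times> T) p *\<^sub>R g p - indicator (A \<times> B) p *\<^sub>R g p\<bar> \<partial>(M \<Otimes>\<^sub>M M))"
    by (rule integral_abs_bound)
  also have "\<dots> \<le> (\<integral>p. b * (indicator ?X p + indicator ?Y p) \<partial>(M \<Otimes>\<^sub>M M))"
  proof (intro integral_mono)
    show "integrable (M \<Otimes>\<^sub>M M) (\<lambda>p. \<bar>indicator (S \<times> T) p *\<^sub>R g p - indicator (A \<times> B) p *\<^sub>R g p\<bar>)"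
      using i[of "S \<times> T"] i[of "A \<times> B"] s
      by (intro integrable_abs Bochner_Integration.integrable_diff) (auto simp: set_integrable_def)
    show "integrable (M \<Otimes>\<^sub>M M) (\<lambda>p. b * (indicator ?X p + indicator ?Y p))"
      using ind[OF XY(1)] ind[OF XY(2)] by (intro integrable_mult_right Bochner_Integration.integrable_add)
    fix p assume "p \<in> space (M \<Otimes>\<^sub>M M)"
    then show "\<bar>indicator (S \<times> T) p *\<^sub>R g p - indicator (A \<times> B) p *\<^sub>R g p\<bar> \<le> b * (indicator ?X p + indicator ?Y p)"
      using g(2)[of p] b by (cases p) (auto simp: indicator_def space_pair_measure)
  qed
  also have "\<dots> = b * (P.prob ?X + P.prob ?Y)"
    using ind[OF XY(1)] ind[OF XY(2)] XY by simp
  also have "P.prob ?X = measure M (sym_diff S A)"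
    using s by (simp add: measure_def times one)
  also have "P.prob ?Y = measure M (sym_diff T B)"
    using s by (simp add: measure_def times one)
  finally show ?thesis .
qed

text \<open>Rectangle integrals of a bounded function depend continuously on the sides, so a bound
  on dyadic rectangles extends to all of them without any loss in \<open>c\<close>.\<close>

lemma cut_bound_dyadicI:
  assumes g: "g \<in> borel_measurable (I01 \<Otimes>\<^sub>M I01)" "\<And>p. \<bar>g p\<bar> \<le> b"
    and c: "\<And>A B. A \<in> dyadic_sets \<Longrightarrow> B \<in> dyadic_sets \<Longrightarrow> \<bar>LINT p:A \<times> B|I01 \<Otimes>\<^sub>M I01. g p\<bar> \<le> c"
  shows "cut_bound I01 g c"
proof (rule cut_boundI)
  fix S T assume "S \<in> sets I01" "T \<in> sets I01"
  then have ST: "S \<in> sets borel" "T \<in> sets borel" by auto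
  have b: "0 \<le> b" using order_trans[OF abs_ge_zero g(2)] .
  show "\<bar>LINT p:S \<times> T|I01 \<Otimes>\<^sub>M I01. g p\<bar> \<le> c"
  proof (rule field_le_epsilon)
    fix e :: real assume e: "0 < e"
    \<comment> \<open>The denominator \<open>b + 1\<close> instead of \<open>b\<close> covers the
      case \<open>b = 0\<close>.\<close>
    define d where "d = e / (b + 1) / 2"
    have d: "0 < d" using e b by (simp add: d_def)
    obtain A where A: "A \<in> dyadic_sets" "measure I01 (sym_diff S A) < d"
      using dyadic_approximation[OF ST(1) d] .
    obtain B where B: "B \<in> dyadic_sets" "measure I01 (sym_diff T B) < d"
      using dyadic_approximation[OF ST(2) d] .
    have "\<bar>(LINT p:S \<times> T|I01 \<Otimes>\<^sub>M I01. g p) - (LINT p:A \<times> B|I01 \<Otimes>\<^sub>M I01. g p)\<bar>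
      \<le> b * (measure I01 (sym_diff S A) + measure I01 (sym_diff T B))"
      using A B ST dyadic_sets_borel by (intro I01.set_integral_rectangle_diff g) auto
    also have "\<dots> \<le> b * (d + d)" using A B b by (intro mult_left_mono) auto
    also have "\<dots> = b * (e / (b + 1))" unfolding d_def field_sum_of_halves ..
    also have "\<dots> \<le> e" using b e by (simp add: pos_divide_le_eq distrib_left)
    finally show "\<bar>LINT p:S \<times> T|I01 \<Otimes>\<^sub>M I01. g p\<bar> \<le> c + e" using c[OF A(1) B(1)] by linarith
  qed
qed

text \<open>The \<open>k\<close>-step kernel of a Frieze--Kannan decomposition: the type of a point records in which
  of the left and of the right test sets it lies.\<close>

definition step_kernel :: "(nat \<Rightarrow> real) \<Rightarrow> nat \<Rightarrow> nat set \<times> nat set \<Rightarrow> nat set \<times> nat set \<Rightarrow> real" where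
  "step_kernel s k p q = (\<Sum>i<k. if i \<in> fst p \<and> i \<in> snd q then s i else 0)"

lemma step_kernel_abs_le:
  assumes "\<And>i. i < k \<Longrightarrow> s i \<in> {- e, 0, e}" "0 \<le> e"
  shows "\<bar>step_kernel s k p q\<bar> \<le> real k * e"
proof -
  have "\<bar>step_kernel s k p q\<bar> \<le> (\<Sum>i<k. e)"
    unfolding step_kernel_def using assms
    by (intro order_trans[OF sum_abs] sum_mono) fastforce
  then show ?thesis by simp
qed

text \<open>The integers behind the two arguments range over countable sets, so \<open>h\<close> can
  be arbitrary; the countable case distinction is made for one coordinate at a time.\<close>

lemma dyadic_pair_measurable:
  assumes "dyadic L f" "dyadic L' f'"
  shows "(\<lambda>(x, y). h (f x) (f' y)) \<in> borel_measurable (I01 \<Otimes>\<^sub>M I01)"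
proof -
  define u where "u = (\<lambda>p :: real \<times> real. \<lfloor>2 ^ L * fst p\<rfloor>)"
  define v where "v = (\<lambda>p :: real \<times> real. \<lfloor>2 ^ L' * snd p\<rfloor>)"
  have [measurable]: "u \<in> I01 \<Otimes>\<^sub>M I01 \<rightarrow>\<^sub>M count_space UNIV" "v \<in> I01 \<Otimes>\<^sub>M I01 \<rightarrow>\<^sub>M count_space UNIV"
    unfolding u_def v_def by measurable
  have "(\<lambda>p. h (f (of_int (u p) / 2 ^ L)) (f' (of_int j / 2 ^ L'))) \<in> borel_measurable (I01 \<Otimes>\<^sub>M I01)" for j
    by (rule measurable_compose_countable[of "\<lambda>i p. h (f (of_int i / 2 ^ L)) (f' (of_int j / 2 ^ L'))"]) auto
  then have "(\<lambda>p. h (f (of_int (u p) / 2 ^ L)) (f' (of_int (v p) / 2 ^ L'))) \<in> borel_measurable (I01 \<Otimes>\<^sub>M I01)"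
    by (rule measurable_compose_countable[of "\<lambda>j p. h (f (of_int (u p) / 2 ^ L)) (f' (of_int j / 2 ^ L'))"]) auto
  moreover have "f (of_int (u p) / 2 ^ L) = f (fst p)" "f' (of_int (v p) / 2 ^ L') = f' (snd p)" for p
    using assms by (auto simp: u_def v_def dyadic_def dyadic_floor_def)
  ultimately show ?thesis by (simp add: split_beta')
qed

text \<open>The greedy procedure tests against dyadic rectangles only, which makes the resulting
  sides dyadic; density of dyadic sets then gives the bound against all measurable rectangles. The
  number \<open>k\<close> of steps depends on \<open>e\<close> alone, whereas the level
  \<open>L\<close> depends on \<open>g\<close>.\<close>

lemma weak_regularity_dyadic:
  assumes g: "g \<in> borel_measurable (I01 \<Otimes>\<^sub>M I01)" "\<And>p. \<bar>g p\<bar> \<le> 1"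
    and e: "0 < e" and k: "1 < real k * e\<^sup>2"
  obtains s \<tau> L where "s \<in> {..<k} \<rightarrow>\<^sub>E {- e, 0, e}" "dyadic L \<tau>" "\<And>x. \<tau> x \<in> Pow {..<k} \<times> Pow {..<k}"
    "cut_bound I01 (\<lambda>(x, y). g (x, y) - step_kernel s k (\<tau> x) (\<tau> y)) e"
proof -
  have D: "dyadic_sets \<subseteq> sets I01" "dyadic_sets \<noteq> {}"
    using dyadic_sets_borel by (auto simp: dyadic_sets_def dyadic_def)
  obtain s0 S T where s: "\<And>i. i < k \<Longrightarrow> s0 i \<in> {- e, 0, e}"
    and S: "\<And>i. i < k \<Longrightarrow> S i \<in> dyadic_sets" and T: "\<And>i. i < k \<Longrightarrow> T i \<in> dyadic_sets"
    and le: "\<And>A B. A \<in> dyadic_sets \<Longrightarrow> B \<in> dyadic_sets \<Longrightarrow>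
      \<bar>LINT p:A \<times> B|I01 \<Otimes>\<^sub>M I01. g p - (\<Sum>i<k. s0 i * indicator (S i \<times> T i) p)\<bar> \<le> e"
    using I01.weak_regularity[OF g D e k] by blast
  \<comment> \<open>Restriction makes the coefficient vector extensional, so that it belongs to a
    finite function space, as the later pigeonhole argument requires.\<close>
  define s where "s = restrict s0 {..<k}"
  have s': "\<And>i. i < k \<Longrightarrow> s i \<in> {- e, 0, e}" using s by (auto simp: s_def)
  obtain l m where l: "\<And>i. i < k \<Longrightarrow> dyadic (l i) (\<lambda>x. x \<in> S i)"
    and m: "\<And>i. i < k \<Longrightarrow> dyadic (m i) (\<lambda>x. x \<in> T i)"
    using S T unfolding dyadic_sets_def mem_Collect_eq by metis
  \<comment> \<open>The sum is just a convenient common upper bound for the levels of all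
    sides.\<close>
  define L where "L = (\<Sum>i<k. l i + m i)"
  have "l i + m i \<le> L" if "i < k" for i unfolding L_def using that by (intro member_le_sum) auto
  then have lm: "l i \<le> L" "m i \<le> L" if "i < k" for i using that by (meson add_leD1 add_leD2)+
  define \<tau> where "\<tau> x = ({i. i < k \<and> x \<in> S i}, {i. i < k \<and> x \<in> T i})" for x
  have "dyadic L \<tau>"
    using dyadic_mono[OF l lm(1)] dyadic_mono[OF m lm(2)] by (auto simp: dyadic_def \<tau>_def)
  have eq: "(\<lambda>(x, y). g (x, y) - step_kernel s k (\<tau> x) (\<tau> y))
    = (\<lambda>p. g p - (\<Sum>i<k. s0 i * indicator (S i \<times> T i) p))"
  proof (rule ext, clarify)
    fix x y
    have "step_kernel s k (\<tau> x) (\<tau> y) = (\<Sum>i<k. s0 i * indicator (S i \<times> T i) (x, y))"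
      unfolding step_kernel_def by (rule sum.cong) (auto simp: \<tau>_def s_def indicator_def)
    then show "g (x, y) - step_kernel s k (\<tau> x) (\<tau> y) = g (x, y) - (\<Sum>i<k. s0 i * indicator (S i \<times> T i) (x, y))"
      by simp
  qed
  have "cut_bound I01 (\<lambda>(x, y). g (x, y) - step_kernel s k (\<tau> x) (\<tau> y)) e"
  proof (rule cut_bound_dyadicI)
    show "(\<lambda>(x, y). g (x, y) - step_kernel s k (\<tau> x) (\<tau> y)) \<in> borel_measurable (I01 \<Otimes>\<^sub>M I01)"
      using g(1) dyadic_pair_measurable[OF \<open>dyadic L \<tau>\<close> \<open>dyadic L \<tau>\<close>, of "step_kernel s k"]
      by (simp add: split_beta')
    \<comment> \<open>Any finite bound serves: it feeds the density argument and does not enter the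
      resulting constant \<open>e\<close>.\<close>
    show "\<bar>case p of (x, y) \<Rightarrow> g (x, y) - step_kernel s k (\<tau> x) (\<tau> y)\<bar> \<le> 1 + real k * e" for p
      using g(2)[of p] step_kernel_abs_le[of k s e "\<tau> (fst p)" "\<tau> (snd p)"] s' e
      by (auto simp: split_beta')
  qed (use le in \<open>simp add: eq\<close>)
  moreover have "s \<in> {..<k} \<rightarrow>\<^sub>E {- e, 0, e}" using s' by (auto simp: s_def)
  moreover have "\<tau> x \<in> Pow {..<k} \<times> Pow {..<k}" for x by (auto simp: \<tau>_def)
  ultimately show ?thesis using that[of s L \<tau>] \<open>dyadic L \<tau>\<close> by blast
qed

section \<open>Rearrangements by permuting dyadic intervals\<close>

text \<open>The maps are mutually inverse everywhere and respect the closed unit interval exactly,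
  since \<open>invertible_measure_preserving\<close> asks for a true bijection of it. Carrying the
  inverse \<open>h\<close> explicitly keeps its measurability at hand.\<close>

definition rearrangement :: "(real \<Rightarrow> real) \<Rightarrow> (real \<Rightarrow> real) \<Rightarrow> bool" where
  "rearrangement f h \<longleftrightarrow> f \<in> borel_measurable borel \<and> h \<in> borel_measurable borel \<and>
     (\<forall>x. h (f x) = x) \<and> (\<forall>x. f (h x) = x) \<and> (\<forall>x. f x \<in> {0..1} \<longleftrightarrow> x \<in> {0..1}) \<and>
     distr I01 I01 f = I01"

lemma rearrangement_id: "rearrangement (\<lambda>x. x) (\<lambda>x. x)"
  by (simp add: rearrangement_def)

lemma rearrangement_measurable:
  assumes "rearrangement f h" shows "f \<in> I01 \<rightarrow>\<^sub>M I01" "h \<in> I01 \<rightarrow>\<^sub>M I01"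
  using assms by (auto simp: rearrangement_def measurable_cong_sets[OF sets_I01 sets_I01])

lemma rearrangement_sym:
  assumes "rearrangement f h" shows "rearrangement h f"
proof -
  have "I01 = distr I01 I01 (\<lambda>x. x)" by (metis distr_id)
  also have "\<dots> = distr (distr I01 I01 f) I01 h"
    using assms rearrangement_measurable[OF assms]
    by (subst distr_distr) (auto simp: rearrangement_def o_def)
  also have "\<dots> = distr I01 I01 h" using assms by (simp add: rearrangement_def)
  finally show ?thesis using assms unfolding rearrangement_def by metis
qed

lemma rearrangement_comp:
  assumes "rearrangement f h" "rearrangement f' h'"
  shows "rearrangement (\<lambda>x. f (f' x)) (\<lambda>x. h' (h x))"
proof -
  have "distr I01 I01 (\<lambda>x. f (f' x)) = distr (distr I01 I01 f') I01 f"
    using rearrangement_measurable[OF assms(1)] rearrangement_measurable[OF assms(2)]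
    by (simp add: distr_distr o_def)
  then have "distr I01 I01 (\<lambda>x. f (f' x)) = I01" using assms by (simp add: rearrangement_def)
  then show ?thesis using assms unfolding rearrangement_def
    by (auto intro: measurable_compose)
qed

text \<open>For each colour \<open>q\<close>, as many points of \<open>c\<close>-colour
  \<open>q\<close> as possible are matched with points of \<open>d\<close>-colour \<open>q\<close>.
  At most \<open>t\<close> points per colour are left over; the two leftover sets have equal size
  and are matched arbitrarily, so only these can be wrong.\<close>

lemma matching_permutation:
  fixes c d :: "'a \<Rightarrow> 'b"
  assumes X: "finite X" and Q: "finite Q" "c ` X \<subseteq> Q" "d ` X \<subseteq> Q"
    and t: "\<And>q. q \<in> Q \<Longrightarrow> real (card {j\<in>X. c j = q}) \<le> real (card {j\<in>X. d j = q}) + t" "0 \<le> t"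
  obtains \<pi> where "\<pi> permutes X" "real (card {j\<in>X. c j \<noteq> d (\<pi> j)}) \<le> real (card Q) * t"
proof -
  let ?C = "\<lambda>q. {j\<in>X. c j = q}" and ?D = "\<lambda>q. {j\<in>X. d j = q}"
  define good where "good q A B \<longleftrightarrow>
    A \<subseteq> ?C q \<and> B \<subseteq> ?D q \<and> card A = card B \<and> real (card (?C q - A)) \<le> t" for q A B
  have "\<exists>A B. good q A B" if q: "q \<in> Q" for q
  proof -
    let ?m = "min (card (?C q)) (card (?D q))"
    obtain A where A: "A \<subseteq> ?C q" "card A = ?m"
      by (rule obtain_subset_with_card_n[of ?m "?C q"]) auto
    obtain B where B: "B \<subseteq> ?D q" "card B = ?m"
      by (rule obtain_subset_with_card_n[of ?m "?D q"]) auto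
    have "card (?C q - A) = card (?C q) - ?m"
      using A X by (subst card_Diff_subset) (auto intro: finite_subset)
    then have "real (card (?C q - A)) \<le> t" using t(1)[OF q] t(2) by linarith
    then have "good q A B" using A B by (simp add: good_def)
    then show ?thesis by blast
  qed
  then obtain A B where "\<And>q. q \<in> Q \<Longrightarrow> good q (A q) (B q)" by metis
  then have A: "\<And>q. q \<in> Q \<Longrightarrow> A q \<subseteq> ?C q" and B: "\<And>q. q \<in> Q \<Longrightarrow> B q \<subseteq> ?D q"
    and AB: "\<And>q. q \<in> Q \<Longrightarrow> card (A q) = card (B q)"
    and le: "\<And>q. q \<in> Q \<Longrightarrow> real (card (?C q - A q)) \<le> t"
    unfolding good_def by blast+
  have fin: "finite (A q)" "finite (B q)" if "q \<in> Q" for q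
    using A[OF that] B[OF that] X by (auto intro: finite_subset)
  have "\<exists>h. bij_betw h (A q) (B q)" if "q \<in> Q" for q
    using fin[OF that] AB[OF that] by (intro finite_same_card_bij) auto
  then obtain h where h: "\<And>q. q \<in> Q \<Longrightarrow> bij_betw (h q) (A q) (B q)" by metis
  let ?A = "\<Union>q\<in>Q. A q" and ?B = "\<Union>q\<in>Q. B q"
  define f where "f j = h (c j) j" for j
  have cA: "c j = q" if "q \<in> Q" "j \<in> A q" for q j using A that by blast
  have dB: "d j = q" if "q \<in> Q" "j \<in> B q" for q j using B that by blast
  have f: "bij_betw f (A q) (B q)" if "q \<in> Q" for q
    using h[OF that] by (rule bij_betw_cong[THEN iffD1, rotated]) (use that cA in \<open>auto simp: f_def\<close>)
  have "bij_betw f ?A ?B"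
  proof (rule bij_betw_UNION_disjoint)
    show "disjoint_family_on B Q"
      using dB by (auto simp: disjoint_family_on_def)
  qed (rule f)
  moreover have sub: "?A \<subseteq> X" "?B \<subseteq> X" using A B by auto
  ultimately have "card (X - ?A) = card (X - ?B)"
    using X by (simp add: card_Diff_subset finite_subset bij_betw_same_card)
  then obtain r where r: "bij_betw r (X - ?A) (X - ?B)"
    using X finite_same_card_bij by (metis finite_Diff)
  define \<pi> where "\<pi> j = (if j \<in> ?A then f j else if j \<in> X then r j else j)" for j
  have "bij_betw \<pi> ?A ?B"
    using \<open>bij_betw f ?A ?B\<close> by (rule bij_betw_cong[THEN iffD1, rotated]) (simp add: \<pi>_def)
  moreover have "bij_betw \<pi> (X - ?A) (X - ?B)"
    using r by (rule bij_betw_cong[THEN iffD1, rotated]) (simp add: \<pi>_def)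
  ultimately have "bij_betw \<pi> (?A \<union> (X - ?A)) (?B \<union> (X - ?B))"
    by (rule bij_betw_combine) auto
  moreover have "?A \<union> (X - ?A) = X" "?B \<union> (X - ?B) = X" using sub by auto
  ultimately have "\<pi> permutes X"
    using sub by (intro bij_imp_permutes) (auto simp: \<pi>_def)
  moreover have "real (card {j\<in>X. c j \<noteq> d (\<pi> j)}) \<le> real (card Q) * t"
  proof -
    have "{j\<in>X. c j \<noteq> d (\<pi> j)} \<subseteq> (\<Union>q\<in>Q. ?C q - A q)"
    proof
      fix j assume j: "j \<in> {j\<in>X. c j \<noteq> d (\<pi> j)}"
      then have "c j \<in> Q" using Q by auto
      moreover have "j \<notin> A (c j)"
      proof
        assume "j \<in> A (c j)"
        then have "\<pi> j = f j" "f j \<in> B (c j)"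
          using \<open>c j \<in> Q\<close> f by (auto simp: \<pi>_def bij_betw_def)
        then show False using dB \<open>c j \<in> Q\<close> j by auto
      qed
      ultimately show "j \<in> (\<Union>q\<in>Q. ?C q - A q)" using j by auto
    qed
    then have "card {j\<in>X. c j \<noteq> d (\<pi> j)} \<le> card (\<Union>q\<in>Q. ?C q - A q)"
      using X Q by (intro card_mono) auto
    also have "\<dots> \<le> (\<Sum>q\<in>Q. card (?C q - A q))" by (rule card_UN_le[OF Q(1)])
    finally have "real (card {j\<in>X. c j \<noteq> d (\<pi> j)}) \<le> real (\<Sum>q\<in>Q. card (?C q - A q))"
      by (rule of_nat_mono)
    also have "\<dots> = (\<Sum>q\<in>Q. real (card (?C q - A q)))" by (rule of_nat_sum)
    also have "\<dots> \<le> (\<Sum>q\<in>Q. t)" using le by (intro sum_mono)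
    finally show ?thesis by simp
  qed
  ultimately show ?thesis using that by blast
qed

text \<open>Translates the dyadic interval with index \<open>j\<close> rigidly onto the one with
  index \<open>\<pi> j\<close>.\<close>

definition cell_map :: "nat \<Rightarrow> (int \<Rightarrow> int) \<Rightarrow> real \<Rightarrow> real" where
  "cell_map L \<pi> x = x + of_int (\<pi> \<lfloor>2 ^ L * x\<rfloor> - \<lfloor>2 ^ L * x\<rfloor>) / 2 ^ L"

lemma floor_cell_map: "\<lfloor>2 ^ L * cell_map L \<pi> x\<rfloor> = \<pi> \<lfloor>2 ^ L * x\<rfloor>"
proof -
  have "2 ^ L * cell_map L \<pi> x = 2 ^ L * x + of_int (\<pi> \<lfloor>2 ^ L * x\<rfloor> - \<lfloor>2 ^ L * x\<rfloor>)"
    by (simp add: cell_map_def field_simps)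
  then show ?thesis by (simp only: floor_add_int) simp
qed

lemma cell_map_inverse: "(\<And>j. \<sigma> (\<pi> j) = j) \<Longrightarrow> cell_map L \<sigma> (cell_map L \<pi> x) = x"
  by (subst cell_map_def[of L \<sigma>]) (simp add: floor_cell_map, simp add: cell_map_def field_simps)

lemma cell_map_measurable: "cell_map L \<pi> \<in> borel_measurable borel"
proof -
  have "(\<lambda>x::real. x + of_int (\<pi> \<lfloor>2 ^ L * x\<rfloor> - \<lfloor>2 ^ L * x\<rfloor>) / 2 ^ L) \<in> borel_measurable borel"
    by (rule measurable_compose_countable[of "\<lambda>j x. x + of_int (\<pi> j - j) / 2 ^ L"]) measurable
  then show ?thesis by (simp add: cell_map_def[abs_def])
qed

text \<open>On each of the countably many cells the map is a translation, which preserves Lebesgue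
  measure; the bijection only reindexes the sum over cells.\<close>

lemma distr_cell_map_lborel:
  assumes "bij \<pi>"
  shows "distr lborel borel (cell_map L \<pi>) = lborel"
proof (rule measure_eqI)
  fix A assume "A \<in> sets (distr lborel borel (cell_map L \<pi>))"
  then have A [measurable]: "A \<in> sets borel" by simp
  let ?E = "\<lambda>A j. {x::real. \<lfloor>2 ^ L * x\<rfloor> = j} \<inter> A"
  have fl [measurable]: "{x::real. \<lfloor>2 ^ L * x\<rfloor> = j} \<in> sets borel" for j :: int
    using dyadic_vimage_borel[of L "\<lambda>x. \<lfloor>2 ^ L * x\<rfloor>" "{j}"]
    by (simp add: dyadic_def dyadic_floor_def vimage_def)
  have split: "emeasure lborel B = (\<integral>\<^sup>+j. emeasure lborel (?E B j) \<partial>count_space UNIV)"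
    if [measurable]: "B \<in> sets borel" for B
  proof -
    have "emeasure lborel (\<Union>j\<in>UNIV. ?E B j) = (\<integral>\<^sup>+j. emeasure lborel (?E B j) \<partial>count_space UNIV)"
      by (rule emeasure_UN_countable) (auto simp: disjoint_family_on_def)
    moreover have "(\<Union>j\<in>UNIV. ?E B j) = B" by auto
    ultimately show ?thesis by simp
  qed
  have m: "cell_map L \<pi> \<in> borel \<rightarrow>\<^sub>M borel" by (rule cell_map_measurable)
  have pre: "cell_map L \<pi> -` A \<in> sets borel" using measurable_sets[OF m A] by simp
  have cell: "emeasure lborel (?E (cell_map L \<pi> -` A) j) = emeasure lborel (?E A (\<pi> j))" for j
  proof -
    let ?c = "of_int (\<pi> j - j) / 2 ^ L :: real"
    have "?E (cell_map L \<pi> -` A) j = (+) ?c -` (?E A (\<pi> j))"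
    proof (rule set_eqI)
      fix x
      have "\<lfloor>2 ^ L * (?c + x)\<rfloor> = \<lfloor>2 ^ L * x\<rfloor> + (\<pi> j - j)"
      proof -
        have "2 ^ L * (?c + x) = 2 ^ L * x + of_int (\<pi> j - j)" by (simp add: field_simps)
        then show ?thesis by (simp only: floor_add_int)
      qed
      then show "x \<in> ?E (cell_map L \<pi> -` A) j \<longleftrightarrow> x \<in> (+) ?c -` (?E A (\<pi> j))"
        by (auto simp: cell_map_def add.commute)
    qed
    then have "emeasure lborel (?E (cell_map L \<pi> -` A) j) = emeasure (distr lborel borel ((+) ?c)) (?E A (\<pi> j))"
      by (subst emeasure_distr) auto
    then show ?thesis by (simp only: lborel_distr_plus)
  qed
  have "emeasure (distr lborel borel (cell_map L \<pi>)) A = emeasure lborel (cell_map L \<pi> -` A)"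
    using m by (subst emeasure_distr) auto
  also have "\<dots> = (\<integral>\<^sup>+j. emeasure lborel (?E A (\<pi> j)) \<partial>count_space UNIV)"
    by (subst split[OF pre]) (simp only: cell)
  also have "\<dots> = (\<integral>\<^sup>+j. emeasure lborel (?E A j) \<partial>count_space UNIV)"
    using assms by (intro nn_integral_bij_count_space) simp
  also have "\<dots> = emeasure lborel A" by (rule split[OF A, symmetric])
  finally show "emeasure (distr lborel borel (cell_map L \<pi>)) A = emeasure lborel A" .
qed simp

lemma rearrangement_cell_map:
  assumes \<pi>: "\<pi> permutes {0..<2 ^ L}"
  shows "rearrangement (cell_map L \<pi>) (cell_map L (inv \<pi>))"
proof -
  have "bij \<pi>" using \<pi> by (rule permutes_bij)
  have dom: "x \<in> {0..<1} \<longleftrightarrow> \<lfloor>2 ^ L * x\<rfloor> \<in> {0..<2 ^ L}" for x :: real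
  proof -
    have "x < 1 \<longleftrightarrow> 2 ^ L * x < of_int (2 ^ L)" by simp
    also have "\<dots> \<longleftrightarrow> \<lfloor>2 ^ L * x\<rfloor> < 2 ^ L" by (rule floor_less_iff[symmetric])
    finally show ?thesis using mult_le_cancel_left_pos[of "2 ^ L" 0 x] by simp
  qed
  have "cell_map L \<pi> x \<in> {0..<1} \<longleftrightarrow> x \<in> {0..<1}" for x
    unfolding dom floor_cell_map by (rule permutes_in_image[OF \<pi>])
  \<comment> \<open>In particular the point 1, which lies in the cell of index \<open>2 ^ L\<close>,
    is fixed; this passes from invariance of the half-open interval to that of the closed
    one.\<close>
  moreover have "cell_map L \<pi> x = x" if "x \<notin> {0..<1}" for x
    using that permutes_not_in[OF \<pi>] unfolding dom by (simp add: cell_map_def)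
  ultimately have in01: "cell_map L \<pi> x \<in> {0..1} \<longleftrightarrow> x \<in> {0..1}" for x
    by (metis atLeastAtMost_iff atLeastLessThan_iff less_eq_real_def)
  have m: "cell_map L \<pi> \<in> borel \<rightarrow>\<^sub>M borel" by (rule cell_map_measurable)
  have "distr I01 I01 (cell_map L \<pi>) = I01"
  proof (rule measure_eqI)
    fix A assume "A \<in> sets (distr I01 I01 (cell_map L \<pi>))"
    then have A: "A \<in> sets borel" by simp
    have pre: "cell_map L \<pi> -` A \<in> sets borel" using measurable_sets[OF m A] by simp
    have "emeasure (distr I01 I01 (cell_map L \<pi>)) A = emeasure lborel (cell_map L \<pi> -` A \<inter> {0..1})"
      using m A pre by (subst emeasure_distr) (auto simp: emeasure_I01 measurable_cong_sets[OF sets_I01 sets_I01])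
    also have "cell_map L \<pi> -` A \<inter> {0..1} = cell_map L \<pi> -` (A \<inter> {0..1})"
      using in01 by auto
    also have "emeasure lborel \<dots> = emeasure (distr lborel borel (cell_map L \<pi>)) (A \<inter> {0..1})"
      using m A by (subst emeasure_distr) auto
    also have "\<dots> = emeasure I01 A"
      by (simp add: distr_cell_map_lborel \<open>bij \<pi>\<close> emeasure_I01 A)
    finally show "emeasure (distr I01 I01 (cell_map L \<pi>)) A = emeasure I01 A" .
  qed simp
  then show ?thesis
    using in01 \<open>bij \<pi>\<close>
    by (auto simp: rearrangement_def cell_map_measurable bij_is_inj bij_is_surj surj_f_inv_f
        intro!: cell_map_inverse)
qed

text \<open>The cells of index 0 to \<open>2 ^ L - 1\<close> cover the interval except for its right
  end, a null point, and have equal measure. Level sets can therefore be measured by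
  counting.\<close>

lemma measure_I01_dyadic:
  fixes f :: "real \<Rightarrow> 'b"
  assumes "dyadic L f"
  shows "measure I01 {x. P (f x)} = real (card {j\<in>{0..<2 ^ L}. P (f (of_int j / 2 ^ L))}) / 2 ^ L"
proof -
  let ?J = "{j\<in>{0..<2 ^ L}. P (f (of_int j / 2 ^ L))}"
  let ?E = "\<lambda>j :: int. {of_int j / 2 ^ L..<(of_int j + 1) / 2 ^ L :: real}"
  have E: "x \<in> ?E j \<longleftrightarrow> \<lfloor>2 ^ L * x\<rfloor> = j" for x j
    by (simp add: floor_eq_iff field_simps)
  have "measure I01 {x. P (f x)} = measure I01 (\<Union>j\<in>?J. ?E j)"
  proof (rule I01.finite_measure_eq_AE)
    show "AE x in I01. x \<in> {x. P (f x)} \<longleftrightarrow> x \<in> (\<Union>j\<in>?J. ?E j)"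
      using I01_AE_less_1
    proof eventually_elim
      case (elim x)
      have "2 ^ L * x < of_int (2 ^ L)" using elim by simp
      then have "\<lfloor>2 ^ L * x\<rfloor> < 2 ^ L" by (simp only: floor_less_iff)
      moreover have "0 \<le> \<lfloor>2 ^ L * x\<rfloor>" using elim by simp
      ultimately show ?case
        using assms unfolding UN_iff E by (auto simp: dyadic_def dyadic_floor_def)
    qed
    show "{x. P (f x)} \<in> sets I01" using dyadic_vimage_borel[OF assms, of "Collect P"] by (simp add: vimage_def)
  qed auto
  also have "\<dots> = (\<Sum>j\<in>?J. measure I01 (?E j))"
  proof (rule I01.finite_measure_finite_Union)
    show "finite ?J" by (rule finite_subset[of _ "{0..<2 ^ L}"]) auto
    show "disjoint_family_on ?E ?J"
      unfolding disjoint_family_on_def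
    proof (intro ballI impI equals0I)
      fix i j x assume "i \<noteq> j" "x \<in> ?E i \<inter> ?E j"
      then show False using E[of x i] E[of x j] by blast
    qed
  qed auto
  also have "\<dots> = (\<Sum>j\<in>?J. 1 / 2 ^ L)"
  proof (rule sum.cong[OF refl])
    fix j assume j: "j \<in> ?J"
    then have "0 \<le> real_of_int j" "real_of_int j + 1 \<le> 2 ^ L"
      by (auto simp: int_less_real_le)
    then have "0 \<le> of_int j / (2::real) ^ L" "(of_int j + 1) / (2::real) ^ L \<le> 1" by simp_all
    then have "?E j \<subseteq> {0..1}" by (auto simp del: divide_le_eq_1_pos le_divide_eq_1_pos)
    then have "measure I01 (?E j) = measure lborel (?E j)" by (intro measure_I01) auto
    also have "\<dots> = 1 / 2 ^ L" by (simp add: divide_right_mono add_divide_distrib)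
    finally show "measure I01 (?E j) = 1 / 2 ^ L" .
  qed
  finally show ?thesis by simp
qed

text \<open>At a common level, class sizes become numbers of cells and the matching of cells
  applies. The bound is independent of the level, which is crucial because the levels of step
  approximations are not bounded along a sequence.\<close>

lemma dyadic_rearrangement:
  fixes \<tau> \<tau>' :: "real \<Rightarrow> 'b"
  assumes d: "dyadic L \<tau>" "dyadic L' \<tau>'" and Q: "finite Q" "range \<tau> \<subseteq> Q" "range \<tau>' \<subseteq> Q"
    and t: "\<And>q. q \<in> Q \<Longrightarrow> measure I01 {x. \<tau> x = q} \<le> measure I01 {x. \<tau>' x = q} + t" "0 \<le> t"
  obtains f h where "rearrangement f h" "{x. \<tau> x \<noteq> \<tau>' (f x)} \<in> sets borel"
    "measure I01 {x. \<tau> x \<noteq> \<tau>' (f x)} \<le> real (card Q) * t"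
proof -
  define N where "N = max L L'"
  have d: "dyadic N \<tau>" "dyadic N \<tau>'" using d by (auto simp: N_def intro: dyadic_mono)
  let ?X = "{0..<2 ^ N} :: int set"
  let ?c = "\<lambda>j::int. \<tau> (of_int j / 2 ^ N)" and ?d = "\<lambda>j::int. \<tau>' (of_int j / 2 ^ N)"
  have "real (card {j\<in>?X. ?c j = q}) \<le> real (card {j\<in>?X. ?d j = q}) + t * 2 ^ N" if "q \<in> Q" for q
    using t(1)[OF that] measure_I01_dyadic[OF d(1), of "\<lambda>y. y = q"] measure_I01_dyadic[OF d(2), of "\<lambda>y. y = q"]
    by (simp add: field_simps)
  then obtain \<pi> where \<pi>: "\<pi> permutes ?X"
    and le: "real (card {j\<in>?X. ?c j \<noteq> ?d (\<pi> j)}) \<le> real (card Q) * (t * 2 ^ N)"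
    using matching_permutation[of ?X Q ?c ?d "t * 2 ^ N"] Q t(2) by (auto simp: image_subset_iff)
  let ?f = "cell_map N \<pi>"
  \<comment> \<open>The pair of types before and after the permutation is again constant on cells,
    so the set of mismatches is measured by counting as well.\<close>
  have dy: "dyadic N (\<lambda>x. (\<tau> x, \<tau>' (?f x)))"
    unfolding dyadic_def
  proof
    fix x
    have "dyadic_floor N (?f (dyadic_floor N x)) = dyadic_floor N (?f x)"
      by (simp add: dyadic_floor_def floor_cell_map)
    then show "(\<tau> (dyadic_floor N x), \<tau>' (?f (dyadic_floor N x))) = (\<tau> x, \<tau>' (?f x))"
      using d by (metis dyadic_def)
  qed
  have "\<tau>' (?f (of_int j / 2 ^ N)) = ?d (\<pi> j)" for j
    by (simp add: cell_map_def add_divide_distrib[symmetric])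
  then have "measure I01 {x. \<tau> x \<noteq> \<tau>' (?f x)} \<le> real (card Q) * t"
    using measure_I01_dyadic[OF dy, of "\<lambda>(u, v). u \<noteq> v"] le by (simp add: pos_divide_le_eq mult.assoc)
  moreover have "{x. \<tau> x \<noteq> \<tau>' (?f x)} \<in> sets borel"
    using dyadic_vimage_borel[OF dy, of "{(u, v). u \<noteq> v}"] by (simp add: vimage_def)
  ultimately show ?thesis using that[OF rearrangement_cell_map[OF \<pi>]] by blast
qed

section \<open>Compactness of kernels\<close>

text \<open>The bounds hold at every point, so products of kernels need no almost everywhere
  reasoning. Symmetry is left out because the limit density is determined only up to a null set; it
  is symmetrized at the end.\<close>

definition unit_kernel :: "(real \<times> real \<Rightarrow> real) \<Rightarrow> bool" where
  "unit_kernel g \<longleftrightarrow> g \<in> borel_measurable (I01 \<Otimes>\<^sub>M I01) \<and> (\<forall>p. 0 \<le> g p \<and> g p \<le> 1)"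

lemma unit_kernelD:
  assumes "unit_kernel g"
  shows "g \<in> borel_measurable (I01 \<Otimes>\<^sub>M I01)" "0 \<le> g p" "g p \<le> 1" "\<bar>g p\<bar> \<le> 1"
    "integrable (I01 \<Otimes>\<^sub>M I01) g"
proof -
  show *: "g \<in> borel_measurable (I01 \<Otimes>\<^sub>M I01)" "0 \<le> g p" "g p \<le> 1" for p
    using assms unfolding unit_kernel_def by blast+
  then show **: "\<bar>g p\<bar> \<le> 1" for p using *(2)[of p] by simp
  show "integrable (I01 \<Otimes>\<^sub>M I01) g" by (rule I01_pair.integrable_bounded[OF *(1) **])
qed

definition pullback :: "(real \<times> real \<Rightarrow> real) \<Rightarrow> (real \<Rightarrow> real) \<Rightarrow> real \<times> real \<Rightarrow> real" where
  "pullback g f = (\<lambda>(x, y). g (f x, f y))"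

lemma pullback_measurable:
  assumes "g \<in> borel_measurable (I01 \<Otimes>\<^sub>M I01)" "f \<in> I01 \<rightarrow>\<^sub>M I01"
  shows "pullback g f \<in> borel_measurable (I01 \<Otimes>\<^sub>M I01)"
  using assms unfolding pullback_def by measurable

lemma kernel_pullback:
  assumes "unit_kernel g" "rearrangement f h" shows "unit_kernel (pullback g f)"
  using pullback_measurable[OF unit_kernelD(1)[OF assms(1)] rearrangement_measurable(1)[OF assms(2)]] assms(1)
  by (auto simp: unit_kernel_def pullback_def)

lemma cut_bound_pullback:
  assumes "rearrangement f h" "g \<in> borel_measurable (I01 \<Otimes>\<^sub>M I01)" "cut_bound I01 g c"
  shows "cut_bound I01 (pullback g f) c"
  unfolding pullback_def
  by (rule cut_bound_rearrange[where h=h, OF prob_space_I01])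
    (use assms rearrangement_measurable[OF assms(1)] in \<open>auto simp: rearrangement_def\<close>)

lemma cut_bound_kernel_triangle:
  assumes "unit_kernel f" "unit_kernel g" "unit_kernel h"
    and "cut_bound I01 (\<lambda>p. f p - g p) a" "cut_bound I01 (\<lambda>p. g p - h p) b"
  shows "cut_bound I01 (\<lambda>p. f p - h p) (a + b)"
proof -
  have "cut_bound I01 (\<lambda>p. (f p - g p) + (g p - h p)) (a + b)"
    using assms by (intro cut_bound_add) (auto intro: unit_kernelD(5))
  then show ?thesis by simp
qed

text \<open>The kernels agree unless one coordinate lies in the mismatch set. These two strips have
  total measure at most \<open>2 * b\<close>, and on them the difference is at most
  \<open>2 * real k * e\<close>.\<close>

lemma cut_bound_step_kernel_diff:
  assumes s: "\<And>i. i < k \<Longrightarrow> s i \<in> {- e, 0, e}" "0 \<le> e"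
    and d: "dyadic L \<tau>" "dyadic L' \<tau>'" and f: "rearrangement f h"
    and X: "{x. \<tau> x \<noteq> \<tau>' (f x)} \<in> sets borel" "measure I01 {x. \<tau> x \<noteq> \<tau>' (f x)} \<le> b"
  shows "cut_bound I01 (\<lambda>(x, y). step_kernel s k (\<tau> x) (\<tau> y) - step_kernel s k (\<tau>' (f x)) (\<tau>' (f y)))
    (4 * real k * e * b)"
proof (rule cut_bound_integral_abs)
  let ?K = "step_kernel s k" and ?X = "{x. \<tau> x \<noteq> \<tau>' (f x)}"
  let ?d = "\<lambda>(x, y). ?K (\<tau> x) (\<tau> y) - ?K (\<tau>' (f x)) (\<tau>' (f y))"
  have "(\<lambda>(x, y). ?K (\<tau> x) (\<tau> y)) \<in> borel_measurable (I01 \<Otimes>\<^sub>M I01)"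
    "pullback (\<lambda>(x, y). ?K (\<tau>' x) (\<tau>' y)) f \<in> borel_measurable (I01 \<Otimes>\<^sub>M I01)"
    using dyadic_pair_measurable[OF d(1,1)] dyadic_pair_measurable[OF d(2,2)]
      pullback_measurable rearrangement_measurable(1)[OF f] by blast+
  then have [measurable]: "?d \<in> borel_measurable (I01 \<Otimes>\<^sub>M I01)"
    by (simp add: pullback_def split_beta')
  have K: "\<bar>?K p q\<bar> \<le> real k * e" for p q by (rule step_kernel_abs_le[OF s])
  show i: "integrable (I01 \<Otimes>\<^sub>M I01) ?d"
  proof (rule I01_pair.integrable_bounded)
    show "\<bar>?d p\<bar> \<le> 2 * real k * e" for p
      using K[of "\<tau> (fst p)" "\<tau> (snd p)"] K[of "\<tau>' (f (fst p))" "\<tau>' (f (snd p))"]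
      by (simp add: split_beta')
  qed simp
  have XU: "?X \<times> UNIV \<in> sets (I01 \<Otimes>\<^sub>M I01)" "UNIV \<times> ?X \<in> sets (I01 \<Otimes>\<^sub>M I01)"
    using X by (auto intro!: pair_measureI simp del: sets_I01_pair)
  have mX: "measure (I01 \<Otimes>\<^sub>M I01) (?X \<times> UNIV) = measure I01 ?X" "measure (I01 \<Otimes>\<^sub>M I01) (UNIV \<times> ?X) = measure I01 ?X"
    using X I01.emeasure_space_1
    by (simp_all add: measure_def I01.emeasure_pair_measure_Times)
  have ind: "integrable (I01 \<Otimes>\<^sub>M I01) (indicator C :: _ \<Rightarrow> real)" if "C \<in> sets (I01 \<Otimes>\<^sub>M I01)" for C
    using that by (intro I01_pair.integrable_bounded[where B=1]) (auto split: split_indicator)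
  have "(\<integral>p. \<bar>?d p\<bar> \<partial>(I01 \<Otimes>\<^sub>M I01))
      \<le> (\<integral>p. 2 * real k * e * (indicator (?X \<times> UNIV) p + indicator (UNIV \<times> ?X) p) \<partial>(I01 \<Otimes>\<^sub>M I01))"
  proof (intro integral_mono integrable_abs i integrable_mult_right Bochner_Integration.integrable_add ind XU)
    fix p
    show "\<bar>?d p\<bar> \<le> 2 * real k * e * (indicator (?X \<times> UNIV) p + indicator (UNIV \<times> ?X) p)"
    proof (cases "fst p \<in> ?X \<or> snd p \<in> ?X")
      case True
      then have "1 \<le> (indicator (?X \<times> UNIV) p + indicator (UNIV \<times> ?X) p :: real)"
        by (auto simp: indicator_def mem_Times_iff)
      then have "2 * real k * e * 1 \<le> 2 * real k * e * (indicator (?X \<times> UNIV) p + indicator (UNIV \<times> ?X) p)"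
        using s(2) by (intro mult_left_mono) auto
      moreover have "\<bar>?d p\<bar> \<le> 2 * real k * e"
        using K[of "\<tau> (fst p)" "\<tau> (snd p)"] K[of "\<tau>' (f (fst p))" "\<tau>' (f (snd p))"]
        by (simp add: split_beta')
      ultimately show ?thesis by simp
    next
      case False
      then have "?d p = 0" by (simp add: split_beta')
      then show ?thesis using s(2) by simp
    qed
  qed
  also have "\<dots> = 2 * real k * e * (measure I01 ?X + measure I01 ?X)"
    using ind XU mX by simp
  also have "\<dots> \<le> 2 * real k * e * (b + b)" using X s(2) by (intro mult_left_mono) auto
  also have "\<dots> = 4 * real k * e * b" by simp
  finally show "(\<integral>p. \<bar>?d p\<bar> \<partial>(I01 \<Otimes>\<^sub>M I01)) \<le> 4 * real k * e * b" .
qed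

text \<open>The signs of the Frieze--Kannan decomposition and the rounded sizes of its type classes take
  finitely many values, and kernels sharing them are close up to a rearrangement.\<close>

lemma eps_close_subsequence:
  assumes g: "\<And>n. unit_kernel (g n)" and "0 < (e::real)"
  obtains r :: "nat \<Rightarrow> nat" where "strict_mono r"
    "\<And>i j. \<exists>f h. rearrangement f h \<and> cut_bound I01 (\<lambda>p. g (r i) p - pullback (g (r j)) f p) e"
proof -
  \<comment> \<open>One third for each of the two step approximations and one third for the mismatch
    between their rearranged steps.\<close>
  define d where "d = e / 3"
  have d: "0 < d" using \<open>0 < e\<close> by (simp add: d_def)
  obtain k :: nat where k0: "1 / d\<^sup>2 < real k" using reals_Archimedean2 by blast
  then have k: "1 < real k * d\<^sup>2" using d by (simp add: pos_divide_less_eq)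
  then have kpos: "0 < k" by (cases k) auto
  let ?Q = "Pow {..<k} \<times> Pow {..<k}"
  have Q: "finite ?Q" "?Q \<noteq> {}" by auto
  then have cQ: "0 < card ?Q" using card_gt_0_iff by blast
  define good where "good n s \<tau> L \<longleftrightarrow> s \<in> {..<k} \<rightarrow>\<^sub>E {- d, 0, d} \<and> dyadic L \<tau> \<and> (\<forall>x. \<tau> x \<in> ?Q) \<and>
     cut_bound I01 (\<lambda>(x, y). g n (x, y) - step_kernel s k (\<tau> x) (\<tau> y)) d" for n s \<tau> L
  have "\<exists>s \<tau> L. good n s \<tau> L" for n
    by (rule weak_regularity_dyadic[OF unit_kernelD(1,4)[OF g[of n]] d k]) (auto simp: good_def)
  then obtain s \<tau> L where good: "\<And>n. good n (s n) (\<tau> n) (L n)" by metis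
  then have s: "\<And>n. s n \<in> {..<k} \<rightarrow>\<^sub>E {- d, 0, d}" and dy: "\<And>n. dyadic (L n) (\<tau> n)"
    and \<tau>: "\<And>n x. \<tau> n x \<in> ?Q"
    and cb: "\<And>n. cut_bound I01 (\<lambda>(x, y). g n (x, y) - step_kernel (s n) k (\<tau> n x) (\<tau> n y)) d"
    unfolding good_def by blast+
  \<comment> \<open>Class sizes agreeing up to \<open>1 / real N\<close> leave a mismatch set of
    measure at most \<open>card ?Q / N\<close>, which costs \<open>4 * k * d\<close> times as much
    in cut norm; this \<open>N\<close> makes the cost exactly \<open>d\<close>.\<close>
  define N where "N = 4 * k * card ?Q"
  have N: "0 < N" using kpos cQ by (simp add: N_def)
  define z where "z n = restrict (\<lambda>q. \<lfloor>real N * measure I01 {x. \<tau> n x = q}\<rfloor>) ?Q" for n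
  have z: "z n \<in> ?Q \<rightarrow>\<^sub>E {0..int N}" for n
  proof -
    have "\<lfloor>real N * measure I01 X\<rfloor> \<le> int N" for X
    proof -
      have "real N * measure I01 X \<le> real N * 1" by (intro mult_left_mono) auto
      then show ?thesis by linarith
    qed
    then show ?thesis by (auto simp: z_def)
  qed
  have "range (\<lambda>n. (s n, z n)) \<subseteq> ({..<k} \<rightarrow>\<^sub>E {- d, 0, d}) \<times> (?Q \<rightarrow>\<^sub>E {0..int N})"
    by (rule image_subsetI) (rule SigmaI[OF s z])
  moreover have "finite \<dots>" using Q by (intro finite_cartesian_product finite_PiE) auto
  ultimately have "finite (range (\<lambda>n. (s n, z n)))" by (rule finite_subset)
  then obtain n0 where "infinite {n \<in> UNIV. (s n, z n) = (s n0, z n0)}"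
    using pigeonhole_infinite[OF infinite_UNIV_nat] by blast
  then obtain r :: "nat \<Rightarrow> nat" where r: "strict_mono r" "\<And>i. (s (r i), z (r i)) = (s n0, z n0)"
    using infinite_enumerate[of "{n \<in> UNIV. (s n, z n) = (s n0, z n0)}"] by auto
  have "\<exists>f h. rearrangement f h \<and> cut_bound I01 (\<lambda>p. g m p - pullback (g n) f p) e"
    if same: "s m = s n" "z m = z n" for m n
  proof -
    have sizes: "measure I01 {x. \<tau> m x = q} \<le> measure I01 {x. \<tau> n x = q} + 1 / real N" if "q \<in> ?Q" for q
    proof -
      have "\<lfloor>real N * measure I01 {x. \<tau> m x = q}\<rfloor> = \<lfloor>real N * measure I01 {x. \<tau> n x = q}\<rfloor>"
        using fun_cong[OF same(2), of q] that by (simp add: z_def)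
      then have "real N * measure I01 {x. \<tau> m x = q} \<le> real N * measure I01 {x. \<tau> n x = q} + 1"
        by linarith
      then show ?thesis using N by (simp add: field_simps)
    qed
    have rng: "range (\<tau> m) \<subseteq> ?Q" "range (\<tau> n) \<subseteq> ?Q" using \<tau> by blast+
    have "0 \<le> 1 / real N" by simp
    then obtain f h where f: "rearrangement f h" "{x. \<tau> m x \<noteq> \<tau> n (f x)} \<in> sets borel"
      "measure I01 {x. \<tau> m x \<noteq> \<tau> n (f x)} \<le> real (card ?Q) * (1 / real N)"
      using dyadic_rearrangement[OF dy[of m] dy[of n] Q(1) rng sizes] by blast
    let ?K = "step_kernel (s m) k"
    have sm: "s m i \<in> {- d, 0, d}" if "i < k" for i using s[of m] that by auto
    have "4 * real k * d * (real (card ?Q) * (1 / real N)) = d"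
    proof -
      have "real N = 4 * real k * real (card ?Q)" unfolding N_def by (simp only: of_nat_mult of_nat_numeral)
      moreover have "4 * a * d * (b * (1 / (4 * a * b))) = d" if "0 < a" "0 < b" for a b :: real
        using that by simp
      ultimately show ?thesis using kpos cQ by (simp only: of_nat_0_less_iff)
    qed
    then have 1: "cut_bound I01 (\<lambda>(x, y). ?K (\<tau> m x) (\<tau> m y) - ?K (\<tau> n (f x)) (\<tau> n (f y))) d"
      using cut_bound_step_kernel_diff[of k "s m" d, OF sm _ dy dy f] d by simp
    have Km: "(\<lambda>(x, y). ?K (\<tau> n x) (\<tau> n y)) \<in> borel_measurable (I01 \<Otimes>\<^sub>M I01)" for n
      by (rule dyadic_pair_measurable[OF dy dy])
    have Kb: "\<bar>?K p q\<bar> \<le> real k * d" for p q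
      by (rule step_kernel_abs_le[OF sm]) (use d in auto)
    have Ki: "integrable (I01 \<Otimes>\<^sub>M I01) (\<lambda>(x, y). ?K (\<tau> n x) (\<tau> n y))" for n
      by (rule I01_pair.integrable_bounded[OF Km, where B="real k * d"]) (simp add: split_beta' Kb)
    have gn: "(\<lambda>(x, y). g n (x, y) - ?K (\<tau> n x) (\<tau> n y)) \<in> borel_measurable (I01 \<Otimes>\<^sub>M I01)"
      using borel_measurable_diff[OF unit_kernelD(1)[OF g[of n]] Km[of n]] by (simp add: split_beta')
    have "cut_bound I01 (\<lambda>(x, y). g n (x, y) - ?K (\<tau> n x) (\<tau> n y)) d" using cb[of n] same by simp
    from cut_bound_pullback[OF f(1) gn this]
    have "cut_bound I01 (pullback (\<lambda>(x, y). g n (x, y) - ?K (\<tau> n x) (\<tau> n y)) f) d" .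
    then have 2: "cut_bound I01 (\<lambda>p. - pullback (\<lambda>(x, y). g n (x, y) - ?K (\<tau> n x) (\<tau> n y)) f p) d"
      by (simp only: cut_bound_uminus)
    have pK: "pullback (\<lambda>(x, y). ?K (\<tau> n x) (\<tau> n y)) f \<in> borel_measurable (I01 \<Otimes>\<^sub>M I01)"
      by (rule pullback_measurable[OF Km rearrangement_measurable(1)[OF f(1)]])
    have pKi: "integrable (I01 \<Otimes>\<^sub>M I01) (pullback (\<lambda>(x, y). ?K (\<tau> n x) (\<tau> n y)) f)"
      by (rule I01_pair.integrable_bounded[OF pK, of "real k * d"]) (simp add: split_beta' pullback_def Kb)
    have gi: "integrable (I01 \<Otimes>\<^sub>M I01) (g m)" "integrable (I01 \<Otimes>\<^sub>M I01) (pullback (g n) f)"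
      using unit_kernelD(5) g kernel_pullback[OF g f(1)] by auto
    have "cut_bound I01 (\<lambda>p. ((case p of (x, y) \<Rightarrow> g m (x, y) - ?K (\<tau> m x) (\<tau> m y)) +
        (case p of (x, y) \<Rightarrow> ?K (\<tau> m x) (\<tau> m y) - ?K (\<tau> n (f x)) (\<tau> n (f y)))) +
        (- pullback (\<lambda>(x, y). g n (x, y) - ?K (\<tau> n x) (\<tau> n y)) f p)) ((d + d) + d)"
      using Ki[of m] pKi gi
      by (intro cut_bound_add cb 1 2 Bochner_Integration.integrable_add) (simp_all add: split_beta' pullback_def)
    also have "(\<lambda>p. ((case p of (x, y) \<Rightarrow> g m (x, y) - ?K (\<tau> m x) (\<tau> m y)) +
        (case p of (x, y) \<Rightarrow> ?K (\<tau> m x) (\<tau> m y) - ?K (\<tau> n (f x)) (\<tau> n (f y)))) +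
        (- pullback (\<lambda>(x, y). g n (x, y) - ?K (\<tau> n x) (\<tau> n y)) f p)) = (\<lambda>p. g m p - pullback (g n) f p)"
      by (auto simp: pullback_def)
    also have "(d + d) + d = e" by (simp add: d_def)
    finally show ?thesis using f(1) by blast
  qed
  then have "\<exists>f h. rearrangement f h \<and> cut_bound I01 (\<lambda>p. g (r i) p - pullback (g (r j)) f p) e" for i j
    using r(2)[of i] r(2)[of j] by simp
  then show ?thesis using that r(1) by blast
qed

text \<open>Closeness is demanded for all pairs of indices, a property inherited by subsequences, so
  the refinements for the tolerances \<open>(1 / 2) ^ n\<close> can be diagonalized.\<close>

lemma cauchy_subsequence:
  assumes g: "\<And>n. unit_kernel (g n)"
  obtains r :: "nat \<Rightarrow> nat" where "strict_mono r"
    "\<And>i. \<exists>f h. rearrangement f h \<and> cut_bound I01 (\<lambda>p. g (r i) p - pullback (g (r (Suc i))) f p) ((1 / 2) ^ i)"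
proof -
  define P where "P n s \<longleftrightarrow> (\<forall>i j. \<exists>f h. rearrangement f h \<and>
      cut_bound I01 (\<lambda>p. g (s i) p - pullback (g (s j)) f p) ((1 / 2) ^ n))" for n :: nat and s :: "nat \<Rightarrow> nat"
  interpret subseqs P
  proof
    fix n and s :: "nat \<Rightarrow> nat" assume "strict_mono s"
    show "\<exists>r'. strict_mono r' \<and> P n (s \<circ> r')"
      using eps_close_subsequence[of "\<lambda>n. g (s n)" "(1 / 2) ^ n"] g unfolding P_def o_def
      by (metis half_gt_zero_iff zero_less_one zero_less_power)
  qed
  \<comment> \<open>The tolerance of index \<open>k\<close> is guaranteed only from position
    \<open>Suc k\<close> of the diagonal sequence on. The subsequence chosen below is shifted by one
    for this reason, and the terms 0 and 1 of this tail are compared.\<close>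
  have P: "P k (diagseq \<circ> ((+) (Suc k)))" for k
    by (rule diagseq_holds) (auto simp: P_def)
  have "\<exists>f h. rearrangement f h \<and>
      cut_bound I01 (\<lambda>p. g (diagseq (Suc i)) p - pullback (g (diagseq (Suc (Suc i)))) f p) ((1 / 2) ^ i)" for i
  proof -
    have "\<exists>f h. rearrangement f h \<and> cut_bound I01 (\<lambda>p. g (s a) p - pullback (g (s b)) f p) ((1 / 2) ^ n)"
      if "P n s" for n s a b
      using that by (simp add: P_def)
    from this[OF P[of i], of 0 1] show ?thesis by simp
  qed
  moreover have "strict_mono (\<lambda>i. diagseq (Suc i))"
    using subseq_diagseq by (simp add: strict_mono_def)
  ultimately show ?thesis using that by blast
qed

text \<open>Rectangle integrals are Cauchy, and rectangles are a generator stable under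
  intersection, so all set integrals converge and have a weak limit. The cut bound then passes to
  the limit for each rectangle separately.\<close>

lemma cut_norm_complete:
  assumes V: "\<And>n. unit_kernel (V n)"
    and c: "\<And>n. cut_bound I01 (\<lambda>p. V n p - V (Suc n) p) ((1 / 2) ^ n)"
  obtains v where "unit_kernel v" "\<And>n. cut_bound I01 (\<lambda>p. V n p - v p) (2 * (1 / 2) ^ n)"
proof -
  \<comment> \<open>The bound is the exact geometric sum of the steps from \<open>i\<close> to
    \<open>i + m\<close>; keeping the subtracted tail lets the induction close.\<close>
  have ij: "cut_bound I01 (\<lambda>p. V i p - V (i + m) p) (2 * (1 / 2) ^ i - 2 * (1 / 2) ^ (i + m))" for i m
  proof (induction m)
    case 0
    then show ?case by (simp add: cut_bound_def set_lebesgue_integral_def)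
  next
    case (Suc m)
    have "cut_bound I01 (\<lambda>p. V i p - V (Suc (i + m)) p)
      ((2 * (1 / 2) ^ i - 2 * (1 / 2) ^ (i + m)) + (1 / 2) ^ (i + m))"
      by (rule cut_bound_kernel_triangle[OF V V V Suc.IH c])
    then show ?case by simp
  qed
  have le: "cut_bound I01 (\<lambda>p. V i p - V j p) (2 * (1 / 2) ^ i)" if "i \<le> j" for i j
  proof -
    from that obtain m where "j = i + m" by (auto simp: le_iff_add)
    have "cut_bound I01 (\<lambda>p. V i p - V (i + m) p) (2 * (1 / 2) ^ i)"
      by (rule cut_bound_mono[OF ij]) simp
    then show ?thesis by (simp only: \<open>j = i + m\<close>)
  qed
  have m: "V n \<in> borel_measurable (I01 \<Otimes>\<^sub>M I01)" "\<And>p. 0 \<le> V n p \<and> V n p \<le> 1" for n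
    using unit_kernelD[OF V[of n]] by auto
  have si: "set_integrable (I01 \<Otimes>\<^sub>M I01) A (V n)" if "A \<in> sets (I01 \<Otimes>\<^sub>M I01)" for A n
    by (rule I01_pair.set_integrable_unit[OF m that])
  have diff: "\<bar>(LINT p:S \<times> T|I01 \<Otimes>\<^sub>M I01. V i p) - (LINT p:S \<times> T|I01 \<Otimes>\<^sub>M I01. V j p)\<bar> \<le> 2 * (1 / 2) ^ i"
    if "i \<le> j" "S \<in> sets I01" "T \<in> sets I01" for i j S T
  proof -
    have "S \<times> T \<in> sets (I01 \<Otimes>\<^sub>M I01)" using that by (intro pair_measureI)
    then show ?thesis using cut_boundD[OF le[OF that(1)] that(2,3)] si by simp
  qed
  have rect: "convergent (\<lambda>n. LINT p:S \<times> T|I01 \<Otimes>\<^sub>M I01. V n p)" if ST: "S \<in> sets I01" "T \<in> sets I01" for S T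
  proof -
    have "Cauchy (\<lambda>n. LINT p:S \<times> T|I01 \<Otimes>\<^sub>M I01. V n p)"
    proof (rule metric_CauchyI)
      fix e :: real assume "0 < e"
      then obtain n where n: "(1 / 2) ^ n < e / 4" using real_arch_pow_inv[of "e / 4" "1/2"] by auto
      have "dist (LINT p:S \<times> T|I01 \<Otimes>\<^sub>M I01. V i p) (LINT p:S \<times> T|I01 \<Otimes>\<^sub>M I01. V j p) < e"
        if "n \<le> i" "n \<le> j" for i j
        using diff[OF that(1) ST] diff[OF that(2) ST] n unfolding dist_real_def by linarith
      then show "\<exists>M. \<forall>i\<ge>M. \<forall>j\<ge>M. dist (LINT p:S \<times> T|I01 \<Otimes>\<^sub>M I01. V i p) (LINT p:S \<times> T|I01 \<Otimes>\<^sub>M I01. V j p) < e"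
        by blast
    qed
    then show ?thesis by (rule Cauchy_convergent)
  qed
  have conv: "convergent (\<lambda>n. LINT p:A|I01 \<Otimes>\<^sub>M I01. V n p)" if "A \<in> sets (I01 \<Otimes>\<^sub>M I01)" for A
  proof (rule I01_pair.convergent_set_integral_generator[OF m _ _ _ _ _ that])
    let ?G = "{a \<times> b | a b. a \<in> sets I01 \<and> b \<in> sets I01}"
    show "Int_stable ?G" by (rule Int_stable_pair_measure_generator)
    show "?G \<subseteq> Pow (space (I01 \<Otimes>\<^sub>M I01))" by simp
    show "space (I01 \<Otimes>\<^sub>M I01) \<in> ?G" by (force simp: space_pair_measure simp del: space_I01_pair)
    show "sets (I01 \<Otimes>\<^sub>M I01) = sigma_sets (space (I01 \<Otimes>\<^sub>M I01)) ?G"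
      by (simp add: sets_pair_measure space_pair_measure del: sets_I01_pair space_I01_pair)
  qed (use rect in auto)
  obtain v where v: "v \<in> borel_measurable (I01 \<Otimes>\<^sub>M I01)" "\<And>x. 0 \<le> v x \<and> v x \<le> 1"
    and lim: "\<And>A. A \<in> sets (I01 \<Otimes>\<^sub>M I01) \<Longrightarrow>
      (\<lambda>n. LINT p:A|I01 \<Otimes>\<^sub>M I01. V n p) \<longlonglongrightarrow> (LINT p:A|I01 \<Otimes>\<^sub>M I01. v p)"
    by (rule I01_pair.weak_limit_exists[OF m], erule conv, rule that)
  have "cut_bound I01 (\<lambda>p. V n p - v p) (2 * (1 / 2) ^ n)" for n
  proof (rule cut_boundI)
    fix S T assume ST: "S \<in> sets I01" "T \<in> sets I01"
    then have A: "S \<times> T \<in> sets (I01 \<Otimes>\<^sub>M I01)" by (intro pair_measureI)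
    have "(\<lambda>j. \<bar>(LINT p:S \<times> T|I01 \<Otimes>\<^sub>M I01. V n p) - (LINT p:S \<times> T|I01 \<Otimes>\<^sub>M I01. V j p)\<bar>)
      \<longlonglongrightarrow> \<bar>(LINT p:S \<times> T|I01 \<Otimes>\<^sub>M I01. V n p) - (LINT p:S \<times> T|I01 \<Otimes>\<^sub>M I01. v p)\<bar>"
      by (intro tendsto_intros lim A)
    then have "\<bar>(LINT p:S \<times> T|I01 \<Otimes>\<^sub>M I01. V n p) - (LINT p:S \<times> T|I01 \<Otimes>\<^sub>M I01. v p)\<bar> \<le> 2 * (1 / 2) ^ n"
      by (rule LIMSEQ_le_const2) (use diff ST in blast)
    then show "\<bar>LINT p:S \<times> T|I01 \<Otimes>\<^sub>M I01. V n p - v p\<bar> \<le> 2 * (1 / 2) ^ n"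
      using si[OF A] I01_pair.set_integrable_unit[OF v A] by simp
  qed
  moreover have "unit_kernel v" using v by (simp add: unit_kernel_def)
  ultimately show ?thesis using that by blast
qed

text \<open>Each term is close to the next only after a further rearrangement. Composing these maps
  from the start aligns all terms in one Cauchy sequence, because a common rearrangement preserves
  cut bounds.\<close>

theorem kernel_sequential_compactness:
  assumes g: "\<And>n. unit_kernel (g n)"
  obtains r :: "nat \<Rightarrow> nat" and f h v where "strict_mono r" "unit_kernel v" "\<And>i. rearrangement (f i) (h i)"
    "\<And>i. cut_bound I01 (\<lambda>p. pullback (g (r i)) (f i) p - v p) (2 * (1 / 2) ^ i)"
proof -
  obtain r :: "nat \<Rightarrow> nat" where r: "strict_mono r"
    and "\<And>i. \<exists>f h. rearrangement f h \<and> cut_bound I01 (\<lambda>p. g (r i) p - pullback (g (r (Suc i))) f p) ((1 / 2) ^ i)"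
    by (rule cauchy_subsequence[of g, OF g]) blast
  then obtain f h where f: "\<And>i. rearrangement (f i) (h i)"
    and c: "\<And>i. cut_bound I01 (\<lambda>p. g (r i) p - pullback (g (r (Suc i))) (f i) p) ((1 / 2) ^ i)" by metis
  \<comment> \<open>\<open>F\<close> applies the newest map last, while the inverses in
    \<open>H\<close> compose in the opposite order.\<close>
  define F where "F = rec_nat (\<lambda>x. x) (\<lambda>i F x. f i (F x))"
  define H where "H = rec_nat (\<lambda>x. x) (\<lambda>i H x. H (h i x))"
  have F: "F 0 = (\<lambda>x. x)" "F (Suc i) = (\<lambda>x. f i (F i x))" for i by (simp_all add: F_def)
  have H: "H 0 = (\<lambda>x. x)" "H (Suc i) = (\<lambda>x. H i (h i x))" for i by (simp_all add: H_def)
  have FH: "rearrangement (F i) (H i)" for i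
  proof (induction i)
    case (Suc i)
    then show ?case unfolding F H by (rule rearrangement_comp[OF f])
  qed (simp add: F H rearrangement_id)
  define V where "V i = pullback (g (r i)) (F i)" for i
  have V: "unit_kernel (V i)" for i unfolding V_def by (rule kernel_pullback[OF g FH])
  have "cut_bound I01 (\<lambda>p. V i p - V (Suc i) p) ((1 / 2) ^ i)" for i
  proof -
    have "cut_bound I01 (pullback (\<lambda>p. g (r i) p - pullback (g (r (Suc i))) (f i) p) (F i)) ((1 / 2) ^ i)"
      using unit_kernelD(1)[OF g] unit_kernelD(1)[OF kernel_pullback[OF g f]] by (intro cut_bound_pullback[OF FH] c) auto
    also have "pullback (\<lambda>p. g (r i) p - pullback (g (r (Suc i))) (f i) p) (F i) = (\<lambda>p. V i p - V (Suc i) p)"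
      by (auto simp: pullback_def V_def F)
    finally show ?thesis .
  qed
  from cut_norm_complete[OF V this] obtain v where "unit_kernel v"
        "\<And>n. cut_bound I01 (\<lambda>p. V n p - v p) (2 * (1 / 2) ^ n)" by blast
  from that[OF r this(1) FH this(2)[unfolded V_def]] show ?thesis .
qed

section \<open>Counting lemma\<close>

abbreviation cube :: "'a set \<Rightarrow> ('a \<Rightarrow> real) measure" where
  "cube V \<equiv> PiM V (\<lambda>_. I01)"

lemma prob_space_cube: "prob_space (cube V)"
  by (rule prob_space_PiM) (rule prob_space_I01)

lemma cut_bound_vertex_weights:
  fixes a b :: "('a \<Rightarrow> real) \<Rightarrow> real"
  assumes V: "finite V" "i \<in> V" "j \<in> V" "i \<noteq> j"
    and g: "g \<in> borel_measurable (I01 \<Otimes>\<^sub>M I01)" "\<And>p. \<bar>g p\<bar> \<le> B" and c: "cut_bound I01 g c"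
    and a: "a \<in> borel_measurable (cube V)" "\<And>x. 0 \<le> a x \<and> a x \<le> 1" "\<And>x y. a (x(j := y)) = a x"
    and b: "b \<in> borel_measurable (cube V)" "\<And>x. 0 \<le> b x \<and> b x \<le> 1" "\<And>x y. b (x(i := y)) = b x"
  shows "\<bar>\<integral>x. a x * b x * g (x i, x j) \<partial>cube V\<bar> \<le> c"
proof -
  interpret I01_family: product_sigma_finite "\<lambda>_ :: 'a. I01" by unfold_locales
  let ?f = "\<lambda>x. a x * b x * g (x i, x j)"
  define I where "I = V - {i, j}"
  have VI: "V = insert j (insert i I)" and I: "finite I" "i \<notin> I" "j \<notin> insert i I" "finite (insert i I)"
    using V by (auto simp: I_def)
  have B: "0 \<le> B" using order_trans[OF abs_ge_zero g(2)] .
  have [measurable]: "(\<lambda>x. x i) \<in> cube V \<rightarrow>\<^sub>M I01" "(\<lambda>x. x j) \<in> cube V \<rightarrow>\<^sub>M I01"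
    using V by (auto intro: measurable_component_singleton)
  note [measurable] = a(1) b(1) g(1)
  have fm: "?f \<in> borel_measurable (cube V)" by measurable
  have fB: "\<bar>?f x\<bar> \<le> B" for x
  proof -
    have "0 \<le> a x * b x" "a x * b x \<le> 1" using a(2)[of x] b(2)[of x] by (auto intro: mult_le_one)
    then have "\<bar>?f x\<bar> \<le> 1 * B"
      unfolding abs_mult[of "a x * b x"] using g(2) by (intro mult_mono) auto
    then show ?thesis by simp
  qed
  have fi: "integrable (cube V) ?f"
    by (rule prob_space.integrable_bounded[OF prob_space_cube fm fB])
  define H where "H x = (\<integral>y. ?f (x(j := y)) \<partial>I01)" for x
  have "(\<lambda>(x, y). x(j := y)) \<in> cube (insert i I) \<Otimes>\<^sub>M I01 \<rightarrow>\<^sub>M cube V"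
    unfolding VI by (rule measurable_add_dim)
  from measurable_compose[OF this fm]
  have "(\<lambda>(x, y). ?f (x(j := y))) \<in> borel_measurable (cube (insert i I) \<Otimes>\<^sub>M I01)"
    by (simp add: split_beta')
  then have Hm: "H \<in> borel_measurable (cube (insert i I))"
    unfolding H_def[abs_def] by (rule I01.borel_measurable_lebesgue_integral)
  have Hi: "integrable (cube (insert i I)) H"
    by (rule prob_space.integrable_bounded[OF prob_space_cube Hm, of B])
      (unfold H_def, intro I01.abs_integral_le fB B)
  have "(\<integral>x. ?f x \<partial>cube V) = (\<integral>x. H x \<partial>cube (insert i I))"
    unfolding VI H_def by (rule I01_family.product_integral_insert) (use I fi VI in auto)
  also have "\<dots> = (\<integral>z. \<integral>x. H (z(i := x)) \<partial>I01 \<partial>cube I)"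
    by (rule I01_family.product_integral_insert) (use I Hi in auto)
  also have "\<bar>\<dots>\<bar> \<le> c"
  proof (rule prob_space.abs_integral_le[OF prob_space_cube])
    fix z assume z: "z \<in> space (cube I)"
    \<comment> \<open>The 0 is a placeholder for the coordinate that the weight ignores.\<close>
    define u where "u x = a (z(i := x, j := 0))" for x
    define v where "v y = b (z(i := 0, j := y))" for y
    have zm: "(\<lambda>x. z) \<in> I01 \<rightarrow>\<^sub>M cube I" using z by (rule measurable_const)
    have um: "(\<lambda>x. (z(i := x))(j := 0)) \<in> I01 \<rightarrow>\<^sub>M cube V" and vm: "(\<lambda>y. (z(i := 0))(j := y)) \<in> I01 \<rightarrow>\<^sub>M cube V"
      by (rule measurable_fun_upd[of _ "insert i I"], use VI in simp,
          rule measurable_fun_upd[of _ I], simp, rule zm, simp, simp)+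
    have uv: "u \<in> borel_measurable I01" "v \<in> borel_measurable I01"
      using measurable_compose[OF um a(1)] measurable_compose[OF vm b(1)]
      unfolding u_def[abs_def] v_def[abs_def] .
    have "?f (z(i := x, j := y)) = u x * v y * g (x, y)" for x y
    proof -
      have "a (z(i := x, j := y)) = u x" unfolding u_def by (metis a(3))
      moreover have "b (z(i := x, j := y)) = v y"
        unfolding v_def using b(3)[of "z(j := y)"] V(4) by (metis fun_upd_twist)
      ultimately show ?thesis using V(4) by simp
    qed
    then have "(\<integral>x. H (z(i := x)) \<partial>I01) = (\<integral>x. \<integral>y. u x * v y * g (x, y) \<partial>I01 \<partial>I01)"
      by (simp add: H_def)
    also have "\<bar>\<dots>\<bar> \<le> c"
      by (rule cut_bound_functions[OF prob_space_I01 I01_pair.integrable_bounded[OF g] c uv(1) _ uv(2)])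
        (use a(2) b(2) in \<open>auto simp: u_def v_def\<close>)
    finally show "\<bar>\<integral>x. H (z(i := x)) \<partial>I01\<bar> \<le> c" .
  next
    show "0 \<le> c" using cut_boundD[OF c, of "{}" "{}"] by simp
  qed
  finally show ?thesis .
qed

text \<open>An arbitrary ordering of the ends of each edge. The last clause, about unordered pairs,
  excludes parallel and opposite edges alike.\<close>

definition edge_orientation :: "'a set \<Rightarrow> 'e set \<Rightarrow> ('e \<Rightarrow> 'a) \<Rightarrow> ('e \<Rightarrow> 'a) \<Rightarrow> bool" where
  "edge_orientation V E s t \<longleftrightarrow> finite V \<and> finite E \<and> s ` E \<subseteq> V \<and> t ` E \<subseteq> V \<and> (\<forall>e\<in>E. s e \<noteq> t e) \<and>
     (\<forall>e\<in>E. \<forall>e'\<in>E. e \<noteq> e' \<longrightarrow> {s e, t e} \<noteq> {s e', t e'})"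

text \<open>The kernel may vary with the edge so that kernels can be exchanged one edge at a
  time.\<close>

definition edge_integral ::
    "'a set \<Rightarrow> 'e set \<Rightarrow> ('e \<Rightarrow> 'a) \<Rightarrow> ('e \<Rightarrow> 'a) \<Rightarrow> ('e \<Rightarrow> real \<times> real \<Rightarrow> real) \<Rightarrow> real" where
  "edge_integral V E s t K = (\<integral>x. (\<Prod>e\<in>E. K e (x (s e), x (t e))) \<partial>cube V)"

lemma edge_product_measurable:
  assumes "s ` E \<subseteq> V" "t ` E \<subseteq> V" "\<And>e. e \<in> E \<Longrightarrow> unit_kernel (K e)"
  shows "(\<lambda>x. \<Prod>e\<in>E. K e (x (s e), x (t e))) \<in> borel_measurable (cube V)"
proof (rule borel_measurable_prod)
  fix e assume e: "e \<in> E"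
  then have "(\<lambda>x. (x (s e), x (t e))) \<in> cube V \<rightarrow>\<^sub>M I01 \<Otimes>\<^sub>M I01"
    using assms by (intro measurable_Pair measurable_component_singleton) auto
  then show "(\<lambda>x. K e (x (s e), x (t e))) \<in> borel_measurable (cube V)"
    using unit_kernelD(1)[OF assms(3)[OF e]] by (rule measurable_compose)
qed

lemma edge_product_unit:
  assumes "\<And>e. e \<in> E \<Longrightarrow> unit_kernel (K e)"
  shows "0 \<le> (\<Prod>e\<in>E. K e (x (s e), x (t e))) \<and> (\<Prod>e\<in>E. K e (x (s e), x (t e))) \<le> 1"
  using unit_kernelD(2,3)[OF assms] by (auto intro!: prod_nonneg prod_le_1)

text \<open>The remaining edges split into those avoiding the target and those avoiding the source of
  the distinguished edge, because no other edge joins the same two vertices.\<close>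

lemma edge_integral_single_edge:
  assumes o: "edge_orientation V E s t" and e0: "e0 \<in> E" and K: "\<And>e. unit_kernel (K e)"
    and g: "g \<in> borel_measurable (I01 \<Otimes>\<^sub>M I01)" "\<And>p. \<bar>g p\<bar> \<le> B" and c: "cut_bound I01 g c"
  shows "\<bar>\<integral>x. (\<Prod>e\<in>E - {e0}. K e (x (s e), x (t e))) * g (x (s e0), x (t e0)) \<partial>cube V\<bar> \<le> c"
proof -
  define A where "A = {e \<in> E - {e0}. t e0 \<notin> {s e, t e}}"
  define C where "C = {e \<in> E - {e0}. t e0 \<in> {s e, t e}}"
  have E: "E - {e0} = A \<union> C" "A \<inter> C = {}" "finite A" "finite C" "A \<subseteq> E" "C \<subseteq> E"
    using o by (auto simp: A_def C_def edge_orientation_def)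
  have tA: "s e \<noteq> t e0" "t e \<noteq> t e0" if "e \<in> A" for e using that by (auto simp: A_def)
  have sC: "s e \<noteq> s e0" "t e \<noteq> s e0" if "e \<in> C" for e
  proof -
    have "e \<in> E" "e \<noteq> e0" "t e0 \<in> {s e, t e}" using that by (auto simp: C_def)
    moreover from this have "{s e, t e} \<noteq> {s e0, t e0}" "s e0 \<noteq> t e0"
      using o e0 unfolding edge_orientation_def by blast+
    ultimately show "s e \<noteq> s e0" "t e \<noteq> s e0" by auto
  qed
  let ?P = "\<lambda>D x. \<Prod>e\<in>D. K e (x (s e), x (t e))"
  have "?P (E - {e0}) x = ?P A x * ?P C x" for x :: "'a \<Rightarrow> real"
    unfolding E(1) using E by (intro prod.union_disjoint) auto
  moreover have "\<bar>\<integral>x. ?P A x * ?P C x * g (x (s e0), x (t e0)) \<partial>cube V\<bar> \<le> c"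
  proof (rule cut_bound_vertex_weights[OF _ _ _ _ g c])
    show "finite V" "s e0 \<in> V" "t e0 \<in> V" "s e0 \<noteq> t e0"
      using o e0 by (auto simp: edge_orientation_def)
    have st: "s ` E \<subseteq> V" "t ` E \<subseteq> V" using o by (simp_all add: edge_orientation_def)
    have "s ` A \<subseteq> V" "t ` A \<subseteq> V" "s ` C \<subseteq> V" "t ` C \<subseteq> V"
      by (rule order_trans[OF image_mono st(1)] order_trans[OF image_mono st(2)], rule E)+
    then show "?P A \<in> borel_measurable (cube V)" "?P C \<in> borel_measurable (cube V)"
      using K by (auto intro: edge_product_measurable)
    show "0 \<le> ?P A x \<and> ?P A x \<le> 1" "0 \<le> ?P C x \<and> ?P C x \<le> 1" for x
      by (rule edge_product_unit[OF K])+
    show "?P A (x(t e0 := y)) = ?P A x" "?P C (x(s e0 := y)) = ?P C x" for x y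
      using tA sC by (auto intro!: prod.cong)
  qed
  ultimately show ?thesis by simp
qed

text \<open>Replacing \<open>u\<close> by \<open>w\<close> on one edge changes the integral by at
  most \<open>c\<close>: the other factors are weights attached to the two ends. Summing over the
  edges gives the factor \<open>card E\<close>.\<close>

theorem counting_lemma:
  assumes o: "edge_orientation V E s t" and U: "unit_kernel u" and W: "unit_kernel w"
    and c: "cut_bound I01 (\<lambda>p. u p - w p) c"
  shows "\<bar>edge_integral V E s t (\<lambda>_. u) - edge_integral V E s t (\<lambda>_. w)\<bar> \<le> real (card E) * c"
proof -
  interpret C: prob_space "cube V" by (rule prob_space_cube)
  have sub: "s ` E \<subseteq> V" "t ` E \<subseteq> V" "finite E" using o by (auto simp: edge_orientation_def)
  \<comment> \<open>The hybrid kernel: edges in \<open>D\<close> have already been switched to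
    \<open>w\<close>.\<close>
  define K where "K D e = (if e \<in> D then w else u)" for D :: "'b set" and e
  have K: "unit_kernel (K D e)" for D e using U W by (simp add: K_def)
  have gm: "(\<lambda>p. u p - w p) \<in> borel_measurable (I01 \<Otimes>\<^sub>M I01)"
    using unit_kernelD(1)[OF U] unit_kernelD(1)[OF W] by (rule borel_measurable_diff)
  have gB: "\<bar>u p - w p\<bar> \<le> 1" for p
    using unit_kernelD(2,3)[OF U, of p] unit_kernelD(2,3)[OF W, of p] by linarith
  have "\<bar>edge_integral V E s t (K {}) - edge_integral V E s t (K D)\<bar> \<le> real (card D) * c" if "D \<subseteq> E" for D
    using finite_subset[OF that sub(3)] that
  proof (induction D)
    case empty
    then show ?case by simp
  next
    case (insert e0 D)
    let ?R = "\<lambda>x. \<Prod>e\<in>E - {e0}. K D e (x (s e), x (t e))"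
    have e0: "e0 \<in> E" "e0 \<notin> D" using insert by auto
    have 1: "(\<Prod>e\<in>E. K D e (x (s e), x (t e))) = u (x (s e0), x (t e0)) * ?R x" for x :: "'a \<Rightarrow> real"
      by (subst prod.remove[OF sub(3) e0(1)]) (use e0 in \<open>simp add: K_def\<close>)
    have 2: "(\<Prod>e\<in>E. K (insert e0 D) e (x (s e), x (t e))) = w (x (s e0), x (t e0)) * ?R x" for x :: "'a \<Rightarrow> real"
      by (subst prod.remove[OF sub(3) e0(1)]) (auto simp: K_def intro!: prod.cong)
    have i: "integrable (cube V) (\<lambda>x. \<Prod>e\<in>E. K D' e (x (s e), x (t e)))" for D'
    proof (rule C.integrable_bounded)
      show "\<bar>\<Prod>e\<in>E. K D' e (x (s e), x (t e))\<bar> \<le> 1" for x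
        using edge_product_unit[of E "K D'" x s t, OF K] by auto
    qed (rule edge_product_measurable[OF sub(1,2) K])
    have "edge_integral V E s t (K D) - edge_integral V E s t (K (insert e0 D))
       = (\<integral>x. (\<Prod>e\<in>E. K D e (x (s e), x (t e))) - (\<Prod>e\<in>E. K (insert e0 D) e (x (s e), x (t e))) \<partial>cube V)"
      unfolding edge_integral_def by (rule Bochner_Integration.integral_diff[symmetric, OF i i])
    also have "\<dots> = (\<integral>x. ?R x * (u (x (s e0), x (t e0)) - w (x (s e0), x (t e0))) \<partial>cube V)"
      unfolding 1 2 by (simp add: algebra_simps)
    also have "\<bar>\<dots>\<bar> \<le> c"
      by (rule edge_integral_single_edge[OF o e0(1) K gm gB c])
    finally have "\<bar>edge_integral V E s t (K D) - edge_integral V E s t (K (insert e0 D))\<bar> \<le> c" .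
    moreover have "\<bar>edge_integral V E s t (K {}) - edge_integral V E s t (K D)\<bar> \<le> real (card D) * c"
      using insert by auto
    moreover have "real (card (insert e0 D)) * c = real (card D) * c + c"
      using insert by (simp add: algebra_simps)
    ultimately show ?case by linarith
  qed
  from this[OF subset_refl] have "\<bar>edge_integral V E s t (K {}) - edge_integral V E s t (K E)\<bar> \<le> real (card E) * c" .
  moreover have "edge_integral V E s t (K {}) = edge_integral V E s t (\<lambda>_. u)"
    unfolding edge_integral_def K_def by simp
  moreover have "edge_integral V E s t (K E) = edge_integral V E s t (\<lambda>_. w)"
    unfolding edge_integral_def K_def by (simp cong: prod.cong)
  ultimately show ?thesis by simp
qed

text \<open>Applying \<open>f\<close> in every coordinate preserves the product measure, so this is
  a change of variables.\<close>

lemma edge_integral_pullback: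
  assumes o: "edge_orientation V E s t" and g: "unit_kernel g" and f: "rearrangement f h"
  shows "edge_integral V E s t (\<lambda>_. pullback g f) = edge_integral V E s t (\<lambda>_. g)"
proof -
  have V: "finite V" and sub: "s ` E \<subseteq> V" "t ` E \<subseteq> V" using o by (auto simp: edge_orientation_def)
  have fm: "f \<in> I01 \<rightarrow>\<^sub>M I01" by (rule rearrangement_measurable[OF f])
  have d: "distr (cube V) (cube V) (compose V f) = cube V"
    using distr_PiM_finite_prob_space'[OF V, of "\<lambda>_. I01" "\<lambda>_. I01" f] fm f prob_space_I01
    by (simp add: rearrangement_def)
  have cm: "compose V f \<in> cube V \<rightarrow>\<^sub>M cube V"
    unfolding compose_def
    by (rule measurable_restrict, rule measurable_compose[OF _ fm], rule measurable_component_singleton)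
  let ?P = "\<lambda>x. \<Prod>e\<in>E. g (x (s e), x (t e))"
  have "edge_integral V E s t (\<lambda>_. g) = (\<integral>x. ?P x \<partial>distr (cube V) (cube V) (compose V f))"
    by (simp only: d edge_integral_def)
  also have "\<dots> = (\<integral>x. ?P (compose V f x) \<partial>cube V)"
    by (rule integral_distr[OF cm edge_product_measurable[OF sub g]])
  also have "\<dots> = edge_integral V E s t (\<lambda>_. pullback g f)"
    unfolding edge_integral_def
    by (intro Bochner_Integration.integral_cong refl prod.cong)
      (use sub in \<open>auto simp: pullback_def compose_def\<close>)
  finally show ?thesis by simp
qed

section \<open>Graphons and Borel kernels\<close>

abbreviation unit_square :: "(real \<times> real) set" where
  "unit_square \<equiv> {0..1} \<times> {0..1}"

lemma unit_square_borel [measurable, simp]: "unit_square \<in> sets borel"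
  by (rule borel_Times) auto

section \<open>Integrals over completed measures computed by Borel functions\<close>

lemma measurable_completion_AE_eq:
  fixes f g :: "'a \<Rightarrow> real"
  assumes ae: "AE x in M. f x = g x" and g: "g \<in> borel_measurable M"
  shows "f \<in> borel_measurable (completion M)"
proof (rule measurableI)
  fix A :: "real set" assume A: "A \<in> sets borel"
  have "AE x in M. \<not> (f x \<noteq> g x)" "AE x in M. \<not> (f x \<in> A \<and> f x \<noteq> g x)" using ae by auto
  then have [measurable]: "Measurable.pred (completion M) (\<lambda>x. f x \<noteq> g x)"
    "Measurable.pred (completion M) (\<lambda>x. f x \<in> A \<and> f x \<noteq> g x)"
    by (auto intro: sets_completion_AE)
  have [measurable]: "g \<in> borel_measurable (completion M)" "A \<in> sets borel"
    using g A by (auto intro: measurable_completion)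
  have "Measurable.pred (completion M) (\<lambda>x. (f x \<in> A \<and> f x \<noteq> g x) \<or> (g x \<in> A \<and> \<not> f x \<noteq> g x))"
    by measurable
  then have "{x \<in> space M. (f x \<in> A \<and> f x \<noteq> g x) \<or> (g x \<in> A \<and> \<not> f x \<noteq> g x)} \<in> sets (completion M)"
    by (simp only: pred_def space_completion)
  also have "{x \<in> space M. (f x \<in> A \<and> f x \<noteq> g x) \<or> (g x \<in> A \<and> \<not> f x \<noteq> g x)} = f -` A \<inter> space (completion M)"
    by auto
  finally show "f -` A \<inter> space (completion M) \<in> sets (completion M)" .
qed simp

text \<open>The bridge from the completed measures in \<open>cut_norm\<close> and
  \<open>hom_density\<close> to Borel integrals: measurability of \<open>f\<close> for the
  completion comes from the almost everywhere equality itself.\<close>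

lemma integral_completion_AE_eq:
  fixes f g :: "'a \<Rightarrow> real"
  assumes ae: "AE x in M. f x = g x" and g: "g \<in> borel_measurable M"
  shows "(\<integral>x. f x \<partial>completion M) = (\<integral>x. g x \<partial>M)"
proof -
  have "(\<integral>x. f x \<partial>completion M) = (\<integral>x. g x \<partial>completion M)"
    using ae g by (intro integral_cong_AE measurable_completion_AE_eq measurable_completion AE_completion) auto
  then show ?thesis by (simp add: integral_completion g)
qed

lemma I01_pair_density: "I01 \<Otimes>\<^sub>M I01 = density lborel (indicator unit_square)"
proof -
  have "I01 \<Otimes>\<^sub>M I01 = density (lborel \<Otimes>\<^sub>M lborel) (\<lambda>(x, y). indicator {0..1} x * indicator {0..1} y)"
    unfolding I01_def
    by (rule pair_measure_density)
      (auto intro: sigma_finite_lborel prob_space_imp_sigma_finite prob_space_I01[unfolded I01_def])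
  also have "(\<lambda>(x, y). indicator {0..1} x * indicator {0..1} y :: ennreal) = indicator unit_square"
    by (auto simp: fun_eq_iff indicator_def)
  finally show ?thesis by (simp only: lborel_prod)
qed

lemma AE_I01_pair: "(AE p in I01 \<Otimes>\<^sub>M I01. P p) \<longleftrightarrow> (AE p in lborel. p \<in> unit_square \<longrightarrow> P p)"
  unfolding I01_pair_density by (subst AE_density) (auto simp: indicator_def)

lemma integral_I01_pair:
  fixes g :: "real \<times> real \<Rightarrow> real"
  assumes "g \<in> borel_measurable borel"
  shows "(\<integral>p. g p \<partial>(I01 \<Otimes>\<^sub>M I01)) = (\<integral>p. indicator unit_square p * g p \<partial>lborel)"
proof -
  have "density lborel (indicator unit_square) = density lborel (\<lambda>p. ennreal (indicator unit_square p))"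
    by (simp add: ennreal_indicator)
  then show ?thesis
    unfolding I01_pair_density using assms by (simp add: integral_density)
qed

lemma AE_lborel_swap:
  assumes "AE p in (lborel :: (real \<times> real) measure). P p"
  shows "AE p in (lborel :: (real \<times> real) measure). P (snd p, fst p)"
proof -
  have "AE p in distr (lborel \<Otimes>\<^sub>M lborel) (lborel \<Otimes>\<^sub>M lborel) (\<lambda>(x :: real, y :: real). (y, x)). P p"
    using assms unfolding lborel_prod[symmetric] lborel_pair.distr_pair_swap[symmetric] .
  then have "AE p in lborel \<Otimes>\<^sub>M lborel. P ((\<lambda>(x :: real, y :: real). (y, x)) p)"
    by (rule AE_distrD[rotated]) (rule measurable_pair_swap')
  then have "AE p in lborel \<Otimes>\<^sub>M lborel. P (snd p, fst p)" by (simp add: split_beta')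
  then show ?thesis unfolding lborel_prod .
qed

lemma AE_lborel_fst:
  assumes "AE x in (lborel :: real measure). P x"
  shows "AE p in (lborel :: (real \<times> real) measure). P (fst p)"
proof -
  from assms obtain N where N: "{x \<in> space lborel. \<not> P x} \<subseteq> N" "emeasure lborel N = 0" "N \<in> sets lborel"
    by (rule AE_E)
  have "emeasure (lborel \<Otimes>\<^sub>M lborel) (N \<times> (UNIV :: real set)) = emeasure lborel N * emeasure lborel (UNIV :: real set)"
    using N(3) by (intro lborel.emeasure_pair_measure_Times) auto
  then have "N \<times> UNIV \<in> null_sets (lborel :: (real \<times> real) measure)"
    using N by (auto simp: lborel_prod null_sets_def borel_Times)
  then show ?thesis
    by (rule AE_I') (use N(1) in auto)
qed

lemma AE_lborel_snd:
  assumes "AE x in (lborel :: real measure). P x"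
  shows "AE p in (lborel :: (real \<times> real) measure). P (snd p)"
  using AE_lborel_swap[OF AE_lborel_fst[OF assms]] by simp

section \<open>Lebesgue measurable test sets, cut norm and cut distance\<close>

lemma sets_lebesgue_on_unit:
  assumes "S \<in> sets (lebesgue_on {0..1 :: real})"
  obtains S0 N where "S0 \<in> sets borel" "N \<in> null_sets lborel" "S0 \<subseteq> S" "S \<subseteq> S0 \<union> N" "S \<subseteq> {0..1}"
    "S \<in> sets lebesgue"
proof -
  have S: "S \<in> sets lebesgue" "S \<subseteq> {0..1}" using assms by (auto simp: sets_restrict_space_iff)
  from sets_completionE[OF S(1)] obtain S0 N0 N where "S = S0 \<union> N0" "N0 \<subseteq> N" "N \<in> null_sets lborel" "S0 \<in> sets lborel"
    by blast
  then show ?thesis using S by (intro that[of S0 N]) auto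
qed

text \<open>Lebesgue measurable sides differ from Borel ones by null sets of the line, whose strips
  are null in the plane. Hence the supremum over Lebesgue sides is governed by Borel
  rectangles.\<close>

lemma cut_norm_le:
  assumes g: "g \<in> borel_measurable borel"
    and ae: "AE p in lborel. p \<in> unit_square \<longrightarrow> h p = g p" and c: "cut_bound I01 g c"
  shows "cut_norm h \<le> c"
  unfolding cut_norm_def
proof (rule cSUP_least)
  show "sets (lebesgue_on {0..1 :: real}) \<times> sets (lebesgue_on {0..1 :: real}) \<noteq> {}"
    using sets.empty_sets by blast
  fix ST assume "ST \<in> sets (lebesgue_on {0..1 :: real}) \<times> sets (lebesgue_on {0..1 :: real})"
  then obtain S T where ST: "ST = (S, T)" "S \<in> sets (lebesgue_on {0..1})" "T \<in> sets (lebesgue_on {0..1})"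
    by auto
  obtain S0 N where S0: "S0 \<in> sets borel" "N \<in> null_sets lborel" "S0 \<subseteq> S" "S \<subseteq> S0 \<union> N" "S \<subseteq> {0..1}"
    using sets_lebesgue_on_unit[OF ST(2)] .
  obtain T0 N' where T0: "T0 \<in> sets borel" "N' \<in> null_sets lborel" "T0 \<subseteq> T" "T \<subseteq> T0 \<union> N'" "T \<subseteq> {0..1}"
    using sets_lebesgue_on_unit[OF ST(3)] .
  have [measurable]: "S0 \<times> T0 \<in> sets borel" using S0(1) T0(1) by (rule borel_Times)
  note [measurable] = g
  have "AE x in lborel. x \<notin> N" "AE x in lborel. x \<notin> N'"
    using S0(2) T0(2) by (auto intro: AE_not_in)
  from AE_lborel_fst[OF this(1)] AE_lborel_snd[OF this(2)] ae
  have "AE p in lborel. indicator (S \<times> T) p *\<^sub>R h p = indicator (S0 \<times> T0) p *\<^sub>R g p"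
  proof eventually_elim
    case (elim p)
    have "fst p \<in> S \<longleftrightarrow> fst p \<in> S0" using elim(1) S0(3,4) by blast
    moreover have "snd p \<in> T \<longleftrightarrow> snd p \<in> T0" using elim(2) T0(3,4) by blast
    ultimately have "p \<in> S \<times> T \<longleftrightarrow> p \<in> S0 \<times> T0" by (simp add: mem_Times_iff)
    moreover have "h p = g p" if "p \<in> S \<times> T"
      using elim(3) that S0(5) T0(5) by (auto simp: subset_iff)
    ultimately show ?case by (cases "p \<in> S \<times> T") simp_all
  qed
  then have "set_lebesgue_integral lebesgue (S \<times> T) h = (\<integral>p. indicator (S0 \<times> T0) p *\<^sub>R g p \<partial>lborel)"
    unfolding set_lebesgue_integral_def by (rule integral_completion_AE_eq) simp
  also have "\<dots> = (\<integral>p. indicator unit_square p * (indicator (S0 \<times> T0) p *\<^sub>R g p) \<partial>lborel)"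
    using S0 T0 by (intro Bochner_Integration.integral_cong) (auto simp: indicator_def)
  also have "\<dots> = (LINT p:S0 \<times> T0|I01 \<Otimes>\<^sub>M I01. g p)"
    unfolding set_lebesgue_integral_def by (rule integral_I01_pair[symmetric]) simp
  finally show "(case ST of (S, T) \<Rightarrow> \<bar>set_lebesgue_integral lebesgue (S \<times> T) h\<bar>) \<le> c"
    using cut_boundD[OF c, of S0 T0] S0 T0 ST by simp
qed

text \<open>The pointwise bound makes the family under the real supremum bounded, and the empty
  rectangle contributes the value 0.\<close>

lemma cut_norm_nonneg:
  assumes h: "\<And>p. p \<in> unit_square \<Longrightarrow> \<bar>h p\<bar> \<le> 1"
  shows "0 \<le> cut_norm h"
  unfolding cut_norm_def
proof (rule cSUP_upper2[where x = "({}, {})"])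
  show "bdd_above ((\<lambda>(S, T). \<bar>set_lebesgue_integral lebesgue (S \<times> T) h\<bar>) `
      (sets (lebesgue_on {0..1}) \<times> sets (lebesgue_on {0..1})))"
  proof (rule bdd_aboveI2)
    fix ST assume "ST \<in> sets (lebesgue_on {0..1 :: real}) \<times> sets (lebesgue_on {0..1 :: real})"
    then obtain S T where ST: "ST = (S, T)" "S \<subseteq> {0..1}" "T \<subseteq> {0..1}"
      by (auto simp: sets_restrict_space_iff)
    have sq: "emeasure lborel unit_square = 1"
      using lborel.emeasure_pair_measure_Times[of "{0..1 :: real}" "lborel :: real measure" "{0..1 :: real}"]
      by (simp add: lborel_prod)
    have "\<bar>set_lebesgue_integral lebesgue (S \<times> T) h\<bar> \<le> (\<integral>p. \<bar>indicator (S \<times> T) p *\<^sub>R h p\<bar> \<partial>lebesgue)"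
      unfolding set_lebesgue_integral_def by (rule integral_abs_bound)
    also have "\<dots> \<le> (\<integral>p. indicator unit_square p \<partial>lebesgue)"
    proof (rule integral_mono')
      show "integrable lebesgue (indicator unit_square :: _ \<Rightarrow> real)"
        using sq by (subst integrable_completion) (auto intro!: integrable_real_indicator)
      fix p show "\<bar>indicator (S \<times> T) p *\<^sub>R h p\<bar> \<le> indicator unit_square p"
        using h[of p] ST by (cases p) (auto simp: indicator_def)
    qed simp
    also have "\<dots> = 1"
      using sq by (subst integral_completion) (auto simp: measure_def)
    finally show "(case ST of (S, T) \<Rightarrow> \<bar>set_lebesgue_integral lebesgue (S \<times> T) h\<bar>) \<le> 1"
      using ST by simp
  qed
qed auto

lemma graphonD:
  assumes "U \<in> graphons" "x \<in> {0..1}" "y \<in> {0..1}"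
  shows "0 \<le> U (x, y)" "U (x, y) \<le> 1" "U (x, y) = U (y, x)"
proof -
  have "U \<in> unit_square \<rightarrow> {0..1}" using assms(1) by (auto simp: graphons_def)
  then have "U (x, y) \<in> {0..1}" using assms(2,3) by auto
  then show "0 \<le> U (x, y)" "U (x, y) \<le> 1" by auto
  show "U (x, y) = U (y, x)" using assms by (auto simp: graphons_def)
qed

lemma cut_norm_rearranged_nonneg:
  assumes "U \<in> graphons" "W \<in> graphons" "invertible_measure_preserving \<phi>"
  shows "0 \<le> cut_norm (\<lambda>(x, y). U (x, y) - W (\<phi> x, \<phi> y))"
proof (rule cut_norm_nonneg, clarify)
  fix x y :: real assume xy: "x \<in> {0..1}" "y \<in> {0..1}"
  have "\<phi> x \<in> {0..1}" "\<phi> y \<in> {0..1}"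
    using assms(3) xy by (auto simp: invertible_measure_preserving_def dest: bij_betwE)
  then show "\<bar>U (x, y) - W (\<phi> x, \<phi> y)\<bar> \<le> 1"
    using graphonD(1,2)[OF assms(1) xy] graphonD(1,2)[OF assms(2)] by (smt (verit))
qed

text \<open>Nonnegativity of all competing cut norms is what makes the real infimum a lower bound;
  \<open>\<phi>\<close> itself shows that there is a competitor.\<close>

lemma cut_distance_le:
  assumes "U \<in> graphons" "W \<in> graphons" "invertible_measure_preserving \<phi>"
    and "cut_norm (\<lambda>(x, y). U (x, y) - W (\<phi> x, \<phi> y)) \<le> c"
  shows "0 \<le> cut_distance U W" "cut_distance U W \<le> c"
proof -
  show "0 \<le> cut_distance U W"
    unfolding cut_distance_def
    by (rule cINF_greatest) (use assms cut_norm_rearranged_nonneg in auto)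
  show "cut_distance U W \<le> c"
    unfolding cut_distance_def
    by (rule cINF_lower2[OF bdd_belowI2[of _ 0]]) (use assms cut_norm_rearranged_nonneg in auto)
qed

text \<open>The error set \<open>N\<close> is required to be null only for \<open>I01\<close>, since
  this is all that a rearrangement guarantees for the preimage of a null set.\<close>

lemma emeasure_lebesgue_on_unit:
  assumes "S \<in> sets (lebesgue_on {0..1})" "S0 \<in> sets borel" "N \<in> sets borel" "emeasure I01 N = 0"
    "S0 \<inter> {0..1} \<subseteq> S" "S \<subseteq> S0 \<union> N"
  shows "emeasure (lebesgue_on {0..1}) S = emeasure I01 S0"
proof -
  have S: "S \<in> sets lebesgue" "S \<subseteq> {0..1}" using assms(1) by (auto simp: sets_restrict_space_iff)
  have "emeasure (lebesgue_on {0..1}) S = emeasure lebesgue S"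
    using S by (simp add: emeasure_restrict_space)
  also have "\<dots> = emeasure lebesgue (S0 \<inter> {0..1})"
  proof (rule emeasure_eq_AE)
    have "N \<inter> {0..1} \<in> null_sets lborel"
      using assms(3,4) by (auto simp: null_sets_def emeasure_I01)
    then have "AE x in lebesgue. x \<notin> N \<inter> {0..1}" by (intro AE_completion AE_not_in)
    then show "AE x in lebesgue. x \<in> S \<longleftrightarrow> x \<in> S0 \<inter> {0..1}"
      by eventually_elim (use assms(5,6) S in auto)
  qed (use S assms in auto)
  also have "\<dots> = emeasure I01 S0"
    using assms(2) by (simp add: emeasure_I01)
  finally show ?thesis .
qed

text \<open>Borel measurability does not by itself give measurability between Lebesgue
  \<sigma>-algebras: preimages of null sets must be null as well, and here this follows from
  preservation of \<open>I01\<close>.\<close>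

lemma rearrangement_lebesgue:
  assumes f: "rearrangement f h"
  shows "f \<in> lebesgue_on {0..1} \<rightarrow>\<^sub>M lebesgue_on {0..1}"
    "distr (lebesgue_on {0..1}) (lebesgue_on {0..1}) f = lebesgue_on {0..1}"
proof -
  have f01: "f x \<in> {0..1} \<longleftrightarrow> x \<in> {0..1}" for x using f by (simp add: rearrangement_def)
  have m: "f \<in> I01 \<rightarrow>\<^sub>M I01" and d: "distr I01 I01 f = I01"
    using f rearrangement_measurable[OF f] by (auto simp: rearrangement_def)
  have vim: "f -` A \<in> sets borel" "emeasure I01 (f -` A) = emeasure I01 A" if "A \<in> sets borel" for A
  proof -
    show "f -` A \<in> sets borel" using measurable_sets[OF m, of A] that by simp
    show "emeasure I01 (f -` A) = emeasure I01 A"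
      using emeasure_distr[OF m, of A] that by (simp add: d)
  qed
  have key: "f -` S \<inter> {0..1} \<in> sets (lebesgue_on {0..1}) \<and>
      emeasure (lebesgue_on {0..1}) (f -` S \<inter> {0..1}) = emeasure (lebesgue_on {0..1}) S"
    if S: "S \<in> sets (lebesgue_on {0..1})" for S
  proof -
    obtain S0 N where S0: "S0 \<in> sets borel" "N \<in> null_sets lborel" "S0 \<subseteq> S" "S \<subseteq> S0 \<union> N" "S \<subseteq> {0..1}"
      using sets_lebesgue_on_unit[OF S] .
    have N: "N \<in> sets borel" using S0(2) by auto
    have "emeasure I01 N \<le> emeasure lborel N"
      unfolding emeasure_I01[OF N] using N by (intro emeasure_mono) auto
    then have N0: "emeasure I01 N = 0" using S0(2) by (auto simp: null_sets_def)
    have null: "f -` N \<inter> {0..1} \<in> null_sets lborel"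
      using vim[OF N] N0 by (auto simp: null_sets_def emeasure_I01)
    have "f -` S \<inter> {0..1} \<in> sets lebesgue"
    proof (rule sets_completionI)
      show "f -` S \<inter> {0..1} = (f -` S0 \<inter> {0..1}) \<union> (f -` (S - S0) \<inter> {0..1})" using S0 by auto
      show "f -` (S - S0) \<inter> {0..1} \<subseteq> f -` N \<inter> {0..1}" using S0 by auto
      show "f -` S0 \<inter> {0..1} \<in> sets lborel" using vim[OF S0(1)] by auto
    qed (rule null)
    then have "f -` S \<inter> {0..1} \<in> sets (lebesgue_on {0..1})" by (auto simp: sets_restrict_space_iff)
    moreover from this have "emeasure (lebesgue_on {0..1}) (f -` S \<inter> {0..1}) = emeasure I01 (f -` S0)"
      by (rule emeasure_lebesgue_on_unit[where N="f -` N"]) (use vim S0 N N0 in auto)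
    moreover have "emeasure (lebesgue_on {0..1}) S = emeasure I01 S0"
      by (rule emeasure_lebesgue_on_unit[where N=N]) (use S S0 N N0 in auto)
    ultimately show ?thesis using vim(2)[OF S0(1)] by simp
  qed
  show fm: "f \<in> lebesgue_on {0..1} \<rightarrow>\<^sub>M lebesgue_on {0..1}"
    by (rule measurableI) (use key f01 in auto)
  show "distr (lebesgue_on {0..1}) (lebesgue_on {0..1}) f = lebesgue_on {0..1}"
    by (rule measure_eqI) (use key in \<open>auto simp: emeasure_distr[OF fm]\<close>)
qed

lemma rearrangement_invertible_measure_preserving:
  assumes f: "rearrangement f h"
  shows "invertible_measure_preserving f"
proof -
  have fh: "h (f x) = x" "f (h x) = x" "f x \<in> {0..1} \<longleftrightarrow> x \<in> {0..1}" for x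
    using f by (auto simp: rearrangement_def)
  have h01: "h x \<in> {0..1} \<longleftrightarrow> x \<in> {0..1}" for x
    using fh(3)[of "h x"] by (simp only: fh)
  have bij: "bij_betw f {0..1} {0..1}"
    by (rule bij_betw_byWitness[where f'=h]) (use fh h01 in auto)
  have "inv_into {0..1} f x = h x" if "x \<in> {0..1}" for x
    by (rule inv_into_f_eq) (use bij fh h01 that in \<open>auto simp: bij_betw_def\<close>)
  then have "inv_into {0..1} f \<in> lebesgue_on {0..1} \<rightarrow>\<^sub>M lebesgue_on {0..1}"
    using rearrangement_lebesgue(1)[OF rearrangement_sym[OF f]]
    by (subst measurable_cong[where g=h]) auto
  then show ?thesis
    using bij rearrangement_lebesgue[OF f] by (simp add: invertible_measure_preserving_def)
qed

section \<open>Borel versions of graphons\<close>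

definition represents :: "(real \<times> real \<Rightarrow> real) \<Rightarrow> (real \<times> real \<Rightarrow> real) \<Rightarrow> bool" where
  "represents g U \<longleftrightarrow> unit_kernel g \<and> (\<forall>x y. g (x, y) = g (y, x)) \<and>
     (AE p in lborel. p \<in> unit_square \<longrightarrow> U p = g p)"

text \<open>A Borel version of \<open>U\<close> is clamped to the unit interval and averaged with
  its transpose. Neither operation disturbs almost everywhere equality on the square, because
  \<open>U\<close> has values in that interval and is symmetric; afterwards both properties hold
  everywhere.\<close>

lemma graphon_representative:
  assumes U: "U \<in> graphons"
  obtains g where "represents g U"
proof -
  have sq: "unit_square \<in> sets lebesgue" by (rule sets_completionI_sets) simp
  have "U \<in> borel_measurable (lebesgue_on unit_square)" using U by (simp add: graphons_def)
  then have "(\<lambda>p. if p \<in> unit_square then U p else 0) \<in> borel_measurable lebesgue"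
    using borel_measurable_if[OF sq] by blast
  then obtain g' where g' [measurable]: "g' \<in> borel_measurable lborel"
    and ae: "AE p in lborel. (if p \<in> unit_square then U p else 0) = g' p"
    using completion_ex_borel_measurable_real by blast
  define k where "k p = max 0 (min 1 (g' p))" for p
  define g where "g p = (k p + k (snd p, fst p)) / 2" for p
  have [measurable]: "k \<in> borel_measurable borel" using g' unfolding k_def by simp
  have "(\<lambda>p :: real \<times> real. (snd p, fst p)) \<in> borel \<Otimes>\<^sub>M borel \<rightarrow>\<^sub>M borel \<Otimes>\<^sub>M borel"
    by measurable
  then have "(\<lambda>p :: real \<times> real. (snd p, fst p)) \<in> borel \<rightarrow>\<^sub>M borel"
    unfolding borel_prod .
  then have "(\<lambda>p. k (snd p, fst p)) \<in> borel_measurable borel"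
    by (rule measurable_compose) measurable
  then have gm: "g \<in> borel_measurable borel" unfolding g_def[abs_def] by measurable
  have "AE p in lborel. p \<in> unit_square \<longrightarrow> U p = k p"
    using ae
  proof eventually_elim
    case (elim p)
    then show ?case using graphonD(1,2)[OF U, of "fst p" "snd p"] by (auto simp: k_def mem_Times_iff)
  qed
  with AE_lborel_swap[OF this] have "AE p in lborel. p \<in> unit_square \<longrightarrow> U p = g p"
  proof eventually_elim
    case (elim p)
    then show ?case using graphonD(3)[OF U, of "fst p" "snd p"] by (auto simp: g_def)
  qed
  moreover have "unit_kernel g"
    using gm unfolding unit_kernel_def
    by (auto simp: g_def k_def measurable_cong_sets[OF sets_I01_pair refl])
  ultimately show ?thesis using that[of g] by (auto simp: represents_def g_def add.commute)
qed

lemma kernel_graphon: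
  assumes v: "unit_kernel v" and s: "\<And>x y. v (x, y) = v (y, x)"
  shows "restrict v unit_square \<in> graphons" "represents v (restrict v unit_square)"
proof -
  have "v \<in> borel_measurable borel"
    using unit_kernelD(1)[OF v] by (simp add: measurable_cong_sets[OF sets_I01_pair refl])
  then have "v \<in> borel_measurable lebesgue" by (intro measurable_completion) simp
  then have "v \<in> borel_measurable (lebesgue_on unit_square)" by (rule measurable_restrict_space1)
  then have "restrict v unit_square \<in> borel_measurable (lebesgue_on unit_square)"
    by (rule measurable_cong[THEN iffD1, rotated]) simp
  moreover have "restrict v unit_square \<in> unit_square \<rightarrow>\<^sub>E {0..1}"
    using unit_kernelD(2,3)[OF v] by auto
  ultimately show "restrict v unit_square \<in> graphons" using s by (auto simp: graphons_def)
  show "represents v (restrict v unit_square)" using v s by (auto simp: represents_def)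
qed

section \<open>Compactness of the space of graphons\<close>

text \<open>The indicator of the exceptional set has cut bound 0, so the weighted vertex bound with
  constant weights makes its integral over the cube vanish. The coordinates must be distinct, as the
  null diagonal is not controlled.\<close>

lemma AE_cube_edge:
  fixes P :: "real \<times> real \<Rightarrow> bool"
  assumes V: "finite V" "i \<in> V" "j \<in> V" "i \<noteq> j" and P: "AE p in I01 \<Otimes>\<^sub>M I01. P p"
  shows "AE x in cube V. P (x i, x j)"
proof -
  interpret C: prob_space "cube V" by (rule prob_space_cube)
  from P obtain N where N: "{p \<in> space (I01 \<Otimes>\<^sub>M I01). \<not> P p} \<subseteq> N" "emeasure (I01 \<Otimes>\<^sub>M I01) N = 0"
    "N \<in> sets (I01 \<Otimes>\<^sub>M I01)"
    by (rule AE_E)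
  let ?n = "indicator N :: real \<times> real \<Rightarrow> real"
  have nm: "?n \<in> borel_measurable (I01 \<Otimes>\<^sub>M I01)" using N(3) by (rule borel_measurable_indicator)
  have n1: "\<bar>?n p\<bar> \<le> 1" for p by (simp add: indicator_def)
  have "cut_bound I01 ?n 0"
  proof (rule cut_bound_integral_abs[OF I01_pair.integrable_bounded[OF nm n1]])
    have "(\<integral>p. \<bar>?n p\<bar> \<partial>(I01 \<Otimes>\<^sub>M I01)) = measure (I01 \<Otimes>\<^sub>M I01) N" using N(3) by simp
    then show "(\<integral>p. \<bar>?n p\<bar> \<partial>(I01 \<Otimes>\<^sub>M I01)) \<le> 0" using N(2) by (simp add: measure_def)
  qed
  from cut_bound_vertex_weights[OF V nm n1 this, of "\<lambda>_. 1" "\<lambda>_. 1"]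
  have "(\<integral>x. ?n (x i, x j) \<partial>cube V) \<le> 0" by simp
  moreover have "0 \<le> (\<integral>x. ?n (x i, x j) \<partial>cube V)" by (rule Bochner_Integration.integral_nonneg) simp
  ultimately have "(\<integral>x. ?n (x i, x j) \<partial>cube V) = 0" by (rule antisym)
  moreover have "(\<lambda>x. (x i, x j)) \<in> cube V \<rightarrow>\<^sub>M I01 \<Otimes>\<^sub>M I01"
    using V by (intro measurable_Pair measurable_component_singleton) auto
  from measurable_compose[OF this nm] have "integrable (cube V) (\<lambda>x. ?n (x i, x j))"
    by (rule C.integrable_bounded) (rule n1)
  ultimately have "AE x in cube V. ?n (x i, x j) = 0"
    by (subst (asm) integral_nonneg_eq_0_iff_AE) auto
  then show ?thesis
    by eventually_elim (use N(1) in \<open>auto simp: indicator_def split: if_splits\<close>)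
qed

text \<open>The identity is measure preserving from Lebesgue to Borel sets in each coordinate, hence
  on the product; \<open>compose V\<close> merely keeps the map extensional.\<close>

lemma distr_lebesgue_cube:
  assumes "finite V"
  shows "compose V (\<lambda>x. x) \<in> PiM V (\<lambda>_. lebesgue_on {0..1}) \<rightarrow>\<^sub>M cube V"
    "distr (PiM V (\<lambda>_. lebesgue_on {0..1})) (cube V) (compose V (\<lambda>x. x)) = cube V"
proof -
  have m: "(\<lambda>x::real. x) \<in> lebesgue_on {0..1} \<rightarrow>\<^sub>M I01"
  proof -
    have "(\<lambda>x::real. x) \<in> lebesgue \<rightarrow>\<^sub>M I01"
      by (rule measurable_completion) (simp add: measurable_cong_sets[OF refl sets_I01])
    then show ?thesis by (rule measurable_restrict_space1)
  qed
  have em: "emeasure (lebesgue_on {0..1}) (A \<inter> {0..1}) = emeasure I01 A" if "A \<in> sets borel" for A :: "real set"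
    by (rule emeasure_lebesgue_on_unit[where N="{}"]) (use that in \<open>auto simp: sets_restrict_space_iff\<close>)
  have d: "distr (lebesgue_on {0..1}) I01 (\<lambda>x. x) = I01"
    by (rule measure_eqI) (use em in \<open>auto simp: emeasure_distr[OF m]\<close>)
  have p: "prob_space (lebesgue_on {0..1::real})"
    by (rule prob_spaceI) (simp add: emeasure_restrict_space)
  show "distr (PiM V (\<lambda>_. lebesgue_on {0..1})) (cube V) (compose V (\<lambda>x. x)) = cube V"
    using distr_PiM_finite_prob_space'[OF assms p prob_space_I01 m] by (simp add: d)
  show "compose V (\<lambda>x. x) \<in> PiM V (\<lambda>_. lebesgue_on {0..1}) \<rightarrow>\<^sub>M cube V"
    unfolding compose_def
    by (rule measurable_restrict, rule measurable_compose[OF _ m], rule measurable_component_singleton)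
qed

text \<open>Finitely many edges contribute finitely many null sets, so \<open>U\<close> and
  \<open>g\<close> agree on all edges at almost every point. Symmetry of \<open>U\<close> makes the
  chosen orientation irrelevant to \<open>edge_factor\<close>.\<close>

lemma hom_density_eq_edge_integral:
  assumes U: "U \<in> graphons" and g: "represents g U"
    and o: "edge_orientation (verts F) (edges F) s t" and e: "\<And>e. e \<in> edges F \<Longrightarrow> e = {s e, t e}"
  shows "hom_density F U = edge_integral (verts F) (edges F) s t (\<lambda>_. g)"
proof -
  let ?V = "verts F" and ?E = "edges F"
  let ?L = "PiM ?V (\<lambda>_. lebesgue_on {0..1})"
  have V: "finite ?V" "finite ?E" and sub: "s ` ?E \<subseteq> ?V" "t ` ?E \<subseteq> ?V" and st: "\<And>e. e \<in> ?E \<Longrightarrow> s e \<noteq> t e"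
    using o by (auto simp: edge_orientation_def)
  have gk: "unit_kernel g" and ae: "AE p in I01 \<Otimes>\<^sub>M I01. p \<in> unit_square \<longrightarrow> U p = g p"
    using g unfolding represents_def AE_I01_pair by auto
  let ?P = "\<lambda>x. \<Prod>e\<in>?E. g (x (s e), x (t e))"
  have Pm: "?P \<in> borel_measurable (cube ?V)" by (rule edge_product_measurable[OF sub gk])
  note dm = distr_lebesgue_cube[OF V(1)]
  have Pc: "?P (compose ?V (\<lambda>x. x) x) = ?P x" for x
    by (rule prod.cong) (use sub in \<open>auto simp: compose_def\<close>)
  have "AE x in cube ?V. \<forall>e\<in>?E. (x (s e), x (t e)) \<in> unit_square \<longrightarrow> U (x (s e), x (t e)) = g (x (s e), x (t e))"
    using sub st by (intro AE_finite_allI V AE_cube_edge ae) auto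
  then have "AE x in distr ?L (cube ?V) (compose ?V (\<lambda>x. x)).
      \<forall>e\<in>?E. (x (s e), x (t e)) \<in> unit_square \<longrightarrow> U (x (s e), x (t e)) = g (x (s e), x (t e))"
    by (simp only: dm(2))
  from AE_distrD[OF dm(1) this]
  have "AE x in ?L. \<forall>e\<in>?E. (x (s e), x (t e)) \<in> unit_square \<longrightarrow> U (x (s e), x (t e)) = g (x (s e), x (t e))"
    by eventually_elim (use sub in \<open>auto simp: compose_def image_subset_iff\<close>)
  with AE_space have "AE x in ?L. (\<Prod>e\<in>?E. edge_factor U x e) = ?P x"
  proof eventually_elim
    case (elim x)
    show ?case
    proof (rule prod.cong[OF refl])
      fix e' assume e': "e' \<in> ?E"
      then have "s e' \<in> ?V" "t e' \<in> ?V" using sub by auto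
      then have 01: "x (s e') \<in> {0..1}" "x (t e') \<in> {0..1}"
        using elim(1) by (auto simp: space_PiM PiE_iff)
      have "edge_factor U x e' = edge_factor U x {s e', t e'}" using e[OF e'] by simp
      also have "\<dots> = U (x (s e'), x (t e'))" by (rule edge_factor_eq[where x=x, OF U 01])
      also have "\<dots> = g (x (s e'), x (t e'))" using elim(2) e' 01 by auto
      finally show "edge_factor U x e' = g (x (s e'), x (t e'))" .
    qed
  qed
  then have "hom_density F U = (\<integral>x. ?P x \<partial>?L)"
    unfolding hom_density_def
  proof (rule integral_completion_AE_eq)
    show "?P \<in> borel_measurable ?L" using measurable_compose[OF dm(1) Pm] by (simp only: Pc)
  qed
  also have "\<dots> = (\<integral>x. ?P (compose ?V (\<lambda>x. x) x) \<partial>?L)" by (simp only: Pc)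
  also have "\<dots> = (\<integral>x. ?P x \<partial>distr ?L (cube ?V) (compose ?V (\<lambda>x. x)))"
    by (rule integral_distr[OF dm(1) Pm, symmetric])
  finally show ?thesis by (simp only: dm(2) edge_integral_def)
qed

lemma simple_graph_orientation:
  assumes "finite_simple_graph F"
  obtains s t where "edge_orientation (verts F) (edges F) s t" "\<And>e. e \<in> edges F \<Longrightarrow> e = {s e, t e}"
proof -
  have e: "e \<subseteq> verts F" "card e = 2" if "e \<in> edges F" for e
    using assms that by (auto simp: finite_simple_graph_def)
  have "\<exists>i j. e = {i, j} \<and> i \<noteq> j" if "e \<in> edges F" for e
    using e(2)[OF that] by (auto simp: card_2_iff)
  then obtain s t where st: "\<And>e. e \<in> edges F \<Longrightarrow> e = {s e, t e}" "\<And>e. e \<in> edges F \<Longrightarrow> s e \<noteq> t e"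
    by metis
  have "finite (verts F)" using assms by (simp add: finite_simple_graph_def)
  moreover have "finite (edges F)"
    by (rule finite_subset[of _ "Pow (verts F)"]) (use e calculation in auto)
  moreover have "s e \<in> verts F" "t e \<in> verts F" if "e \<in> edges F" for e
    using st(1)[OF that] e(1)[OF that] by blast+
  moreover have "{s e, t e} \<noteq> {s e', t e'}" if "e \<in> edges F" "e' \<in> edges F" "e \<noteq> e'" for e e'
    using st(1) that by metis
  ultimately have "edge_orientation (verts F) (edges F) s t"
    using st(2) unfolding edge_orientation_def by (simp add: image_subset_iff)
  then show ?thesis using that st(1) by blast
qed

lemma cut_bound_scale:
  assumes "cut_bound M g c" "0 \<le> k" shows "cut_bound M (\<lambda>p. k * g p) (k * c)"
proof (rule cut_boundI)
  fix S T assume "S \<in> sets M" "T \<in> sets M"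
  from mult_left_mono[OF cut_boundD[OF assms(1) this] assms(2)]
  show "\<bar>LINT p:S \<times> T|M \<Otimes>\<^sub>M M. k * g p\<bar> \<le> k * c"
    using assms(2) by (simp add: abs_mult)
qed

text \<open>Each rearranged kernel is symmetric, so replacing the limit by its symmetrization does not
  increase the cut norm of the difference.\<close>

lemma cut_bound_symmetrize:
  assumes g: "unit_kernel g" "\<And>x y. g (x, y) = g (y, x)" and v: "unit_kernel v"
    and c: "cut_bound I01 (\<lambda>p. g p - v p) c"
  shows "cut_bound I01 (\<lambda>p. g p - (v p + v (snd p, fst p)) / 2) c"
proof -
  have i: "integrable (I01 \<Otimes>\<^sub>M I01) (\<lambda>p. g p - v p)"
    using unit_kernelD(5)[OF g(1)] unit_kernelD(5)[OF v] by (rule Bochner_Integration.integrable_diff)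
  interpret pair_prob_space I01 I01 by (rule I01.pair_prob_space_self)
  have i': "integrable (I01 \<Otimes>\<^sub>M I01) (\<lambda>(x, y). g (y, x) - v (y, x))"
    using integrable_product_swap[OF i] by simp
  have "cut_bound I01 (\<lambda>p. (g p - v p) + (case p of (x, y) \<Rightarrow> g (y, x) - v (y, x))) (c + c)"
    by (rule cut_bound_add[OF c cut_bound_swap[OF prob_space_I01 i c] i i'])
  from cut_bound_scale[OF this, of "1 / 2"]
  have "cut_bound I01 (\<lambda>p. 1 / 2 * ((g p - v p) + (case p of (x, y) \<Rightarrow> g (y, x) - v (y, x)))) c" by simp
  also have "(\<lambda>p. 1 / 2 * ((g p - v p) + (case p of (x, y) \<Rightarrow> g (y, x) - v (y, x))))
      = (\<lambda>p. g p - (v p + v (snd p, fst p)) / 2)"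
    using g(2) by (auto simp: fun_eq_iff field_simps)
  finally show ?thesis .
qed

text \<open>The densities are handled before passing to \<open>cut_distance\<close>: the counting
  lemma is applied to the rearranged kernels, and rearranging leaves densities unchanged. No infimum
  has to be unpacked, and one subsequence serves all graphs.\<close>

theorem graphon_sequential_compactness:
  assumes U: "\<And>n. U n \<in> graphons"
  obtains r :: "nat \<Rightarrow> nat" and W where "strict_mono r" "W \<in> graphons"
    "(\<lambda>n. cut_distance (U (r n)) W) \<longlonglongrightarrow> 0"
    "\<And>F :: 'a graph. finite_simple_graph F \<Longrightarrow> (\<lambda>n. hom_density F (U (r n))) \<longlonglongrightarrow> hom_density F W"
proof -
  have "\<exists>g. represents g (U n)" for n using graphon_representative[OF U] by metis
  then obtain g where g: "\<And>n. represents (g n) (U n)" by metis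
  then have gk: "\<And>n. unit_kernel (g n)" and gs: "\<And>n x y. g n (x, y) = g n (y, x)"
    by (auto simp: represents_def)
  obtain r :: "nat \<Rightarrow> nat" and f h v where r: "strict_mono r" and v: "unit_kernel v"
    and f: "\<And>i. rearrangement (f i) (h i)"
    and c0: "\<And>i. cut_bound I01 (\<lambda>p. pullback (g (r i)) (f i) p - v p) (2 * (1 / 2) ^ i)"
    by (rule kernel_sequential_compactness[of g, OF gk]) (rule that)
  define w where "w p = (v p + v (snd p, fst p)) / 2" for p
  have c: "cut_bound I01 (\<lambda>p. pullback (g (r i)) (f i) p - w p) (2 * (1 / 2) ^ i)" for i
    unfolding w_def
    by (rule cut_bound_symmetrize[OF kernel_pullback[OF gk f] _ v c0]) (simp add: pullback_def gs)
  have "(\<lambda>p. v (snd p, fst p)) \<in> borel_measurable (I01 \<Otimes>\<^sub>M I01)"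
    by (rule measurable_compose[OF _ unit_kernelD(1)[OF v]]) measurable
  then have "w \<in> borel_measurable (I01 \<Otimes>\<^sub>M I01)"
    unfolding w_def[abs_def] using unit_kernelD(1)[OF v] by simp
  moreover have "0 \<le> w p \<and> w p \<le> 1" for p
    using unit_kernelD(2,3)[OF v, of p] unit_kernelD(2,3)[OF v, of "(snd p, fst p)"] by (simp add: w_def)
  ultimately have wk: "unit_kernel w" by (simp add: unit_kernel_def)
  have ws: "w (x, y) = w (y, x)" for x y by (simp add: w_def add.commute)
  define W where "W = restrict w unit_square"
  have W: "W \<in> graphons" "represents w W" unfolding W_def by (rule kernel_graphon[OF wk ws])+
  have lim: "(\<lambda>i. B * (2 * (1 / 2) ^ i)) \<longlonglongrightarrow> 0" for B :: real
    by (intro tendsto_mult_right_zero LIMSEQ_power_zero) simp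
  have "0 \<le> cut_distance (U (r i)) W \<and> cut_distance (U (r i)) W \<le> 1 * (2 * (1 / 2) ^ i)" for i
  proof -
    \<comment> \<open>Compactness rearranges the terms of the sequence, whereas
      \<open>cut_distance\<close> rearranges its second argument; pulling the difference back along
      the inverse moves the map onto the limit.\<close>
    have h: "rearrangement (h i) (f i)" by (rule rearrangement_sym[OF f])
    have h01: "h i x \<in> {0..1}" if "x \<in> {0..1}" for x using h that by (simp add: rearrangement_def)
    have gm: "(\<lambda>p. pullback (g (r i)) (f i) p - w p) \<in> borel_measurable (I01 \<Otimes>\<^sub>M I01)"
      using unit_kernelD(1)[OF kernel_pullback[OF gk f]] unit_kernelD(1)[OF wk] by (rule borel_measurable_diff)
    have "cut_bound I01 (pullback (\<lambda>p. pullback (g (r i)) (f i) p - w p) (h i)) (2 * (1 / 2) ^ i)"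
      by (rule cut_bound_pullback[OF h gm c])
    moreover have "pullback (\<lambda>p. pullback (g (r i)) (f i) p - w p) (h i) \<in> borel_measurable borel"
      using pullback_measurable[OF gm rearrangement_measurable(1)[OF h]]
      by (simp add: measurable_cong_sets[OF sets_I01_pair refl])
    moreover have "AE p in lborel. p \<in> unit_square \<longrightarrow>
        (case p of (x, y) \<Rightarrow> U (r i) (x, y) - W (h i x, h i y)) = pullback (\<lambda>p. pullback (g (r i)) (f i) p - w p) (h i) p"
    proof -
      have "AE p in lborel. p \<in> unit_square \<longrightarrow> U (r i) p = g (r i) p"
        using g[of "r i"] by (simp add: represents_def)
      then show ?thesis
      proof eventually_elim
        case (elim p)
        then show ?case
          using h h01 by (cases p) (auto simp: pullback_def W_def rearrangement_def)
      qed
    qed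
    ultimately have "cut_norm (\<lambda>(x, y). U (r i) (x, y) - W (h i x, h i y)) \<le> 2 * (1 / 2) ^ i"
      by (intro cut_norm_le)
    from cut_distance_le[OF U W(1) rearrangement_invertible_measure_preserving[OF h] this]
    show ?thesis by simp
  qed
  then have "(\<lambda>i. cut_distance (U (r i)) W) \<longlonglongrightarrow> 0"
    by (intro Lim_null_comparison[OF always_eventually lim[of 1]]) simp
  moreover have "(\<lambda>n. hom_density F (U (r n))) \<longlonglongrightarrow> hom_density F W" if F: "finite_simple_graph F" for F :: "'a graph"
  proof -
    obtain s t where o: "edge_orientation (verts F) (edges F) s t" and e: "\<And>e. e \<in> edges F \<Longrightarrow> e = {s e, t e}"
      using simple_graph_orientation[OF F] by blast
    have "\<bar>hom_density F (U (r i)) - hom_density F W\<bar> \<le> real (card (edges F)) * (2 * (1 / 2) ^ i)" for i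
      using counting_lemma[OF o kernel_pullback[OF gk f] wk c, of i]
      by (simp only: edge_integral_pullback[OF o gk f] hom_density_eq_edge_integral[OF U g o e]
          hom_density_eq_edge_integral[OF W o e])
    then have "(\<lambda>i. hom_density F (U (r i)) - hom_density F W) \<longlonglongrightarrow> 0"
      by (intro Lim_null_comparison[OF always_eventually lim[of "real (card (edges F))"]]) simp
    then show ?thesis by (rule LIM_zero_cancel)
  qed
  ultimately show ?thesis using that[OF r W(1)] by blast
qed

theorem theorem11:
  fixes \<F> :: "'a graph set"
    and \<delta> :: "(real \<times> real \<Rightarrow> real) \<Rightarrow> (real \<times> real \<Rightarrow> real) \<Rightarrow> real"
  assumes "\<forall>F\<in>\<F>. finite_simple_graph F"
    and "pseudometric_on graphons \<delta>"
    and "compatible_with_cut_distance \<delta>"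
    and "\<forall>U\<in>graphons. \<forall>W\<in>graphons. \<delta> U W = 0 \<longrightarrow>
           (\<forall>F\<in>\<F>. hom_density F U = hom_density F W)"
  shows "\<forall>F\<in>\<F>. \<forall>\<epsilon>>0. \<exists>\<eta>>0. \<forall>U\<in>graphons. \<forall>W\<in>graphons.
           \<delta> U W \<le> \<eta> \<longrightarrow> \<bar>hom_density F U - hom_density F W\<bar> \<le> \<epsilon>"
proof (intro ballI allI impI, rule ccontr)
  fix F and \<epsilon> :: real
  assume F: "F \<in> \<F>" and \<epsilon>: "0 < \<epsilon>"
    and "\<not> (\<exists>\<eta>>0. \<forall>U\<in>graphons. \<forall>W\<in>graphons.
           \<delta> U W \<le> \<eta> \<longrightarrow> \<bar>hom_density F U - hom_density F W\<bar> \<le> \<epsilon>)"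
  \<comment> \<open>Failure for every \<eta> is used with \<open>1 / real (Suc n)\<close>.\<close>
  then have "\<exists>U W. U \<in> graphons \<and> W \<in> graphons \<and> \<delta> U W \<le> 1 / real (Suc n) \<and>
      \<epsilon> < \<bar>hom_density F U - hom_density F W\<bar>" for n
    by (metis not_le of_nat_0_less_iff zero_less_Suc zero_less_divide_1_iff)
  then obtain U W where U: "\<And>n. U n \<in> graphons" and W: "\<And>n. W n \<in> graphons"
    and close: "\<And>n. \<delta> (U n) (W n) \<le> 1 / real (Suc n)"
    and far: "\<And>n. \<epsilon> < \<bar>hom_density F (U n) - hom_density F (W n)\<bar>" by metis
  have pm: "0 \<le> \<delta> x y" "\<delta> x y = \<delta> y x" if "x \<in> graphons" "y \<in> graphons" for x y
    using assms(2) that by (auto simp: pseudometric_on_def)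
  have tri: "\<delta> x z \<le> \<delta> x y + \<delta> y z" if "x \<in> graphons" "y \<in> graphons" "z \<in> graphons" for x y z
    using assms(2) that by (auto simp: pseudometric_on_def)
  have Fs: "finite_simple_graph F" using assms(1) F by blast
  obtain r :: "nat \<Rightarrow> nat" and U' where r: "strict_mono r" and U': "U' \<in> graphons"
    and Ulim: "(\<lambda>n. cut_distance (U (r n)) U') \<longlonglongrightarrow> 0"
    and Uhom: "(\<lambda>n. hom_density F (U (r n))) \<longlonglongrightarrow> hom_density F U'"
    by (rule graphon_sequential_compactness[of U, OF U]) (use Fs in blast)
  \<comment> \<open>The second extraction runs along the first, so that both sequences converge
    along the common subsequence \<open>k\<close>.\<close>
  obtain q :: "nat \<Rightarrow> nat" and W' where q: "strict_mono q" and W': "W' \<in> graphons"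
    and Wlim: "(\<lambda>n. cut_distance (W (r (q n))) W') \<longlonglongrightarrow> 0"
    and Whom: "(\<lambda>n. hom_density F (W (r (q n)))) \<longlonglongrightarrow> hom_density F W'"
    by (rule graphon_sequential_compactness[of "\<lambda>n. W (r n)", OF W]) (use Fs in blast)
  define k where "k n = r (q n)" for n
  have k: "strict_mono k" using r q by (simp add: k_def strict_mono_def)
  have Ulim': "(\<lambda>n. cut_distance (U (k n)) U') \<longlonglongrightarrow> 0"
    and Uhom': "(\<lambda>n. hom_density F (U (k n))) \<longlonglongrightarrow> hom_density F U'"
    using LIMSEQ_subseq_LIMSEQ[OF Ulim q] LIMSEQ_subseq_LIMSEQ[OF Uhom q] by (simp_all add: o_def k_def)
  have dU: "(\<lambda>n. \<delta> (U (k n)) U') \<longlonglongrightarrow> 0"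
    using assms(3) U U' Ulim' by (simp add: compatible_with_cut_distance_def)
  have dW: "(\<lambda>n. \<delta> (W (k n)) W') \<longlonglongrightarrow> 0"
    using assms(3) W W' Wlim by (simp add: compatible_with_cut_distance_def k_def)
  have inv: "(\<lambda>n. 1 / real (Suc (k n))) \<longlonglongrightarrow> 0"
    using LIMSEQ_subseq_LIMSEQ[OF LIMSEQ_inverse_real_of_nat k] by (simp add: o_def inverse_eq_divide)
  \<comment> \<open>The triangle inequality through \<open>U (k n)\<close> and
    \<open>W (k n)\<close> bounds the fixed number \<open>\<delta> U' W'\<close> by a null sequence,
    so the hypothesis on pairs at distance 0 becomes applicable.\<close>
  have "(\<lambda>n. \<delta> (U (k n)) U' + 1 / real (Suc (k n)) + \<delta> (W (k n)) W') \<longlonglongrightarrow> 0 + 0 + 0"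
    by (intro tendsto_add dU dW inv)
  moreover have "\<delta> U' W' \<le> \<delta> (U (k n)) U' + 1 / real (Suc (k n)) + \<delta> (W (k n)) W'" for n
    using tri[OF U' U[of "k n"] W'] tri[OF U[of "k n"] W[of "k n"] W'] pm(2)[OF U' U[of "k n"]] close[of "k n"]
    by linarith
  ultimately have "\<delta> U' W' \<le> 0" by (intro LIMSEQ_le_const[where X="\<lambda>n. _ n + _ n + _ n"]) auto
  then have "\<delta> U' W' = 0" using pm(1)[OF U' W'] by simp
  then have same: "hom_density F U' = hom_density F W'" using assms(4) U' W' F by blast
  have "(\<lambda>n. \<bar>hom_density F (U (k n)) - hom_density F (W (k n))\<bar>) \<longlonglongrightarrow> \<bar>hom_density F U' - hom_density F W'\<bar>"
    using Whom by (intro tendsto_rabs tendsto_diff Uhom') (simp add: k_def)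
  \<comment> \<open>The strict separation weakens to \<open>\<le>\<close> in the limit, which still
    contradicts equality of the limiting densities because \<epsilon> is positive.\<close>
  then have "\<epsilon> \<le> \<bar>hom_density F U' - hom_density F W'\<bar>"
    by (rule LIMSEQ_le_const) (use far in \<open>auto intro: less_imp_le\<close>)
  then show False using \<epsilon> same by simp
qed

end
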